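(* Let $k\in L^1(0,1)$ with $k(t)=t^rf(t)$, where $r>-1$, $f(0)\neq0$ and the (one-sided) derivative $f'(0)$ exists. Put $\mu=f'(0)/f(0)$ and $h(t)=f(0)t^re^{\mu t}$. Then for every $p\in[1,\infty]$: (i) $V_k^n\sim V_h^n$ on $L^p(0,1)$ as $n\to\infty$; (ii) consequently $$V_k^n\sim\frac{f(0)^n\Gamma(r+1)^n e^{-((r+1)n-1)}}{\Gamma((r+1)n)}S_{(r+1)n-1+\mu},\qquad \|V_k^n\|_p\sim\frac{C_p(|f(0)|\Gamma(r+1))^ne^{\mu}}{\Gamma((r+1)n+1)};$$ (iii) if $f_n(t)=e^{-g(n)nt}$ for $p=1$ (where $g$ is any function with $g(n)\to\infty$), $f_n(t)=e^{-((r+1)n-1+\mu)t/(p-1)}$ for $1<p<\infty$, and $f_n(t)=1$ for $p=\infty$, then $(f_n)$ is asymptotically extremal for $(V_k^n)$, i.e. $\|V_k^nf_n\|_p\sim\|V_k^n\|_p\|f_n\|_p$.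
   Context: For $k\in L^1(0,1)$, $V_k$ is the operator on $L^p(0,1)$ given by $(V_ku)(t)=\int_0^tk(t-s)u(s)\,ds$; $\|\cdot\|_p$ is the $L^p$ norm and the operator norm on $L^p(0,1)$. $(S_\lambda f)(t)=\int_0^1e^{\lambda(t-s)}f(s)\,ds$. $C_p=1/(p^{1/p}q^{1/q})$ if $1<p<\infty$ where $1/p+1/q=1$, and $C_p=1$ if $p\in\{1,\infty\}$. For operator sequences, $A_n\sim B_n$ means $\|A_n-B_n\|/\|A_n\|\to0$; for numbers, $a_n\sim b_n$ means $a_n/b_n\to1$. *)

theory Defs
  imports "HOL-Analysis.Analysis" "HOL-Probability.Essential_Supremum"
begin

definition M01 :: "real measure" where
  "M01 = restrict_space lebesgue {0<..<1}"

definition Lp :: "ereal \<Rightarrow> (real \<Rightarrow> real) set" where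
  "Lp p = {u. u \<in> borel_measurable M01 \<and>
      (if p = \<infinity> then esssup M01 (\<lambda>t. ereal \<bar>u t\<bar>) < \<infinity>
       else integrable M01 (\<lambda>t. \<bar>u t\<bar> powr real_of_ereal p))}"

definition pnorm :: "ereal \<Rightarrow> (real \<Rightarrow> real) \<Rightarrow> real" where
  "pnorm p u = (if p = \<infinity> then real_of_ereal (esssup M01 (\<lambda>t. ereal \<bar>u t\<bar>))
      else (integral\<^sup>L M01 (\<lambda>t. \<bar>u t\<bar> powr real_of_ereal p)) powr (1 / real_of_ereal p))"

definition opnorm :: "ereal \<Rightarrow> ((real \<Rightarrow> real) \<Rightarrow> (real \<Rightarrow> real)) \<Rightarrow> real" where
  "opnorm p A = Sup {pnorm p (A u) | u. u \<in> Lp p \<and> pnorm p u \<le> 1}"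

definition Vop :: "(real \<Rightarrow> real) \<Rightarrow> (real \<Rightarrow> real) \<Rightarrow> (real \<Rightarrow> real)" where
  "Vop k u = (\<lambda>t. LINT s:{0..t}|lebesgue. k (t - s) * u s)"

definition Sop :: "real \<Rightarrow> (real \<Rightarrow> real) \<Rightarrow> (real \<Rightarrow> real)" where
  "Sop lam u = (\<lambda>t. LINT s:{0..1}|lebesgue. exp (lam * (t - s)) * u s)"

definition op_scale :: "real \<Rightarrow> ((real \<Rightarrow> real) \<Rightarrow> (real \<Rightarrow> real)) \<Rightarrow> ((real \<Rightarrow> real) \<Rightarrow> (real \<Rightarrow> real))" where
  "op_scale c A = (\<lambda>u t. c * A u t)"

definition op_diff :: "((real \<Rightarrow> real) \<Rightarrow> (real \<Rightarrow> real)) \<Rightarrow> ((real \<Rightarrow> real) \<Rightarrow> (real \<Rightarrow> real)) \<Rightarrow> ((real \<Rightarrow> real) \<Rightarrow> (real \<Rightarrow> real))" where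
  "op_diff A B = (\<lambda>u t. A u t - B u t)"

definition op_asymp :: "ereal \<Rightarrow> (nat \<Rightarrow> (real \<Rightarrow> real) \<Rightarrow> (real \<Rightarrow> real)) \<Rightarrow> (nat \<Rightarrow> (real \<Rightarrow> real) \<Rightarrow> (real \<Rightarrow> real)) \<Rightarrow> bool" where
  "op_asymp p A B \<longleftrightarrow> (\<lambda>n. opnorm p (op_diff (A n) (B n)) / opnorm p (A n)) \<longlonglongrightarrow> 0"

definition num_asymp :: "(nat \<Rightarrow> real) \<Rightarrow> (nat \<Rightarrow> real) \<Rightarrow> bool" where
  "num_asymp a b \<longleftrightarrow> (\<lambda>n. a n / b n) \<longlonglongrightarrow> 1"

definition Cp :: "ereal \<Rightarrow> real" where
  "Cp p = (if p = 1 \<or> p = \<infinity> then 1 else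
     (let p' = real_of_ereal p; q = p' / (p' - 1) in 1 / (p' powr (1 / p') * q powr (1 / q))))"

end

theory Submission
  imports Defs "HOL-Real_Asymp.Real_Asymp"
begin

text \<open>
  Put \<^term>\<open>a = r + 1\<close>. All the operators involved act as convolution on \<open>(0,1)\<close> with a kernel on
  \<open>(-1,1)\<close>, so by Young's inequality it suffices to compare kernels in \<open>L\<^sup>1(-1,1)\<close> with the scale
  \<open>\<Gamma>(a)\<^sup>n / \<Gamma>(an + 1)\<close>, which is the order of both the \<open>L\<^sup>1\<close> norm and the operator norms.

  Assume \<open>f(0) = 1\<close>. The powers of \<open>t\<^bsup>a-1\<^esup>e\<^bsup>ct\<^esup>\<close> are explicit, because \<open>t\<^bsup>a-1\<^esup>/\<Gamma>(a)\<close> is a convolution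
  semigroup in \<open>a\<close>. Near \<open>0\<close> the kernel \<open>k\<close> differs from \<open>h = t\<^bsup>a-1\<^esup>e\<^bsup>\<mu>t\<^esup>\<close> by at most
  \<open>t\<^bsup>a-1\<^esup>e\<^bsup>(\<mu>+\<epsilon>)t\<^esup> - h\<close>, whose effect on the \<open>n\<close>-th power is to multiply \<open>h\<^sup>n\<close> by at most \<open>e\<^sup>\<epsilon>\<close>. The part
  of \<open>k - h\<close> supported in \<open>[\<delta>,1)\<close> contributes an exponentially small relative error, as one sees from
  Laplace transforms at \<open>\<lambda> = an + \<mu> + \<epsilon>\<close>: passing back to \<open>L\<^sup>1\<close> loses only a factor polynomial in \<open>n\<close>.
  Finally \<open>x\<^sup>N\<close> is replaced by \<open>e\<^bsup>N(x-1)\<^esup> \<ge> x\<^sup>N\<close>, where \<open>N = an - 1\<close>, at a cost \<open>1/N - 1/(N+1)\<close>. This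
  turns \<open>V\<^sub>h\<^sup>n\<close> into a multiple of the rank one operator \<open>S\<^bsub>N+\<mu>\<^esub>\<close>, whose norm and extremal functions are
  those of Hoelder's inequality.
\<close>

section \<open>Convolution of nonnegative kernels\<close>

text \<open>Multiplication by exp(ct) commutes with convolution. Hence changing \<open>\<mu>\<close>
  to \<open>\<mu> + \<epsilon>\<close> in all n factors multiplies the n-th power by
  exp(\<epsilon>t) once, not by exp(n\<epsilon>t). The two errors need different tools. A Laplace
  estimate of the part near 0 would leave a quantity of fixed order \<open>\<epsilon>\<close> times
  the polynomial loss, which does not tend to 0, so that part is compared pointwise. The far part is
  merely integrable, so no pointwise bound exists, but its Laplace transform is exponentially small.
  Powers are therefore compared in two stages, through the kernel with
  \<open>\<mu> + \<epsilon>\<close>. Signs of k - h are given up at once in favour of majorants with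
  values in \<open>ennreal\<close>: Tonelli then has no side conditions, and integrability of the
  actual convolutions is recovered almost everywhere from finite Laplace transforms. The parameter
  an + c is the minimiser of exp(\<lambda>) (\<lambda> - c)^(-an), the factor by which a Laplace
  transform controls the mass on [0,1].\<close>

definition nnconv :: "(real \<Rightarrow> ennreal) \<Rightarrow> (real \<Rightarrow> ennreal) \<Rightarrow> real \<Rightarrow> ennreal" where
  "nnconv f g t = (\<integral>\<^sup>+s. f (t - s) * g s \<partial>lborel)"

text \<open>Two-sided as written, but the kernels and functions of the application vanish on the
  negative half line, so this is the usual Laplace transform. A finite value at one parameter serves
  throughout as the integrability condition.\<close>

definition laplace :: "real \<Rightarrow> (real \<Rightarrow> ennreal) \<Rightarrow> ennreal" where
  "laplace c f = (\<integral>\<^sup>+t. ennreal (exp (- c * t)) * f t \<partial>lborel)"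

lemma measurable_nnconv [measurable]:
  assumes [measurable]: "f \<in> borel_measurable borel" "g \<in> borel_measurable borel"
  shows "nnconv f g \<in> borel_measurable borel"
  unfolding nnconv_def by measurable

lemma nn_integral_lborel_shift:
  fixes f :: "real \<Rightarrow> ennreal"
  assumes [measurable]: "f \<in> borel_measurable borel"
  shows "(\<integral>\<^sup>+x. f (x - t) \<partial>lborel) = (\<integral>\<^sup>+x. f x \<partial>lborel)"
  using nn_integral_real_affine[OF assms, of 1 "- t"] by simp

lemma nn_integral_lborel_reflect:
  fixes f :: "real \<Rightarrow> ennreal"
  assumes [measurable]: "f \<in> borel_measurable borel"
  shows "(\<integral>\<^sup>+x. f (t - x) \<partial>lborel) = (\<integral>\<^sup>+x. f x \<partial>lborel)"
  using nn_integral_real_affine[OF assms, of "-1" "t"] by simp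

lemma nnconv_assoc:
  assumes [measurable]: "f \<in> borel_measurable borel" "g \<in> borel_measurable borel" "h \<in> borel_measurable borel"
  shows "nnconv f (nnconv g h) = nnconv (nnconv f g) h"
proof
  fix t
  have "nnconv f (nnconv g h) t = (\<integral>\<^sup>+s. \<integral>\<^sup>+x. f (t - s) * (g (s - x) * h x) \<partial>lborel \<partial>lborel)"
    unfolding nnconv_def by (subst nn_integral_cmult) auto
  also have "\<dots> = (\<integral>\<^sup>+x. \<integral>\<^sup>+s. f (t - s) * (g (s - x) * h x) \<partial>lborel \<partial>lborel)"
    by (rule lborel_pair.Fubini') measurable
  also have "\<dots> = (\<integral>\<^sup>+x. (\<integral>\<^sup>+s. f (t - s) * g (s - x) \<partial>lborel) * h x \<partial>lborel)"
    by (subst nn_integral_multc[symmetric]) (auto simp: mult_ac)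
  also have "\<dots> = (\<integral>\<^sup>+x. nnconv f g (t - x) * h x \<partial>lborel)"
  proof -
    have "(\<integral>\<^sup>+s. f (t - s) * g (s - x) \<partial>lborel) = nnconv f g (t - x)" for x
      unfolding nnconv_def
      using nn_integral_lborel_shift[of "\<lambda>s. f (t - x - s) * g s" x] by (simp add: algebra_simps)
    then show ?thesis by simp
  qed
  finally show "nnconv f (nnconv g h) t = nnconv (nnconv f g) h t"
    by (simp add: nnconv_def)
qed

lemma nnconv_add_left:
  assumes [measurable]: "f \<in> borel_measurable borel" "g \<in> borel_measurable borel" "h \<in> borel_measurable borel"
  shows "nnconv (\<lambda>x. f x + g x) h = (\<lambda>x. nnconv f h x + nnconv g h x)"
  unfolding nnconv_def by (auto simp: distrib_right nn_integral_add)

lemma nnconv_add_right: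
  assumes [measurable]: "f \<in> borel_measurable borel" "g \<in> borel_measurable borel" "h \<in> borel_measurable borel"
  shows "nnconv f (\<lambda>x. g x + h x) = (\<lambda>x. nnconv f g x + nnconv f h x)"
  unfolding nnconv_def by (auto simp: distrib_left nn_integral_add)

lemma nnconv_cmult_left:
  assumes [measurable]: "f \<in> borel_measurable borel" "g \<in> borel_measurable borel"
  shows "nnconv (\<lambda>x. c * f x) g = (\<lambda>x. c * nnconv f g x)"
  unfolding nnconv_def by (auto simp: mult.assoc nn_integral_cmult)

lemma nnconv_cmult_right:
  assumes [measurable]: "f \<in> borel_measurable borel" "g \<in> borel_measurable borel"
  shows "nnconv f (\<lambda>x. c * g x) = (\<lambda>x. c * nnconv f g x)"
  unfolding nnconv_def by (auto simp: mult.left_commute nn_integral_cmult)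

text \<open>Holds because exp(c(t - s)) exp(cs) = exp(ct). It is used twice: with a negative
  exponent to make the Laplace transform multiplicative, and with a general one to reduce powers of
  the model kernel to the case without exponential.\<close>

lemma nnconv_exp:
  assumes [measurable]: "f \<in> borel_measurable borel" "g \<in> borel_measurable borel"
  shows "nnconv (\<lambda>x. ennreal (exp (c * x)) * f x) (\<lambda>x. ennreal (exp (c * x)) * g x)
     = (\<lambda>x. ennreal (exp (c * x)) * nnconv f g x)"
proof
  fix t
  have "ennreal (exp (c * (t - s))) * f (t - s) * (ennreal (exp (c * s)) * g s)
     = ennreal (exp (c * t)) * (f (t - s) * g s)" for s
  proof -
    have "ennreal (exp (c * t)) = ennreal (exp (c * (t - s))) * ennreal (exp (c * s))"
      by (simp add: ennreal_mult'[symmetric] exp_add[symmetric] algebra_simps)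
    then show ?thesis by (simp add: mult_ac)
  qed
  then show "nnconv (\<lambda>x. ennreal (exp (c * x)) * f x) (\<lambda>x. ennreal (exp (c * x)) * g x) t
     = ennreal (exp (c * t)) * nnconv f g t"
    unfolding nnconv_def by (simp add: nn_integral_cmult)
qed

lemma nn_integral_nnconv:
  assumes [measurable]: "f \<in> borel_measurable borel" "g \<in> borel_measurable borel"
  shows "(\<integral>\<^sup>+t. nnconv f g t \<partial>lborel) = (\<integral>\<^sup>+t. f t \<partial>lborel) * (\<integral>\<^sup>+t. g t \<partial>lborel)"
proof -
  have "(\<integral>\<^sup>+t. nnconv f g t \<partial>lborel) = (\<integral>\<^sup>+s. \<integral>\<^sup>+t. f (t - s) * g s \<partial>lborel \<partial>lborel)"
    unfolding nnconv_def by (rule lborel_pair.Fubini') measurable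
  also have "\<dots> = (\<integral>\<^sup>+s. (\<integral>\<^sup>+t. f t \<partial>lborel) * g s \<partial>lborel)"
    by (simp add: nn_integral_multc nn_integral_lborel_shift)
  finally show ?thesis by (simp add: nn_integral_cmult)
qed

lemma laplace_nnconv:
  assumes [measurable]: "f \<in> borel_measurable borel" "g \<in> borel_measurable borel"
  shows "laplace c (nnconv f g) = laplace c f * laplace c g"
proof -
  have "laplace c (nnconv f g)
      = (\<integral>\<^sup>+t. nnconv (\<lambda>x. ennreal (exp (- c * x)) * f x) (\<lambda>x. ennreal (exp (- c * x)) * g x) t \<partial>lborel)"
    unfolding laplace_def by (subst nnconv_exp) auto
  also have "\<dots> = laplace c f * laplace c g"
    unfolding laplace_def by (rule nn_integral_nnconv) auto
  finally show ?thesis .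
qed

lemma laplace_add:
  assumes [measurable]: "f \<in> borel_measurable borel" "g \<in> borel_measurable borel"
  shows "laplace c (\<lambda>x. f x + g x) = laplace c f + laplace c g"
  unfolding laplace_def by (simp add: distrib_left nn_integral_add)

text \<open>The exponential weight is strictly positive, so it cannot hide an infinite value.
  Through this lemma, finite Laplace transforms become integrability of convolution integrands at
  almost every point.\<close>

lemma AE_less_top_of_laplace:
  assumes [measurable]: "f \<in> borel_measurable borel" and "laplace c f < \<infinity>"
  shows "AE t in lborel. f t < \<infinity>"
proof -
  have "AE t in lborel. ennreal (exp (- c * t)) * f t \<noteq> \<infinity>"
    using assms(2) unfolding laplace_def by (intro nn_integral_PInf_AE) auto
  then show ?thesis
    by eventually_elim (auto simp: ennreal_mult_eq_top_iff less_top[symmetric])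
qed

lemma nnconv_mono_AE:
  assumes [measurable]: "f \<in> borel_measurable borel"
    and "AE x in lborel. g x \<le> h x"
  shows "nnconv f g t \<le> nnconv f h t"
  unfolding nnconv_def using assms(2)
  by (intro nn_integral_mono_AE) (auto elim!: eventually_mono intro: mult_left_mono)

section \<open>Convolution powers and the remainder of a perturbed power\<close>

text \<open>Indices are shifted: \<open>nnpow f n\<close> is the \<open>(n + 1)\<close>-fold convolution power of \<open>f\<close>, and \<open>nnrem f g n\<close> is the
  difference of these powers of \<open>f + g\<close> and \<open>f\<close>, defined without subtraction.\<close>

primrec nnpow :: "(real \<Rightarrow> ennreal) \<Rightarrow> nat \<Rightarrow> real \<Rightarrow> ennreal" where
  "nnpow f 0 = f"
| "nnpow f (Suc n) = nnconv f (nnpow f n)"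

primrec nnrem :: "(real \<Rightarrow> ennreal) \<Rightarrow> (real \<Rightarrow> ennreal) \<Rightarrow> nat \<Rightarrow> real \<Rightarrow> ennreal" where
  "nnrem f g 0 = g"
| "nnrem f g (Suc n) = (\<lambda>x. nnconv (\<lambda>x. f x + g x) (nnrem f g n) x + nnconv g (nnpow f n) x)"

lemma measurable_nnpow [measurable]:
  assumes [measurable]: "f \<in> borel_measurable borel"
  shows "nnpow f n \<in> borel_measurable borel"
  by (induction n) (auto intro: measurable_nnconv)

lemma measurable_nnrem [measurable]:
  assumes [measurable]: "f \<in> borel_measurable borel" "g \<in> borel_measurable borel"
  shows "nnrem f g n \<in> borel_measurable borel"
proof (induction n)
  case (Suc n)
  note [measurable] = Suc.IH
  show ?case by simp
qed simp

text \<open>Write P for the power of \<open>f\<close> and R for the remainder. Expanding (f + g)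
  convolved with P + R gives the next power of \<open>f\<close>, plus g convolved with P, plus (f +
  g) convolved with R; the last two terms are the recursion of \<open>nnrem\<close>. Only addition
  occurs, so infinite values do no harm.\<close>

lemma nnpow_add_nnrem:
  assumes [measurable]: "f \<in> borel_measurable borel" "g \<in> borel_measurable borel"
  shows "nnpow (\<lambda>x. f x + g x) n = (\<lambda>x. nnpow f n x + nnrem f g n x)"
proof (induction n)
  case (Suc n)
  have "nnpow (\<lambda>x. f x + g x) (Suc n) = nnconv (\<lambda>x. f x + g x) (\<lambda>x. nnpow f n x + nnrem f g n x)"
    using Suc by simp
  also have "\<dots> = (\<lambda>x. nnconv (\<lambda>x. f x + g x) (nnpow f n) x + nnconv (\<lambda>x. f x + g x) (nnrem f g n) x)"
    by (rule nnconv_add_right) measurable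
  also have "nnconv (\<lambda>x. f x + g x) (nnpow f n) = (\<lambda>x. nnconv f (nnpow f n) x + nnconv g (nnpow f n) x)"
    by (rule nnconv_add_left) measurable
  finally show ?case by (simp add: add_ac)
qed simp

lemma laplace_nnpow:
  assumes [measurable]: "f \<in> borel_measurable borel"
  shows "laplace c (nnpow f n) = laplace c f ^ Suc n"
  by (induction n) (auto simp: laplace_nnconv)

section \<open>The semigroup of Riemann-Liouville kernels and its Laplace transform\<close>

lemma nnconv_powr:
  fixes a b :: real
  assumes a: "a > 0" and b: "b > 0"
  shows "nnconv (\<lambda>t. ennreal (if t > 0 then t powr (a - 1) / Gamma a else 0))
      (\<lambda>t. ennreal (if t > 0 then t powr (b - 1) / Gamma b else 0)) u
    = ennreal (if u > 0 then u powr (a + b - 1) / Gamma (a + b) else 0)"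
proof (cases "u > 0")
  case False
  have "nnconv (\<lambda>t. ennreal (if t > 0 then t powr (a - 1) / Gamma a else 0))
      (\<lambda>t. ennreal (if t > 0 then t powr (b - 1) / Gamma b else 0)) u = (\<integral>\<^sup>+s. 0 \<partial>(lborel :: real measure))"
    unfolding nnconv_def using False by (intro nn_integral_cong) auto
  then show ?thesis using False by simp
next
  case u: True
  define F where "F s = ennreal ((u - s) powr (a - 1) / Gamma a * (s powr (b - 1) / Gamma b) * indicator {0<..<u} s)" for s
  have [measurable]: "F \<in> borel_measurable borel" unfolding F_def by measurable
  have "nnconv (\<lambda>t. ennreal (if t > 0 then t powr (a - 1) / Gamma a else 0))
      (\<lambda>t. ennreal (if t > 0 then t powr (b - 1) / Gamma b else 0)) u = (\<integral>\<^sup>+s. F s \<partial>lborel)"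
    unfolding nnconv_def F_def using a b
    by (intro nn_integral_cong) (auto simp: ennreal_mult''[symmetric] indicator_def)
  \<comment> \<open>The substitution s = ux extracts the power of u and leaves the Beta integral,
    whose value Gamma a Gamma b / Gamma (a + b) cancels the normalisation of the two
    kernels.\<close>
  also have "\<dots> = ennreal u * (\<integral>\<^sup>+x. F (u * x) \<partial>lborel)"
    using nn_integral_real_affine[of F u 0] u by simp
  also have "(\<integral>\<^sup>+x. F (u * x) \<partial>lborel) = (\<integral>\<^sup>+x. ennreal (u powr (a + b - 2) / (Gamma a * Gamma b))
       * ennreal (indicator {0..1} x * (x powr (b - 1) * (1 - x) powr (a - 1))) \<partial>lborel)"
  proof (intro nn_integral_cong_AE)
    show "AE x in lborel. F (u * x) = ennreal (u powr (a + b - 2) / (Gamma a * Gamma b))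
       * ennreal (indicator {0..1} x * (x powr (b - 1) * (1 - x) powr (a - 1)))"
      using AE_lborel_singleton[of 0] AE_lborel_singleton[of 1]
    proof eventually_elim
      case (elim x)
      show ?case
      proof (cases "0 < x \<and> x < 1")
        case True
        have "u - u * x = u * (1 - x)" by (simp add: algebra_simps)
        then have "(u - u * x) powr (a - 1) * (u * x) powr (b - 1)
            = u powr (a + b - 2) * (x powr (b - 1) * (1 - x) powr (a - 1))"
          using u True by (simp add: powr_mult powr_add[symmetric] mult_ac)
        moreover have "u * x < u" "0 < u * x" using u True by auto
        ultimately show ?thesis using True a b
          by (simp add: F_def ennreal_mult'[symmetric] divide_simps)
      next
        case False
        then have "\<not> (0 < u * x \<and> u * x < u)" using u by (auto simp: zero_less_mult_iff)
        then show ?thesis using False elim by (auto simp: F_def indicator_def)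
      qed
    qed
  qed
  also have "\<dots> = ennreal (u powr (a + b - 2) / (Gamma a * Gamma b)) * ennreal (Beta b a)"
    using nn_integral_has_integral_lebesgue[OF _ has_integral_Beta_real[OF b a]]
    by (subst nn_integral_cmult) auto
  also have "\<dots> = ennreal (u powr (a + b - 2) / Gamma (a + b))"
    using a b less_imp_neq[OF Gamma_real_pos[OF a]] less_imp_neq[OF Gamma_real_pos[OF b]]
    by (subst ennreal_mult'[symmetric])
      (auto simp: Beta_def add.commute)
  also have "ennreal u * \<dots> = ennreal (u powr (a + b - 1) / Gamma (a + b))"
    using u a b powr_add[of u 1 "a + b - 2"] by (subst ennreal_mult'[symmetric]) (auto simp: add.commute)
  finally show ?thesis using u by simp
qed

text \<open>The Riemann-Liouville kernel of order \<open>b\<close>, twisted by an exponential. The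
  value 0 for t \<le> 0 turns the Volterra integral over [0,t] into a convolution on the whole
  line.\<close>

definition pker :: "real \<Rightarrow> real \<Rightarrow> real \<Rightarrow> real" where
  "pker c b t = (if t > 0 then exp (c * t) * t powr (b - 1) / Gamma b else 0)"

lemma measurable_pker [measurable]: "pker c b \<in> borel_measurable borel"
  unfolding pker_def by measurable

lemma pker_nonneg: "b > 0 \<Longrightarrow> pker c b t \<ge> 0"
  by (auto simp: pker_def)

lemma nnconv_pker:
  assumes a: "a > 0" and b: "b > 0"
  shows "nnconv (\<lambda>t. ennreal (pker c a t)) (\<lambda>t. ennreal (pker c b t)) = (\<lambda>t. ennreal (pker c (a + b) t))"
proof -
  have eq: "ennreal (pker c b t) = ennreal (exp (c * t)) * ennreal (if t > 0 then t powr (b - 1) / Gamma b else 0)" for b t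
    by (auto simp: pker_def ennreal_mult'[symmetric])
  show ?thesis
    unfolding eq using a b by (subst nnconv_exp) (auto simp: nnconv_powr)
qed

lemma nnpow_pker:
  assumes a: "a > 0" and C: "C \<ge> 0"
  shows "nnpow (\<lambda>t. ennreal (C * pker c a t)) n = (\<lambda>t. ennreal (C ^ Suc n * pker c (a * Suc n) t))"
proof (induction n)
  case (Suc n)
  have "nnpow (\<lambda>t. ennreal (C * pker c a t)) (Suc n)
     = nnconv (\<lambda>t. ennreal C * ennreal (pker c a t)) (\<lambda>t. ennreal (C ^ Suc n) * ennreal (pker c (a * Suc n) t))"
    using Suc C by (simp add: ennreal_mult')
  also have "\<dots> = (\<lambda>t. ennreal C * (ennreal (C ^ Suc n) * ennreal (pker c (a + a * Suc n) t)))"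
    using a by (subst nnconv_cmult_left; measurable?)
      (subst nnconv_cmult_right; measurable?; subst nnconv_pker; simp add: add_pos_nonneg)
  also have "\<dots> = (\<lambda>t. ennreal (C ^ Suc (Suc n) * pker c (a * Suc (Suc n)) t))"
    using C by (simp add: ennreal_mult'[symmetric] algebra_simps)
  finally show ?case .
qed simp

text \<open>Euler's integral for Gamma after rescaling t by m = l - c.\<close>

lemma laplace_pker:
  assumes b: "b > 0" and l: "l > c"
  shows "laplace l (\<lambda>t. ennreal (pker c b t)) = ennreal ((l - c) powr (- b))"
proof -
  define m where "m = l - c"
  have m: "m > 0" using l by (simp add: m_def)
  define F where "F t = ennreal (indicator {0..} t * t powr (b - 1) / exp t)" for t :: real
  have [measurable]: "F \<in> borel_measurable borel" unfolding F_def by measurable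
  have eq: "ennreal (exp (- l * t)) * ennreal (pker c b t) = ennreal (m powr (1 - b) / Gamma b) * F (m * t)" if "t \<noteq> 0" for t
  proof (cases "t > 0")
    case True
    have "exp (- l * t) * exp (c * t) = exp (- (m * t))"
      by (simp add: m_def exp_add[symmetric] algebra_simps)
    moreover have "m powr (1 - b) * (m * t) powr (b - 1) = t powr (b - 1)"
      using True m by (simp add: powr_mult powr_diff)
    ultimately show ?thesis using True m b
      by (simp add: pker_def F_def ennreal_mult'[symmetric] exp_minus divide_simps mult_ac)
  next
    case False
    then have "m * t < 0" using m that by (simp add: mult_less_0_iff)
    with False show ?thesis by (auto simp: pker_def F_def)
  qed
  have "laplace l (\<lambda>t. ennreal (pker c b t)) = (\<integral>\<^sup>+t. ennreal (m powr (1 - b) / Gamma b) * F (m * t) \<partial>lborel)"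
    unfolding laplace_def using AE_lborel_singleton[of "0::real"] eq
    by (intro nn_integral_cong_AE) (auto elim!: eventually_mono)
  also have "\<dots> = ennreal (m powr (1 - b) / Gamma b) * (\<integral>\<^sup>+t. F (m * t) \<partial>lborel)"
    by (rule nn_integral_cmult) auto
  also have "(\<integral>\<^sup>+t. F (m * t) \<partial>lborel) = ennreal (Gamma b / m)"
  proof -
    have "ennreal (Gamma b) = ennreal m * (\<integral>\<^sup>+t. F (m * t) \<partial>lborel)"
      using nn_integral_real_affine[of F m 0] m Gamma_conv_nn_integral_real[OF b] by (simp add: F_def)
    then have "ennreal (1/m) * ennreal (Gamma b) = ennreal (1/m) * ennreal m * (\<integral>\<^sup>+t. F (m * t) \<partial>lborel)"
      by (simp add: mult.assoc)
    then show ?thesis using m b by (simp add: ennreal_mult'[symmetric])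
  qed
  also have "ennreal (m powr (1 - b) / Gamma b) * \<dots> = ennreal (m powr (-b))"
    using m b less_imp_neq[OF Gamma_real_pos[OF b]] by (subst ennreal_mult'[symmetric]) (auto simp: powr_diff powr_minus divide_simps)
  finally show ?thesis by (simp add: m_def)
qed

section \<open>Perturbed powers of the model kernel\<close>

lemma Gamma_upper_bound:
  fixes x :: real
  assumes x: "x > 0"
  shows "Gamma (x + 1) \<le> (x + 1) * exp (1 - x) * x powr x"
proof -
  define l where "l = 1 / (x + 1)"
  have l: "l > 0" using x by (simp add: l_def)
  have pt: "t powr x / exp t \<le> exp (1 - x) * x powr x * exp (- l * t)" if t: "t > 0" for t
  proof -
    have "ln (t / (x + 1)) \<le> t / (x + 1) - 1"
      using t x by (intro ln_le_minus_one) auto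
    then have "x * ln (t / (x + 1)) \<le> x * (t / (x + 1) - 1)" using x by (intro mult_left_mono) auto
    moreover have "x * (t / (x + 1) - 1) = t - l * t - x" using x by (simp add: l_def divide_simps) (simp add: algebra_simps)
    moreover have "x * ln ((x + 1) / x) \<le> x * ((x + 1) / x - 1)"
      using x by (intro mult_left_mono ln_le_minus_one) auto
    moreover have "x * ((x + 1) / x - 1) = 1" using x by (simp add: field_simps)
    ultimately have "x * ln t \<le> 1 - x + x * ln x + t - l * t"
      using t x by (simp add: ln_div algebra_simps)
    then have "exp (x * ln t - t) \<le> exp (1 - x + x * ln x + (- l * t))" by simp
    then show ?thesis using t x by (simp add: powr_def exp_diff exp_add exp_minus divide_inverse mult_ac)
  qed
  have "ennreal (Gamma (x + 1)) = (\<integral>\<^sup>+t. ennreal (indicator {0..} t * t powr x / exp t) \<partial>lborel)"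
    using Gamma_conv_nn_integral_real[of "x + 1"] x by simp
  also have "\<dots> \<le> (\<integral>\<^sup>+t. ennreal (exp (1 - x) * x powr x) * (ennreal (exp (- l * t)) * ennreal (pker 0 1 t)) \<partial>lborel)"
  proof (rule nn_integral_mono)
    fix t :: real
    show "ennreal (indicator {0..} t * t powr x / exp t)
       \<le> ennreal (exp (1 - x) * x powr x) * (ennreal (exp (- l * t)) * ennreal (pker 0 1 t))"
      using pt[of t] by (cases "t > 0") (auto simp: pker_def ennreal_mult'[symmetric] indicator_def)
  qed
  also have "\<dots> = ennreal (exp (1 - x) * x powr x) * laplace l (\<lambda>t. ennreal (pker 0 1 t))"
    unfolding laplace_def by (rule nn_integral_cmult) auto
  also have "\<dots> = ennreal (exp (1 - x) * x powr x * (x + 1))"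
    using x l by (simp add: laplace_pker ennreal_mult'[symmetric] l_def powr_minus del: ennreal_plus)
  finally show ?thesis using x by (simp add: ennreal_le_iff mult_ac)
qed

section \<open>Mass up to time 1 against Laplace transforms\<close>

lemma nn_integral_pker_atMost_1:
  assumes b: "b > 0"
  shows "(\<integral>\<^sup>+t. ennreal (pker 0 b t) * indicator {..1} t \<partial>lborel) = ennreal (1 / Gamma (b + 1))"
proof -
  have "((\<lambda>t. t powr (b - 1)) has_integral (1 powr (b - 1 + 1) / (b - 1 + 1))) {0..1}"
    using b by (intro has_integral_powr_from_0) auto
  then have 1: "((\<lambda>t. t powr (b - 1)) has_integral (1 / b)) {0..1}" by simp
  have "(\<integral>\<^sup>+t. ennreal (pker 0 b t) * indicator {..1} t \<partial>lborel)
     = (\<integral>\<^sup>+t. ennreal (1 / Gamma b) * ennreal (indicator {0..1} t * t powr (b - 1)) \<partial>lborel)"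
    using b by (intro nn_integral_cong) (auto simp: pker_def indicator_def ennreal_mult'[symmetric])
  also have "\<dots> = ennreal (1 / Gamma b) * ennreal (1 / b)"
    using nn_integral_has_integral_lebesgue[OF _ 1] by (subst nn_integral_cmult) auto
  also have "\<dots> = ennreal (1 / Gamma (b + 1))"
    using b Gamma_plus1[of b] by (subst ennreal_mult'[symmetric]) (auto simp: nonpos_Ints_def mult_ac)
  finally show ?thesis .
qed

text \<open>The weight is at most exp(-l\<delta>) on the support: this is the exponential gain for
  mass bounded away from 0. The case \<delta> = 0 serves later as a plain finiteness
  statement.\<close>

lemma laplace_supported_atLeast:
  assumes [measurable]: "d \<in> borel_measurable borel"
    and l: "l \<ge> 0" and supp: "\<And>t. t < \<delta> \<Longrightarrow> d t = 0"
  shows "laplace l d \<le> ennreal (exp (- l * \<delta>)) * (\<integral>\<^sup>+t. d t \<partial>lborel)"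
proof -
  have "laplace l d \<le> (\<integral>\<^sup>+t. ennreal (exp (- l * \<delta>)) * d t \<partial>lborel)"
    unfolding laplace_def
  proof (rule nn_integral_mono)
    fix t :: real
    show "ennreal (exp (- l * t)) * d t \<le> ennreal (exp (- l * \<delta>)) * d t"
      using supp[of t] l by (cases "t < \<delta>") (auto intro!: mult_right_mono simp: mult_left_mono)
  qed
  then show ?thesis by (simp add: nn_integral_cmult)
qed

text \<open>A Chernoff bound: 1 \<le> exp(l) exp(-lt) for t \<le> 1.\<close>

lemma nn_integral_atMost_1_le_laplace:
  assumes [measurable]: "f \<in> borel_measurable borel" and l: "l \<ge> 0"
  shows "(\<integral>\<^sup>+t. f t * indicator {..1} t \<partial>lborel) \<le> ennreal (exp l) * laplace l f"
proof -
  have "(\<integral>\<^sup>+t. f t * indicator {..1} t \<partial>lborel) \<le> (\<integral>\<^sup>+t. ennreal (exp l) * (ennreal (exp (- l * t)) * f t) \<partial>lborel)"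
  proof (rule nn_integral_mono)
    fix t :: real
    show "f t * indicator {..1} t \<le> ennreal (exp l) * (ennreal (exp (- l * t)) * f t)"
    proof (cases "t \<le> 1")
      case True
      have "l * t \<le> l * 1" using l True by (intro mult_left_mono) auto
      then have "1 \<le> exp l * exp (- l * t)" by (simp add: exp_add[symmetric])
      then have "ennreal 1 * f t \<le> ennreal (exp l * exp (- l * t)) * f t"
        by (intro mult_right_mono ennreal_leI) auto
      then show ?thesis using True by (simp add: ennreal_mult' mult_ac)
    qed auto
  qed
  then show ?thesis by (simp add: laplace_def nn_integral_cmult)
qed

text \<open>From 1 + z \<le> exp z. Written as a relative error, it shows that a perturbation y of x
  is negligible in the n-th power once ny/x tends to 0.\<close>

lemma power_add_diff_le_exp:
  fixes x y :: real
  assumes "x > 0" "y \<ge> 0"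
  shows "(x + y) ^ n - x ^ n \<le> x ^ n * (exp (n * (y / x)) - 1)"
proof -
  have "(x + y) ^ n = x ^ n * (1 + y / x) ^ n"
    using assms by (simp add: power_mult_distrib[symmetric] field_simps)
  also have "(1 + y / x) ^ n \<le> exp (y / x) ^ n"
    using assms by (intro power_mono exp_ge_add_one_self) auto
  also have "exp (y / x) ^ n = exp (n * (y / x))"
    by (rule exp_of_nat_mult[symmetric])
  finally show ?thesis using assms by (simp add: right_diff_distrib)
qed

text \<open>Multiplicativity gives the Laplace transform of the remainder as (x + y)^(n+1) -
  x^(n+1), where x belongs to the model kernel and y, exponentially small, bounds that of
  \<open>d\<close>. The Chernoff bound returns to mass on \<open>{..1}\<close>, and
  \<open>Gamma_upper_bound\<close> shows that this costs only exp(c + 1)(N + 1) relative to the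
  natural scale.\<close>

lemma nnrem_bound_far:
  fixes a c M \<delta> :: real
  assumes a: "a > 0" and [measurable]: "d \<in> borel_measurable borel"
    and M: "(\<integral>\<^sup>+t. d t \<partial>lborel) \<le> ennreal M" "M \<ge> 0"
    and supp: "\<And>t. t < \<delta> \<Longrightarrow> d t = 0" and pos: "a * Suc n + c \<ge> 0"
  shows "(\<integral>\<^sup>+t. nnrem (\<lambda>t. ennreal (Gamma a * pker c a t)) d n t * indicator {..1} t \<partial>lborel)
     \<le> ennreal (Gamma a ^ Suc n / Gamma (a * Suc n + 1) * (exp (c + 1) * (a * Suc n + 1)
         * (exp (Suc n * (M * exp (- (a * Suc n + c) * \<delta>) * (a * Suc n) powr a / Gamma a)) - 1)))"
proof -
  define N where "N = a * Suc n"
  \<comment> \<open>This \<open>l\<close> minimises exp(l) (l - c)^(-N), the bound that the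
    transform gives for the unperturbed power.\<close>
  define l where "l = N + c"
  define A where "A = (\<lambda>t. ennreal (Gamma a * pker c a t))"
  define Q where "Q = nnrem A d n"
  define x where "x = Gamma a * N powr (- a)"
  define y where "y = M * exp (- l * \<delta>)"
  have N: "N > 0" using a by (simp add: N_def)
  have G: "Gamma a > 0" using a by simp
  have x: "x > 0" using G N by (simp add: x_def)
  have y: "y \<ge> 0" using M by (simp add: y_def)
  have l: "l \<ge> 0" using pos by (simp add: l_def N_def)
  have [measurable]: "A \<in> borel_measurable borel" "Q \<in> borel_measurable borel"
    unfolding A_def Q_def by measurable
  have LA: "laplace l A = ennreal x"
  proof -
    have "laplace l A = ennreal (Gamma a) * laplace l (\<lambda>t. ennreal (pker c a t))"
      unfolding A_def laplace_def using G
      by (subst nn_integral_cmult[symmetric]) (auto simp: ennreal_mult' mult_ac)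
    also have "\<dots> = ennreal x" using a N
      by (subst laplace_pker) (auto simp: l_def x_def ennreal_mult')
    finally show ?thesis .
  qed
  have Ld: "laplace l d \<le> ennreal y"
  proof -
    have "laplace l d \<le> ennreal (exp (- l * \<delta>)) * (\<integral>\<^sup>+t. d t \<partial>lborel)"
      by (intro laplace_supported_atLeast l supp) auto
    also have "\<dots> \<le> ennreal (exp (- l * \<delta>)) * ennreal M" by (intro mult_left_mono M) auto
    finally show ?thesis using M by (simp add: y_def ennreal_mult'[symmetric] mult_ac)
  qed
  \<comment> \<open>The transform of the perturbed power is computed in two ways, as a power of a
    sum and through the remainder; the finite term x^(n+1) is then cancelled.\<close>
  have "laplace l (nnpow (\<lambda>x. A x + d x) n) = (laplace l A + laplace l d) ^ Suc n"
    by (subst laplace_nnpow) (auto simp: laplace_add)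
  moreover have "laplace l (nnpow (\<lambda>x. A x + d x) n) = laplace l (nnpow A n) + laplace l Q"
    unfolding Q_def by (subst nnpow_add_nnrem) (auto intro!: laplace_add)
  ultimately have "ennreal (x ^ Suc n) + laplace l Q = (ennreal x + laplace l d) ^ Suc n"
    using x by (simp add: LA laplace_nnpow ennreal_power[symmetric] ennreal_mult')
  also have "\<dots> \<le> (ennreal x + ennreal y) ^ Suc n"
    by (intro power_mono add_left_mono Ld) auto
  also have "\<dots> = ennreal ((x + y) ^ Suc n)" using x y by (simp add: ennreal_power ennreal_plus[symmetric] del: ennreal_plus power_Suc)
  also have "\<dots> \<le> ennreal (x ^ Suc n + x ^ Suc n * (exp (Suc n * (y / x)) - 1))"
    using power_add_diff_le_exp[OF x y, of "Suc n"] by (intro ennreal_leI) linarith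
  also have "\<dots> = ennreal (x ^ Suc n) + ennreal (x ^ Suc n * (exp (Suc n * (y / x)) - 1))"
    using x y by (intro ennreal_plus) auto
  finally have LQ: "laplace l Q \<le> ennreal (x ^ Suc n * (exp (Suc n * (y / x)) - 1))"
    by (simp add: ennreal_add_left_cancel_le)
  \<comment> \<open>Since x^(n+1) = Gamma(a)^(n+1) N^(-N), the left side contains exp(N) / N^N,
    which the Stirling bound compares with 1 / Gamma(N + 1).\<close>
  have xn: "exp l * x ^ Suc n \<le> Gamma a ^ Suc n / Gamma (N + 1) * (exp (c + 1) * (N + 1))"
  proof -
    have "x ^ Suc n = Gamma a ^ Suc n * N powr (- N)"
      using N a powr_power[of N "- a" "Suc n"]
      by (simp add: x_def power_mult_distrib N_def mult_ac del: power_Suc)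
    then have "exp l * x ^ Suc n = Gamma a ^ Suc n * exp c * (exp N / N powr N)"
      using N by (simp add: l_def exp_add powr_minus divide_simps del: power_Suc)
    also have "exp N / N powr N \<le> (exp 1 * (N + 1)) / Gamma (N + 1)"
      using Gamma_upper_bound[OF N] N Gamma_real_pos[of "N + 1"] by (simp add: divide_simps exp_diff mult_ac)
    finally show ?thesis using G by (simp add: exp_add mult_ac)
  qed
  have yx: "y / x = M * exp (- l * \<delta>) * N powr a / Gamma a"
    using N by (simp add: x_def y_def powr_minus divide_simps)
  have "(\<integral>\<^sup>+t. Q t * indicator {..1} t \<partial>lborel) \<le> ennreal (exp l) * laplace l Q"
    by (intro nn_integral_atMost_1_le_laplace l) auto
  also have "\<dots> \<le> ennreal (exp l) * ennreal (x ^ Suc n * (exp (Suc n * (y / x)) - 1))"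
    by (intro mult_left_mono LQ) auto
  also have "\<dots> = ennreal (exp l * x ^ Suc n * (exp (Suc n * (y / x)) - 1))"
    by (simp add: ennreal_mult'[symmetric] mult_ac)
  also have "\<dots> \<le> ennreal (Gamma a ^ Suc n / Gamma (N + 1) * (exp (c + 1) * (N + 1)) * (exp (Suc n * (y / x)) - 1))"
    using x y by (intro ennreal_leI mult_right_mono xn) auto
  finally show ?thesis unfolding yx l_def N_def Q_def A_def by (simp add: mult.assoc)
qed

text \<open>The inner exponent decays exponentially in n because exp(-an\<delta>) beats every power,
  so its exponential minus 1 absorbs the linear prefactor.\<close>

lemma far_bound_tendsto_0:
  fixes a c M \<delta> G C :: real
  assumes "a > 0" "M > 0" "\<delta> > 0" "G > 0" "C > 0"
  shows "(\<lambda>n. C * (a * real n + 1)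
         * (exp (real n * (M * exp (- (a * real n + c) * \<delta>) * (a * real n) powr a / G)) - 1)) \<longlonglongrightarrow> 0"
  using assms by real_asymp

text \<open>Let A be the model kernel with \<open>\<mu> + \<epsilon>\<close>. Then H + D = A + d, so
  the remainder of \<open>D\<close> over \<open>H\<close> is the difference of the explicit powers
  of A and \<open>H\<close> plus the remainder of \<open>d\<close> over A. The first summand is
  bounded pointwise for t \<le> 1 and produces exp \<epsilon> - 1; the second is the far
  estimate.\<close>

lemma nnrem_bound:
  fixes a \<mu> \<epsilon> M \<delta> :: real
  assumes a: "a > 0" and e: "\<epsilon> > 0" and [measurable]: "d \<in> borel_measurable borel"
    and M: "(\<integral>\<^sup>+t. d t \<partial>lborel) \<le> ennreal M" "M \<ge> 0"
    and supp: "\<And>t. t < \<delta> \<Longrightarrow> d t = 0" and pos: "a * Suc n + \<mu> + \<epsilon> \<ge> 0"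
  defines "H \<equiv> (\<lambda>t. ennreal (Gamma a * pker \<mu> a t))"
    and "D \<equiv> (\<lambda>t. ennreal (Gamma a * pker (\<mu> + \<epsilon>) a t - Gamma a * pker \<mu> a t) + d t)"
  shows "(\<integral>\<^sup>+t. nnrem H D n t * indicator {..1} t \<partial>lborel)
     \<le> ennreal (Gamma a ^ Suc n / Gamma (a * Suc n + 1) * (exp \<bar>\<mu>\<bar> * (exp \<epsilon> - 1)
        + exp (\<mu> + \<epsilon> + 1) * (a * Suc n + 1)
         * (exp (Suc n * (M * exp (- (a * Suc n + (\<mu> + \<epsilon>)) * \<delta>) * (a * Suc n) powr a / Gamma a)) - 1)))"
    (is "_ \<le> ennreal (?G * (?X + ?Y))")
proof -
  define A where "A = (\<lambda>t. ennreal (Gamma a * pker (\<mu> + \<epsilon>) a t))"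
  define E where "E = exp \<bar>\<mu>\<bar> * (exp \<epsilon> - 1)"
  define N where "N = a * Suc n"
  have N: "N > 0" using a by (simp add: N_def)
  have G: "Gamma a > 0" using a by simp
  have Gn: "?G > 0" using G a by (intro divide_pos_pos zero_less_power Gamma_real_pos) (auto intro!: add_nonneg_pos)
  have E: "E \<ge> 0" using e by (simp add: E_def)
  have [measurable]: "H \<in> borel_measurable borel" "D \<in> borel_measurable borel" "A \<in> borel_measurable borel"
    unfolding H_def D_def A_def by measurable
  have le: "pker \<mu> a t \<le> pker (\<mu> + \<epsilon>) a t" for t
    using a e by (auto simp: pker_def divide_simps intro!: mult_right_mono mult_left_mono)
  have AH: "(\<lambda>t. H t + D t) = (\<lambda>t. A t + d t)"
  proof
    fix t
    have "H t + ennreal (Gamma a * pker (\<mu> + \<epsilon>) a t - Gamma a * pker \<mu> a t) = A t"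
      unfolding H_def A_def using G le[of t] pker_nonneg[OF a]
      by (subst ennreal_plus[symmetric]) (auto simp: mult_left_mono)
    then show "H t + D t = A t + d t" unfolding D_def by (simp add: add.assoc[symmetric])
  qed
  \<comment> \<open>One power, expanded around \<open>H\<close> and around \<open>A\<close>.\<close>
  have sum: "nnpow H n t + nnrem H D n t = nnpow A n t + nnrem A d n t" for t
  proof -
    have "nnpow (\<lambda>x. H x + D x) n = nnpow (\<lambda>x. A x + d x) n" using AH by simp
    then show ?thesis by (subst (asm) (1 2) nnpow_add_nnrem) (auto simp: fun_eq_iff)
  qed
  have bound: "nnrem H D n t \<le> ennreal (Gamma a ^ Suc n * E) * ennreal (pker 0 N t) + nnrem A d n t" if t: "t \<le> 1" for t
  proof -
    have "nnpow A n t = ennreal (Gamma a ^ Suc n * pker (\<mu> + \<epsilon>) N t)"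
      unfolding A_def N_def using a G by (subst nnpow_pker) auto
    also have "\<dots> \<le> ennreal (Gamma a ^ Suc n * pker \<mu> N t + Gamma a ^ Suc n * E * pker 0 N t)"
    proof (cases "t > 0")
      case True
      have "exp (\<mu> * t) * (exp (\<epsilon> * t) - 1) \<le> E"
        unfolding E_def
      proof (intro mult_mono)
        have "\<mu> * t \<le> \<bar>\<mu>\<bar> * 1" using True t by (intro mult_mono) auto
        then show "exp (\<mu> * t) \<le> exp \<bar>\<mu>\<bar>" by simp
        show "exp (\<epsilon> * t) - 1 \<le> exp \<epsilon> - 1" using True t e by simp
        show "0 \<le> exp (\<epsilon> * t) - 1" using True t e by simp
      qed auto
      then have "exp ((\<mu> + \<epsilon>) * t) \<le> exp (\<mu> * t) + E"
        by (simp add: algebra_simps exp_add)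
      then have "pker (\<mu> + \<epsilon>) N t \<le> pker \<mu> N t + E * pker 0 N t"
        using True N less_imp_neq[OF Gamma_real_pos[OF N]] by (simp add: pker_def divide_simps distrib_right[symmetric] mult_right_mono)
      then have "Gamma a ^ Suc n * pker (\<mu> + \<epsilon>) N t \<le> Gamma a ^ Suc n * (pker \<mu> N t + E * pker 0 N t)"
        using G by (intro mult_left_mono) auto
      then show ?thesis by (intro ennreal_leI) (simp add: algebra_simps)
    qed (simp add: pker_def)
    also have "\<dots> = nnpow H n t + ennreal (Gamma a ^ Suc n * E) * ennreal (pker 0 N t)"
      unfolding H_def N_def using a G E N pker_nonneg[of N] unfolding N_def
      by (subst nnpow_pker) (auto simp: ennreal_mult'[symmetric])
    finally have "nnpow H n t + nnrem H D n t \<le> nnpow H n t + (ennreal (Gamma a ^ Suc n * E) * ennreal (pker 0 N t) + nnrem A d n t)"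
      unfolding sum by (simp add: add.assoc[symmetric] add_right_mono)
    \<comment> \<open>Finiteness allows the cancellation of this term in
      \<open>ennreal\<close>.\<close>
    moreover have "nnpow H n t \<noteq> \<infinity>"
      unfolding H_def using a G by (subst nnpow_pker) auto
    ultimately show ?thesis by (simp add: ennreal_add_left_cancel_le)
  qed
  have "(\<integral>\<^sup>+t. nnrem H D n t * indicator {..1} t \<partial>lborel)
     \<le> (\<integral>\<^sup>+t. ennreal (Gamma a ^ Suc n * E) * (ennreal (pker 0 N t) * indicator {..1} t) + nnrem A d n t * indicator {..1} t \<partial>lborel)"
    using bound by (intro nn_integral_mono) (auto simp: indicator_def)
  also have "\<dots> = ennreal (Gamma a ^ Suc n * E) * ennreal (1 / Gamma (N + 1))
       + (\<integral>\<^sup>+t. nnrem A d n t * indicator {..1} t \<partial>lborel)"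
    using nn_integral_pker_atMost_1[OF N] by (subst nn_integral_add) (auto simp: nn_integral_cmult)
  also have "\<dots> \<le> ennreal (?G * ?X) + ennreal (?G * ?Y)"
  proof (rule add_mono)
    show "ennreal (Gamma a ^ Suc n * E) * ennreal (1 / Gamma (N + 1)) \<le> ennreal (?G * ?X)"
      using G E N by (subst ennreal_mult'[symmetric]) (auto simp: E_def N_def)
    show "(\<integral>\<^sup>+t. nnrem A d n t * indicator {..1} t \<partial>lborel) \<le> ennreal (?G * ?Y)"
      unfolding A_def using a M supp pos by (intro nnrem_bound_far) (auto simp: add.assoc)
  qed
  also have "\<dots> = ennreal (?G * (?X + ?Y))"
    unfolding distrib_left using Gn E e a M(2)
    by (intro ennreal_plus[symmetric] mult_nonneg_nonneg) auto
  finally show ?thesis .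
qed

section \<open>Norm bounds and the Young inequality\<close>

lemma nn_integral_M01: "(\<integral>\<^sup>+t. f t \<partial>M01) = (\<integral>\<^sup>+t. f t * indicator {0<..<1} t \<partial>lborel)"
  unfolding M01_def by (simp add: nn_integral_restrict_space nn_integral_completion)

lemma AE_M01: "(AE t in M01. P t) \<longleftrightarrow> (AE t in lborel. t \<in> {0<..<1} \<longrightarrow> P t)"
  unfolding M01_def by (simp add: AE_restrict_space_iff AE_completion_iff)

text \<open>Completeness of Lebesgue measure: a preimage under \<open>f\<close> differs from the one
  under \<open>g\<close> by a subset of a null set. Measurability of operator values, which are only
  identified almost everywhere, is obtained this way.\<close>

lemma borel_measurable_lebesgue_AE:
  fixes f g :: "real \<Rightarrow> real"
  assumes g: "g \<in> borel_measurable borel" and eq: "AE x in lborel. f x = g x"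
  shows "f \<in> borel_measurable lebesgue"
proof (rule measurableI)
  obtain N where N: "N \<in> null_sets lborel" "{x. f x \<noteq> g x} \<subseteq> N"
    using eq by (auto elim!: AE_E simp: null_sets_def)
  fix A :: "real set" assume A: "A \<in> sets borel"
  have gA: "g -` A \<in> sets borel" using measurable_sets[OF g A] by simp
  have "f -` A \<inter> space lebesgue = (g -` A - N) \<union> (f -` A \<inter> N)" using N(2) by auto
  moreover have "f -` A \<inter> N \<in> sets lebesgue"
    using N(1) by (intro sets_completionI_sub[OF N(1)]) auto
  moreover have "g -` A - N \<in> sets lebesgue"
    using gA N(1) by (intro sets_completionI_sets) auto
  ultimately show "f -` A \<inter> space lebesgue \<in> sets lebesgue" by (metis sets.Un)
qed auto

lemma borel_measurable_M01_AE:
  fixes f g :: "real \<Rightarrow> real"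
  assumes g[measurable]: "g \<in> borel_measurable borel" and eq: "AE x in lborel. x \<in> {0<..<1} \<longrightarrow> f x = g x"
  shows "f \<in> borel_measurable M01"
proof -
  have "(\<lambda>x. indicator {0<..<1} x *\<^sub>R f x) \<in> borel_measurable lebesgue"
    by (rule borel_measurable_lebesgue_AE[of "\<lambda>x. indicator {0<..<1} x *\<^sub>R g x"], measurable)
      (use eq in \<open>auto elim!: eventually_mono simp: indicator_def\<close>)
  then show ?thesis
    unfolding M01_def by (subst borel_measurable_restrict_space_iff) auto
qed

lemma borel_measurable_M01I: "(f :: real \<Rightarrow> real) \<in> borel_measurable borel \<Longrightarrow> f \<in> borel_measurable M01"
  by (rule borel_measurable_M01_AE[where g=f]) auto

text \<open>The representative is extended by 0, so that integrals over the interval become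
  integrals over the line and the Borel theory of convolution applies.\<close>

lemma M01_borel_representative:
  fixes f :: "real \<Rightarrow> real"
  assumes "f \<in> borel_measurable M01"
  obtains g where "g \<in> borel_measurable borel" "\<And>x. x \<notin> {0<..<1} \<Longrightarrow> g x = 0"
    "AE x in lborel. x \<in> {0<..<1} \<longrightarrow> f x = g x"
proof -
  have "(\<lambda>x. indicator {0<..<1} x *\<^sub>R f x) \<in> borel_measurable (completion lborel)"
    using assms unfolding M01_def by (subst (asm) borel_measurable_restrict_space_iff) auto
  then obtain g where g: "g \<in> borel_measurable lborel" "AE x in lborel. indicator {0<..<1} x *\<^sub>R f x = g x"
    using completion_ex_borel_measurable_real by blast
  show thesis
    by (rule that[of "\<lambda>x. if x \<in> {0<..<1} then g x else 0"])
      (use g in \<open>auto elim!: eventually_mono simp: indicator_def\<close>)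
qed

text \<open>Membership in \<open>Lp p\<close> together with a norm bound, in one inequality between
  nonnegative integrals. This avoids integrability side conditions and p-th roots;
  \<open>Lple_iff\<close> is the translation for \<open>C\<close> \<ge> 0.\<close>

definition Lple :: "ereal \<Rightarrow> real \<Rightarrow> (real \<Rightarrow> real) \<Rightarrow> bool" where
  "Lple p C u \<longleftrightarrow> u \<in> borel_measurable M01 \<and>
     (if p = \<infinity> then AE t in M01. \<bar>u t\<bar> \<le> C
      else (\<integral>\<^sup>+t. ennreal (\<bar>u t\<bar> powr real_of_ereal p) \<partial>M01) \<le> ennreal (C powr real_of_ereal p))"

lemma ereal_ge_1_cases:
  assumes "1 \<le> (p :: ereal)"
  obtains "p = \<infinity>" | p' where "p = ereal p'" "p' \<ge> 1"
  using assms by (cases p) auto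

lemma emeasure_M01: "emeasure M01 (space M01) = 1"
proof -
  have "emeasure M01 (space M01) = (\<integral>\<^sup>+t. 1 \<partial>M01)" by simp
  also have "\<dots> = (\<integral>\<^sup>+t. indicator {0<..<1::real} t \<partial>lborel)"
    unfolding nn_integral_M01 by simp
  also have "\<dots> = 1" by (subst nn_integral_indicator) auto
  finally show ?thesis .
qed

lemma Lple_iff:
  assumes p: "1 \<le> p" and C: "C \<ge> 0"
  shows "Lple p C u \<longleftrightarrow> u \<in> Lp p \<and> pnorm p u \<le> C"
  using p
proof (cases rule: ereal_ge_1_cases)
  case 1
  show ?thesis
  proof (intro iffI conjI)
    assume L: "Lple p C u"
    then have u[measurable]: "u \<in> borel_measurable M01" and AE: "AE t in M01. ereal \<bar>u t\<bar> \<le> ereal C"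
      using 1 by (auto simp: Lple_def)
    have E: "esssup M01 (\<lambda>t. ereal \<bar>u t\<bar>) \<le> ereal C"
      by (rule esssup_I) (use AE in measurable)
    then show "u \<in> Lp p" using 1 u by (auto simp: Lp_def)
    show "pnorm p u \<le> C" using E C 1
      by (cases "esssup M01 (\<lambda>t. ereal \<bar>u t\<bar>)") (auto simp: pnorm_def)
  next
    assume L: "u \<in> Lp p \<and> pnorm p u \<le> C"
    define E where "E = esssup M01 (\<lambda>t. ereal \<bar>u t\<bar>)"
    have u: "u \<in> borel_measurable M01" and E: "E < \<infinity>" "real_of_ereal E \<le> C"
      using 1 L by (auto simp: Lp_def pnorm_def E_def)
    have "E \<le> ereal C" using E by (cases E) auto
    moreover have "AE t in M01. ereal \<bar>u t\<bar> \<le> E" unfolding E_def by (rule esssup_AE)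
    ultimately have "AE t in M01. \<bar>u t\<bar> \<le> C"
      by (elim eventually_mono) (metis ereal_less_eq(3) order_trans)
    then show "Lple p C u" using u 1 by (auto simp: Lple_def)
  qed
next
  case (2 p')
  show ?thesis
  proof (cases "u \<in> borel_measurable M01")
    case False
    then show ?thesis using 2 by (auto simp: Lple_def Lp_def)
  next
    case True
    note [measurable] = True
    define I where "I = integral\<^sup>L M01 (\<lambda>t. \<bar>u t\<bar> powr p')"
    have I0: "I \<ge> 0" unfolding I_def by (intro integral_nonneg_AE) auto
    have le: "I powr (1 / p') \<le> C \<longleftrightarrow> I \<le> C powr p'"
    proof
      assume "I powr (1 / p') \<le> C"
      then have "(I powr (1 / p')) powr p' \<le> C powr p'" using 2 by (intro powr_mono2) auto
      then show "I \<le> C powr p'" using I0 2 by (simp add: powr_powr)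
    next
      assume "I \<le> C powr p'"
      then have "I powr (1 / p') \<le> (C powr p') powr (1 / p')" using 2 I0 by (intro powr_mono2) auto
      then show "I powr (1 / p') \<le> C" using C 2 by (simp add: powr_powr)
    qed
    show ?thesis
    proof (cases "integrable M01 (\<lambda>t. \<bar>u t\<bar> powr p')")
      case int: True
      have "(\<integral>\<^sup>+t. ennreal (\<bar>u t\<bar> powr p') \<partial>M01) = ennreal I"
        unfolding I_def using int by (intro nn_integral_eq_integral) auto
      then show ?thesis using True 2 int le I0
        by (auto simp: Lple_def Lp_def pnorm_def I_def)
    next
      case False
      have "\<not> (\<integral>\<^sup>+t. ennreal (\<bar>u t\<bar> powr p') \<partial>M01) \<le> ennreal (C powr p')"
      proof
        assume "(\<integral>\<^sup>+t. ennreal (\<bar>u t\<bar> powr p') \<partial>M01) \<le> ennreal (C powr p')"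
        then have "integrable M01 (\<lambda>t. \<bar>u t\<bar> powr p')"
          by (intro integrableI_bounded) (auto simp: le_less_trans)
        with False show False by simp
      qed
      then show ?thesis using 2 False by (auto simp: Lple_def Lp_def)
    qed
  qed
qed

text \<open>For p = \<infinity> the point is that \<open>M01\<close> is not the null measure: a
  negative essential supremum would make a false statement hold almost everywhere.\<close>

lemma pnorm_nonneg: "pnorm p u \<ge> 0"
proof (cases "p = \<infinity>")
  case True
  define E where "E = esssup M01 (\<lambda>t. ereal \<bar>u t\<bar>)"
  have "E \<ge> 0"
  proof (rule ccontr)
    assume "\<not> E \<ge> 0"
    moreover have "AE t in M01. ereal \<bar>u t\<bar> \<le> E" unfolding E_def by (rule esssup_AE)
    ultimately have "AE t in M01. False"
      by (elim eventually_mono) (metis abs_ge_zero ereal_less_eq(5) order_trans)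
    then have "emeasure M01 (space M01) = 0"
      by (simp add: ae_filter_eq_bot_iff[symmetric] trivial_limit_def)
    then show False by (simp add: emeasure_M01)
  qed
  then show ?thesis using True by (simp add: pnorm_def E_def real_of_ereal_pos)
qed (auto simp: pnorm_def)

lemma Lple_pnorm: "1 \<le> p \<Longrightarrow> u \<in> Lp p \<Longrightarrow> Lple p (pnorm p u) u"
  by (simp add: Lple_iff pnorm_nonneg)

lemma Lple_AE_cong:
  assumes "v \<in> borel_measurable M01" "AE t in lborel. t \<in> {0<..<1} \<longrightarrow> u t = v t" "Lple p C u"
  shows "Lple p C v"
proof (cases "p = \<infinity>")
  case True
  have "AE t in M01. u t = v t" using assms(2) by (simp add: AE_M01)
  moreover have "AE t in M01. \<bar>u t\<bar> \<le> C" using assms(3) True by (simp add: Lple_def)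
  ultimately have "AE t in M01. \<bar>v t\<bar> \<le> C" by eventually_elim auto
  then show ?thesis using assms True by (simp add: Lple_def)
next
  case False
  have "(\<integral>\<^sup>+t. ennreal (\<bar>u t\<bar> powr real_of_ereal p) \<partial>M01) = (\<integral>\<^sup>+t. ennreal (\<bar>v t\<bar> powr real_of_ereal p) \<partial>M01)"
    using assms(2) by (intro nn_integral_cong_AE) (auto simp: AE_M01 elim!: eventually_mono)
  then show ?thesis using assms False by (simp add: Lple_def)
qed

section \<open>Convexity: the inequalities of Jensen, Young and Minkowski\<close>

lemma powr_tangent:
  fixes x y p :: real
  assumes p: "p \<ge> 1" and x: "x \<ge> 0" and y: "y > 0"
  shows "p * y powr (p - 1) * x \<le> x powr p + (p - 1) * y powr p"
proof (cases "x = 0")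
  case False
  \<comment> \<open>Weighted arithmetic-geometric mean inequality with weights 1/p and 1 - 1/p; it
    gives the tangent inequality without differentiation.\<close>
  have "(x powr p) powr (1 / p) * (y powr p) powr (1 - 1 / p) \<le> 1 / p * x powr p + (1 - 1 / p) * y powr p"
    using False x y p by (intro Youngs_inequality_0) auto
  moreover have "(y powr p) powr (1 - 1 / p) = y powr (p - 1)"
    using p by (simp add: powr_powr algebra_simps)
  ultimately have "x * y powr (p - 1) \<le> 1 / p * x powr p + (1 - 1 / p) * y powr p"
    using x p by (simp add: powr_powr)
  then have "p * (x * y powr (p - 1)) \<le> p * (1 / p * x powr p + (1 - 1 / p) * y powr p)"
    using p by (intro mult_left_mono) auto
  also have "\<dots> = x powr p + (p - 1) * y powr p" using p by (simp add: field_simps)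
  finally show ?thesis by (simp add: mult_ac)
qed (use p in auto)

text \<open>Jensen's inequality without integrability assumptions, from the tangent inequality at \<open>y = v / W\<close>.\<close>

lemma powr_nn_integral_le:
  fixes w :: "real \<Rightarrow> ennreal" and u :: "real \<Rightarrow> real"
  assumes [measurable]: "w \<in> borel_measurable M" "u \<in> borel_measurable M"
    and p: "p \<ge> 1" and W: "W > 0" "(\<integral>\<^sup>+s. w s \<partial>M) \<le> ennreal W"
    and v: "ennreal v \<le> (\<integral>\<^sup>+s. w s * ennreal \<bar>u s\<bar> \<partial>M)" "v \<ge> 0"
  shows "ennreal (v powr p) \<le> ennreal (W powr (p - 1)) * (\<integral>\<^sup>+s. w s * ennreal (\<bar>u s\<bar> powr p) \<partial>M)"
proof (cases "v = 0")
  case False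
  define y where "y = v / W"
  define J where "J = (\<integral>\<^sup>+s. w s * ennreal (\<bar>u s\<bar> powr p) \<partial>M)"
  have y: "y > 0" using False v W by (simp add: y_def)
  have "ennreal (p * y powr (p - 1)) * ennreal v
     \<le> ennreal (p * y powr (p - 1)) * (\<integral>\<^sup>+s. w s * ennreal \<bar>u s\<bar> \<partial>M)"
    by (intro mult_left_mono v) auto
  also have "\<dots> = (\<integral>\<^sup>+s. w s * ennreal (p * y powr (p - 1) * \<bar>u s\<bar>) \<partial>M)"
    using p by (subst nn_integral_cmult[symmetric]) (auto simp: ennreal_mult' mult_ac)
  also have "\<dots> \<le> (\<integral>\<^sup>+s. w s * ennreal (\<bar>u s\<bar> powr p) + ennreal ((p - 1) * y powr p) * w s \<partial>M)"
  proof (rule nn_integral_mono)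
    fix s
    have "w s * ennreal (p * y powr (p - 1) * \<bar>u s\<bar>) \<le> w s * ennreal (\<bar>u s\<bar> powr p + (p - 1) * y powr p)"
      using powr_tangent[OF p _ y, of "\<bar>u s\<bar>"] by (intro mult_left_mono ennreal_leI) auto
    then show "w s * ennreal (p * y powr (p - 1) * \<bar>u s\<bar>)
       \<le> w s * ennreal (\<bar>u s\<bar> powr p) + ennreal ((p - 1) * y powr p) * w s"
      using p by (simp add: ennreal_plus distrib_left mult_ac)
  qed
  also have "\<dots> = J + ennreal ((p - 1) * y powr p) * (\<integral>\<^sup>+s. w s \<partial>M)"
    by (subst nn_integral_add) (auto simp: nn_integral_cmult J_def)
  also have "\<dots> \<le> J + ennreal ((p - 1) * y powr p) * ennreal W"
    by (intro add_left_mono mult_left_mono W) auto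
  also have "\<dots> = J + ennreal ((p - 1) * y powr p * W)"
    using p W by (simp add: ennreal_mult')
  finally have 1: "ennreal (p * y powr (p - 1)) * ennreal v \<le> J + ennreal ((p - 1) * y powr p * W)" .
  have "y powr (p - 1) * v = y powr p * W"
    using y W powr_add[of y "p - 1" 1] by (simp add: y_def field_simps)
  then have "ennreal (p * y powr (p - 1)) * ennreal v = ennreal (y powr p * W + (p - 1) * y powr p * W)"
    using v p by (subst ennreal_mult'[symmetric]) (auto simp: algebra_simps)
  also have "\<dots> = ennreal (y powr p * W) + ennreal ((p - 1) * y powr p * W)"
    using p W by (intro ennreal_plus) auto
  finally have "ennreal ((p - 1) * y powr p * W) + ennreal (y powr p * W) \<le> ennreal ((p - 1) * y powr p * W) + J"
    using 1 by (simp add: add.commute)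
  then have "ennreal (y powr p * W) \<le> J" by (simp add: ennreal_add_left_cancel_le)
  then have "ennreal (W powr (p - 1)) * ennreal (y powr p * W) \<le> ennreal (W powr (p - 1)) * J"
    by (intro mult_left_mono) auto
  moreover have "W powr (p - 1) * (y powr p * W) = v powr p"
    using W v powr_add[of W "p - 1" 1] by (simp add: y_def powr_divide mult_ac)
  ultimately show ?thesis using W by (simp add: J_def ennreal_mult'[symmetric])
qed auto

text \<open>For t and s in (0,1) the difference t - s lies in (-1,1), so only the mass of
  \<open>w\<close> there counts. For finite p, Jensen's inequality against w(t - s) ds gives a
  factor W^(p-1), and integration in t by Tonelli one more \<open>W\<close>. The function
  \<open>v\<close> need only be dominated almost everywhere, whatever its origin.\<close>

lemma Lple_Young_convolution:
  assumes p: "1 \<le> p" and [measurable]: "w \<in> borel_measurable borel" "u \<in> borel_measurable borel"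
    and W: "W > 0" "(\<integral>\<^sup>+x. w x * indicator {-1<..<1} x \<partial>lborel) \<le> ennreal W"
    and C: "C \<ge> 0" "Lple p C u" and v: "v \<in> borel_measurable M01"
    and dom: "AE t in lborel. t \<in> {0<..<1} \<longrightarrow>
       ennreal \<bar>v t\<bar> \<le> (\<integral>\<^sup>+s. w (t - s) * ennreal \<bar>u s\<bar> * indicator {0<..<1} s \<partial>lborel)"
  shows "Lple p (W * C) v"
proof -
  define w' where "w' x = w x * indicator {-1<..<1} x" for x
  have [measurable]: "w' \<in> borel_measurable borel" unfolding w'_def by measurable
  have w': "w (t - s) * a * indicator {0<..<1} s = w' (t - s) * indicator {0<..<1} s * a" if "t \<in> {0<..<1}" for t s a
    using that by (auto simp: w'_def indicator_def mult_ac)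
  have W': "(\<integral>\<^sup>+s. w' (t - s) * indicator {0<..<1} s \<partial>lborel) \<le> ennreal W" for t
  proof -
    have "(\<integral>\<^sup>+s. w' (t - s) * indicator {0<..<1} s \<partial>lborel) \<le> (\<integral>\<^sup>+s. w' (t - s) \<partial>lborel)"
      by (intro nn_integral_mono) (auto simp: indicator_def)
    also have "\<dots> = (\<integral>\<^sup>+s. w' s \<partial>lborel)" by (rule nn_integral_lborel_reflect) measurable
    also have "\<dots> \<le> ennreal W" using W by (simp add: w'_def)
    finally show ?thesis .
  qed
  show ?thesis using p
  proof (cases rule: ereal_ge_1_cases)
    case 1
    have u: "AE s in lborel. s \<in> {0<..<1} \<longrightarrow> \<bar>u s\<bar> \<le> C" using C 1 by (simp add: Lple_def AE_M01)
    have "AE t in lborel. t \<in> {0<..<1} \<longrightarrow> \<bar>v t\<bar> \<le> W * C"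
      using dom
    proof (eventually_elim, intro impI)
      fix t :: real
      assume H: "t \<in> {0<..<1} \<longrightarrow>
        ennreal \<bar>v t\<bar> \<le> (\<integral>\<^sup>+s. w (t - s) * ennreal \<bar>u s\<bar> * indicator {0<..<1} s \<partial>lborel)" and t: "t \<in> {0<..<1}"
      have "ennreal \<bar>v t\<bar> \<le> (\<integral>\<^sup>+s. w' (t - s) * indicator {0<..<1} s * ennreal \<bar>u s\<bar> \<partial>lborel)"
        using H t by (simp add: w')
      also have "\<dots> \<le> (\<integral>\<^sup>+s. w' (t - s) * indicator {0<..<1} s * ennreal C \<partial>lborel)"
        using u by (intro nn_integral_mono_AE)
          (auto elim!: eventually_mono intro!: mult_left_mono ennreal_leI simp: indicator_def)
      also have "\<dots> = (\<integral>\<^sup>+s. w' (t - s) * indicator {0<..<1} s \<partial>lborel) * ennreal C"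
        by (rule nn_integral_multc) measurable
      also have "\<dots> \<le> ennreal W * ennreal C" by (intro mult_right_mono W') auto
      also have "\<dots> = ennreal (W * C)" using W by (simp add: ennreal_mult')
      finally show "\<bar>v t\<bar> \<le> W * C" using W C by simp
    qed
    then show ?thesis using 1 v by (simp add: Lple_def AE_M01)
  next
    case (2 p')
    have "(\<integral>\<^sup>+t. ennreal (\<bar>v t\<bar> powr p') \<partial>M01)
        \<le> (\<integral>\<^sup>+t. ennreal (W powr (p' - 1)) * nnconv w' (\<lambda>s. ennreal (\<bar>u s\<bar> powr p') * indicator {0<..<1} s) t \<partial>lborel)"
      unfolding nn_integral_M01
    proof (rule nn_integral_mono_AE, use dom in eventually_elim)
      fix t :: real
      assume H: "t \<in> {0<..<1} \<longrightarrow>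
        ennreal \<bar>v t\<bar> \<le> (\<integral>\<^sup>+s. w (t - s) * ennreal \<bar>u s\<bar> * indicator {0<..<1} s \<partial>lborel)"
      show "ennreal (\<bar>v t\<bar> powr p') * indicator {0<..<1} t
        \<le> ennreal (W powr (p' - 1)) * nnconv w' (\<lambda>s. ennreal (\<bar>u s\<bar> powr p') * indicator {0<..<1} s) t"
      proof (cases "t \<in> {0<..<1}")
        case True
        have "ennreal (\<bar>v t\<bar> powr p') \<le> ennreal (W powr (p' - 1)) *
            (\<integral>\<^sup>+s. w' (t - s) * indicator {0<..<1} s * ennreal (\<bar>u s\<bar> powr p') \<partial>lborel)"
          using H True W W' 2 by (intro powr_nn_integral_le) (auto simp: w')
        then show ?thesis using True by (simp add: nnconv_def mult_ac)
      qed simp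
    qed
    also have "\<dots> = ennreal (W powr (p' - 1)) * ((\<integral>\<^sup>+x. w' x \<partial>lborel) * (\<integral>\<^sup>+t. ennreal (\<bar>u t\<bar> powr p') \<partial>M01))"
      by (subst nn_integral_cmult) (auto simp: nn_integral_nnconv nn_integral_M01)
    also have "\<dots> \<le> ennreal (W powr (p' - 1)) * (ennreal W * ennreal (C powr p'))"
      using W C 2 by (intro mult_left_mono mult_mono) (auto simp: w'_def Lple_def)
    also have "\<dots> = ennreal ((W * C) powr p')"
      using W C powr_add[of W "p' - 1" 1]
      by (simp add: ennreal_mult'[symmetric] powr_mult mult_ac)
    finally show ?thesis using 2 v by (simp add: Lple_def)
  qed
qed

text \<open>Minkowski's inequality with prescribed bounds: convexity of the p-th power with weights
  a/(a + b) and b/(a + b), applied to |x|/a and |y|/b. The pointwise form comes from adding two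
  tangent inequalities at the same point z = |x + y|/(a + b), with multiplicities \<open>a\<close>
  and \<open>b\<close>. Dividing by the bounds is why they are strictly positive.\<close>

lemma Lple_add:
  assumes p: "1 \<le> p" and ab: "a > 0" "b > 0" and u: "Lple p a u" and v: "Lple p b v"
  shows "Lple p (a + b) (\<lambda>t. u t + v t)"
proof -
  have [measurable]: "u \<in> borel_measurable M01" "v \<in> borel_measurable M01"
    using u v by (auto simp: Lple_def)
  show ?thesis using p
  proof (cases rule: ereal_ge_1_cases)
    case 1
    have "AE t in M01. \<bar>u t\<bar> \<le> a" "AE t in M01. \<bar>v t\<bar> \<le> b" using u v 1 by (auto simp: Lple_def)
    then have "AE t in M01. \<bar>u t + v t\<bar> \<le> a + b" by eventually_elim auto
    then show ?thesis using 1 by (simp add: Lple_def)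
  next
    case (2 p')
    define K where "K = (a + b) powr (p' - 1)"
    have K: "K \<ge> 0" by (simp add: K_def)
    have pt: "\<bar>x + y\<bar> powr p' \<le> K * (a powr (1 - p') * \<bar>x\<bar> powr p' + b powr (1 - p') * \<bar>y\<bar> powr p')" for x y
    proof -
      define z where "z = \<bar>x + y\<bar> / (a + b)"
      show ?thesis
      proof (cases "z = 0")
        case False
        then have z: "z > 0" using ab by (simp add: z_def)
        have "p' * z powr (p' - 1) * (\<bar>x\<bar> / a) \<le> (\<bar>x\<bar> / a) powr p' + (p' - 1) * z powr p'"
          using z 2 ab by (intro powr_tangent) auto
        then have 1: "a * (p' * z powr (p' - 1) * (\<bar>x\<bar> / a)) \<le> a * ((\<bar>x\<bar> / a) powr p' + (p' - 1) * z powr p')"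
          using ab by (intro mult_left_mono) auto
        have "p' * z powr (p' - 1) * (\<bar>y\<bar> / b) \<le> (\<bar>y\<bar> / b) powr p' + (p' - 1) * z powr p'"
          using z 2 ab by (intro powr_tangent) auto
        then have 2: "b * (p' * z powr (p' - 1) * (\<bar>y\<bar> / b)) \<le> b * ((\<bar>y\<bar> / b) powr p' + (p' - 1) * z powr p')"
          using ab by (intro mult_left_mono) auto
        have "p' * z powr p' * (a + b) = p' * z powr (p' - 1) * (z * (a + b))"
          using z powr_add[of z "p' - 1" 1] by simp
        also have "\<dots> \<le> p' * z powr (p' - 1) * (\<bar>x\<bar> + \<bar>y\<bar>)"
          using ab \<open>p' \<ge> 1\<close> by (intro mult_left_mono) (auto simp: z_def)
        also have "\<dots> \<le> a * (\<bar>x\<bar> / a) powr p' + b * (\<bar>y\<bar> / b) powr p' + (p' - 1) * z powr p' * (a + b)"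
          using 1 2 ab by (simp add: algebra_simps)
        finally have "z powr p' * (a + b) \<le> a * (\<bar>x\<bar> / a) powr p' + b * (\<bar>y\<bar> / b) powr p'"
          by (simp add: algebra_simps)
        also have "\<dots> = a powr (1 - p') * \<bar>x\<bar> powr p' + b powr (1 - p') * \<bar>y\<bar> powr p'"
          using ab by (simp add: powr_divide powr_diff)
        finally have "K * (z powr p' * (a + b)) \<le> K * (a powr (1 - p') * \<bar>x\<bar> powr p' + b powr (1 - p') * \<bar>y\<bar> powr p')"
          using K by (intro mult_left_mono)
        moreover have "K * (z powr p' * (a + b)) = \<bar>x + y\<bar> powr p'"
          using ab powr_add[of "a + b" "p' - 1" 1] by (simp add: K_def z_def powr_divide mult_ac)
        ultimately show ?thesis by simp
      qed (use ab K in \<open>auto simp: z_def\<close>)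
    qed
    have "(\<integral>\<^sup>+t. ennreal (\<bar>u t + v t\<bar> powr p') \<partial>M01)
       \<le> (\<integral>\<^sup>+t. ennreal (K * a powr (1 - p')) * ennreal (\<bar>u t\<bar> powr p') + ennreal (K * b powr (1 - p')) * ennreal (\<bar>v t\<bar> powr p') \<partial>M01)"
    proof (rule nn_integral_mono)
      fix t
      have "ennreal (\<bar>u t + v t\<bar> powr p') \<le> ennreal (K * a powr (1 - p') * \<bar>u t\<bar> powr p' + K * b powr (1 - p') * \<bar>v t\<bar> powr p')"
        using pt[of "u t" "v t"] by (intro ennreal_leI) (simp add: algebra_simps)
      then show "ennreal (\<bar>u t + v t\<bar> powr p') \<le> ennreal (K * a powr (1 - p')) * ennreal (\<bar>u t\<bar> powr p') + ennreal (K * b powr (1 - p')) * ennreal (\<bar>v t\<bar> powr p')"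
        using K by (simp add: ennreal_mult'[symmetric])
    qed
    also have "\<dots> = ennreal (K * a powr (1 - p')) * (\<integral>\<^sup>+t. ennreal (\<bar>u t\<bar> powr p') \<partial>M01)
         + ennreal (K * b powr (1 - p')) * (\<integral>\<^sup>+t. ennreal (\<bar>v t\<bar> powr p') \<partial>M01)"
      by (subst nn_integral_add) (auto simp: nn_integral_cmult)
    also have "\<dots> \<le> ennreal (K * a powr (1 - p')) * ennreal (a powr p') + ennreal (K * b powr (1 - p')) * ennreal (b powr p')"
      using u v 2 by (intro add_mono mult_left_mono) (auto simp: Lple_def)
    also have "\<dots> = ennreal (K * a powr (1 - p') * a powr p' + K * b powr (1 - p') * b powr p')"
      using K by (simp add: ennreal_mult'[symmetric])
    also have "K * a powr (1 - p') * a powr p' + K * b powr (1 - p') * b powr p' = (a + b) powr p'"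
      using ab powr_add[of "a + b" "p' - 1" 1]
      by (simp add: K_def mult.assoc powr_add[symmetric] distrib_left)
    finally show ?thesis using 2 by (simp add: Lple_def)
  qed
qed

section \<open>Convolution operators on the line\<close>

lemma AE_lborel_reflect:
  fixes t :: real
  assumes "AE x in lborel. P x"
  shows "AE s in lborel. P (t - s)"
proof -
  obtain N where N: "N \<in> null_sets lborel" "{x. \<not> P x} \<subseteq> N"
    using assms by (auto elim!: AE_E simp: null_sets_def)
  then have [measurable]: "N \<in> sets borel" by auto
  have "(\<integral>\<^sup>+s. indicator N (t - s) \<partial>lborel) = (\<integral>\<^sup>+s. indicator N s \<partial>lborel)"
    by (rule nn_integral_lborel_reflect) measurable
  also have "\<dots> = 0" using N(1) by auto
  finally have "AE s in lborel. (indicator N (t - s) :: ennreal) = 0"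
    by (subst (asm) nn_integral_0_iff_AE) auto
  then show ?thesis
    by (rule eventually_mono) (use N(2) in \<open>auto simp: indicator_def split: if_splits\<close>)
qed

lemma lebesgue_integral_cong_AE_lborel:
  fixes f g :: "real \<Rightarrow> real"
  assumes g: "g \<in> borel_measurable borel" and eq: "AE x in lborel. f x = g x"
  shows "integral\<^sup>L lebesgue f = integral\<^sup>L lborel g"
proof -
  have "integral\<^sup>L lebesgue f = integral\<^sup>L lebesgue g"
    using borel_measurable_lebesgue_AE[OF g eq] borel_measurable_lebesgue_AE[OF g, of g] eq
    by (intro integral_cong_AE) (auto simp: AE_completion_iff)
  then show ?thesis using g by (simp add: integral_completion)
qed

text \<open>A Bochner integral, hence 0 where the integrand is not integrable. This default makes
  \<open>cv_le_nnconv\<close> unconditional, while additivity and associativity are available only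
  almost everywhere.\<close>

definition cv :: "(real \<Rightarrow> real) \<Rightarrow> (real \<Rightarrow> real) \<Rightarrow> real \<Rightarrow> real" where
  "cv K u t = (\<integral>s. K (t - s) * u s \<partial>lborel)"

lemma measurable_cv [measurable]:
  assumes [measurable]: "K \<in> borel_measurable borel" "u \<in> borel_measurable borel"
  shows "cv K u \<in> borel_measurable borel"
  unfolding cv_def by measurable

lemma measurable_cv_funpow [measurable]:
  assumes [measurable]: "K \<in> borel_measurable borel" "u \<in> borel_measurable borel"
  shows "(cv K ^^ n) u \<in> borel_measurable borel"
  by (induction n) auto

lemma cv_cong_AE:
  assumes [measurable]: "K \<in> borel_measurable borel" "u \<in> borel_measurable borel" "v \<in> borel_measurable borel"
    and "AE s in lborel. u s = v s"
  shows "cv K u t = cv K v t"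
  unfolding cv_def using assms(4) by (intro integral_cong_AE) (auto elim!: eventually_mono)

lemma cv_eq_0:
  assumes "\<And>x. x \<le> 0 \<Longrightarrow> K x = 0" "\<And>x. x \<le> 0 \<Longrightarrow> u x = 0" "t \<le> 0"
  shows "cv K u t = 0"
proof -
  have "K (t - s) * u s = 0" for s
    using assms(1)[of "t - s"] assms(2)[of s] assms(3) by (cases "s \<le> 0") auto
  then show ?thesis unfolding cv_def by (simp only: Bochner_Integration.integral_zero)
qed

text \<open>Vanishing of \<open>K\<close> and \<open>g\<close> for x \<le> 0 builds the limits 0 and
  t into the integrand, and the endpoints form a null set. So only the values of \<open>k\<close>
  and \<open>u\<close> inside (0,1) matter.\<close>

lemma Vop_eq_cv:
  assumes [measurable]: "K \<in> borel_measurable borel" "g \<in> borel_measurable borel"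
    and K: "AE x in lborel. x \<in> {0<..<1} \<longrightarrow> k x = K x" "\<And>x. x \<le> 0 \<Longrightarrow> K x = 0"
    and g: "AE x in lborel. x \<in> {0<..<1} \<longrightarrow> u x = g x" "\<And>x. x \<le> 0 \<Longrightarrow> g x = 0"
    and t: "t \<in> {0<..<1}"
  shows "Vop k u t = cv K g t"
  unfolding Vop_def set_lebesgue_integral_def cv_def
proof (rule lebesgue_integral_cong_AE_lborel)
  show "AE s in lborel. indicat_real {0..t} s *\<^sub>R (k (t - s) * u s) = K (t - s) * g s"
    using AE_lborel_reflect[OF K(1), of t] g(1) AE_lborel_singleton[of 0] AE_lborel_singleton[of t]
  proof eventually_elim
    case (elim s)
    consider "s < 0" | "s > t" | "s \<in> {0<..<t}" using elim by fastforce
    then show ?case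
    proof cases
      case 3
      then have "t - s \<in> {0<..<1}" "s \<in> {0<..<1}" using t by auto
      then show ?thesis using 3 elim by auto
    qed (use g(2)[of s] K(2)[of "t - s"] in auto)
  qed
qed measurable

text \<open>Causality. The iterates of \<open>cv K\<close> keep vanishing for x \<le> 0; beyond 1
  they may differ from 0, which is harmless because values at t < 1 involve earlier times
  only.\<close>

lemma Vop_funpow_eq_cv:
  assumes [measurable]: "K \<in> borel_measurable borel" "g \<in> borel_measurable borel"
    and K: "AE x in lborel. x \<in> {0<..<1} \<longrightarrow> k x = K x" "\<And>x. x \<le> 0 \<Longrightarrow> K x = 0"
    and g: "AE x in lborel. x \<in> {0<..<1} \<longrightarrow> u x = g x" "\<And>x. x \<le> 0 \<Longrightarrow> g x = 0"
  shows "AE t in lborel. t \<in> {0<..<1} \<longrightarrow> (Vop k ^^ n) u t = (cv K ^^ n) g t"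
proof (induction n)
  case (Suc n)
  have "(cv K ^^ n) g x = 0" if "x \<le> 0" for x
    using that by (induction n arbitrary: x) (auto simp: g(2) intro!: cv_eq_0 K(2))
  then have "Vop k ((Vop k ^^ n) u) t = cv K ((cv K ^^ n) g) t" if "t \<in> {0<..<1}" for t
    using K Suc that by (intro Vop_eq_cv) auto
  then show ?case by simp
qed (use g in simp)

text \<open>The exponential kernel is not cut off at 0, so here the support of \<open>g\<close> must
  supply both limits of integration. This is why kernels are compared on (-1,1) and not just on
  (0,1).\<close>

lemma Sop_eq_cv:
  assumes [measurable]: "g \<in> borel_measurable borel"
    and g: "AE x in lborel. x \<in> {0<..<1} \<longrightarrow> u x = g x" "\<And>x. x \<notin> {0<..<1} \<Longrightarrow> g x = 0"
  shows "Sop lam u t = cv (\<lambda>x. exp (lam * x)) g t"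
  unfolding Sop_def set_lebesgue_integral_def cv_def
proof (rule lebesgue_integral_cong_AE_lborel)
  show "AE s in lborel. indicat_real {0..1} s *\<^sub>R (exp (lam * (t - s)) * u s) = exp (lam * (t - s)) * g s"
    using g(1) AE_lborel_singleton[of 0] AE_lborel_singleton[of 1]
  proof eventually_elim
    case (elim s)
    then show ?case using g(2)[of s] by (cases "s \<in> {0<..<1}") (auto simp: indicator_def)
  qed
qed measurable

section \<open>Domination of signed convolutions by nonnegative ones\<close>

abbreviation ennabs :: "(real \<Rightarrow> real) \<Rightarrow> real \<Rightarrow> ennreal" where
  "ennabs f \<equiv> (\<lambda>x. ennreal \<bar>f x\<bar>)"

lemma laplace_mono_AE:
  "AE x in lborel. f x \<le> g x \<Longrightarrow> laplace c f \<le> laplace c g"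
  unfolding laplace_def by (intro nn_integral_mono_AE) (auto elim!: eventually_mono intro: mult_left_mono)

lemma cv_le_nnconv:
  assumes [measurable]: "K \<in> borel_measurable borel" "u \<in> borel_measurable borel"
  shows "ennreal \<bar>cv K u t\<bar> \<le> nnconv (ennabs K) (ennabs u) t"
proof (cases "integrable lborel (\<lambda>s. K (t - s) * u s)")
  case True
  then show ?thesis
    using integral_norm_bound_ennreal[OF True]
    by (simp add: cv_def nnconv_def abs_mult ennreal_mult')
qed (simp add: cv_def not_integrable_integral_eq)

lemma AE_integrable_cv:
  assumes [measurable]: "K \<in> borel_measurable borel" "u \<in> borel_measurable borel"
    and fin: "laplace c (ennabs K) < \<infinity>" "laplace c (ennabs u) < \<infinity>"
  shows "AE t in lborel. integrable lborel (\<lambda>s. K (t - s) * u s)"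
proof -
  have "laplace c (nnconv (ennabs K) (ennabs u)) < \<infinity>"
    using fin by (simp add: laplace_nnconv ennreal_mult_less_top)
  then have "AE t in lborel. nnconv (ennabs K) (ennabs u) t < \<infinity>"
    by (intro AE_less_top_of_laplace) auto
  then show ?thesis
    by eventually_elim (auto intro!: integrableI_bounded simp: nnconv_def abs_mult ennreal_mult')
qed

text \<open>Fubini's theorem at those t where the nonnegative triple convolution is finite; these
  are almost all t, because its Laplace transform is a product of three finite ones. As
  \<open>h\<close> is real valued, the inner integral can be read off as h(t - x) for every
  x.\<close>

lemma cv_assoc:
  assumes [measurable]: "f \<in> borel_measurable borel" "g \<in> borel_measurable borel" "u \<in> borel_measurable borel"
    and nn: "\<And>x. f x \<ge> 0" "\<And>x. g x \<ge> 0" "\<And>x. h x \<ge> 0"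
    and h: "nnconv (\<lambda>x. ennreal (f x)) (\<lambda>x. ennreal (g x)) = (\<lambda>x. ennreal (h x))"
    and fin: "laplace c (\<lambda>x. ennreal (f x)) < \<infinity>" "laplace c (\<lambda>x. ennreal (g x)) < \<infinity>" "laplace c (ennabs u) < \<infinity>"
  shows "AE t in lborel. cv f (cv g u) t = cv h u t"
proof -
  have "laplace c (nnconv (\<lambda>x. ennreal (f x)) (nnconv (\<lambda>x. ennreal (g x)) (ennabs u))) < \<infinity>"
    using fin by (simp add: laplace_nnconv ennreal_mult_less_top)
  then have "AE t in lborel. nnconv (\<lambda>x. ennreal (f x)) (nnconv (\<lambda>x. ennreal (g x)) (ennabs u)) t < \<infinity>"
    by (intro AE_less_top_of_laplace) auto
  then show ?thesis
  proof eventually_elim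
    fix t
    assume t: "nnconv (\<lambda>x. ennreal (f x)) (nnconv (\<lambda>x. ennreal (g x)) (ennabs u)) t < \<infinity>"
    have "(\<integral>\<^sup>+z. ennreal (norm (case z of (s, x) \<Rightarrow> f (t - s) * (g (s - x) * u x))) \<partial>(lborel \<Otimes>\<^sub>M lborel))
       = (\<integral>\<^sup>+s. \<integral>\<^sup>+x. ennreal (f (t - s)) * (ennreal (g (s - x)) * ennreal \<bar>u x\<bar>) \<partial>lborel \<partial>lborel)"
      using nn by (subst lborel.nn_integral_fst[symmetric]) (auto simp: abs_mult ennreal_mult')
    also have "\<dots> = nnconv (\<lambda>x. ennreal (f x)) (nnconv (\<lambda>x. ennreal (g x)) (ennabs u)) t"
      unfolding nnconv_def by (subst nn_integral_cmult) auto
    finally have int: "integrable (lborel \<Otimes>\<^sub>M lborel) (\<lambda>(s, x). f (t - s) * (g (s - x) * u x))"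
      using t by (intro integrableI_bounded) auto
    have "cv f (cv g u) t = (\<integral>s. \<integral>x. f (t - s) * (g (s - x) * u x) \<partial>lborel \<partial>lborel)"
      by (simp add: cv_def)
    also have "\<dots> = (\<integral>x. \<integral>s. f (t - s) * (g (s - x) * u x) \<partial>lborel \<partial>lborel)"
      using lborel_pair.Fubini_integral[OF int] by simp
    also have "\<dots> = (\<integral>x. (\<integral>s. f (t - s) * g (s - x) \<partial>lborel) * u x \<partial>lborel)"
      by (simp add: mult.assoc[symmetric])
    also have "\<dots> = cv h u t"
    proof -
      have "(\<integral>s. f (t - s) * g (s - x) \<partial>lborel) = h (t - x)" for x
      proof -
        have "(\<integral>\<^sup>+s. ennreal (f (t - s) * g (s - x)) \<partial>lborel) = (\<integral>\<^sup>+s. ennreal (f (t - x - s)) * ennreal (g s) \<partial>lborel)"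
          using nn nn_integral_lborel_shift[of "\<lambda>s. ennreal (f (t - x - s)) * ennreal (g s)" x]
          by (simp add: algebra_simps ennreal_mult')
        also have "\<dots> = ennreal (h (t - x))" using fun_cong[OF h, of "t - x"] by (simp add: nnconv_def)
        finally show ?thesis using nn by (subst integral_eq_nn_integral) auto
      qed
      then show ?thesis by (simp add: cv_def)
    qed
    finally show "cv f (cv g u) t = cv h u t" .
  qed
qed

text \<open>With U and W the iterates for \<open>K\<close> and \<open>H\<close>, the next difference
  U - W is K applied to the current difference plus K - H applied to the current W. Since |K| \<le>
  H + D and |K - H| \<le> D, this is the recursion of \<open>nnrem\<close>. The bound on the
  iterates of \<open>H\<close> is carried along because the second term needs it.\<close>

lemma cv_funpow_diff_le:
  assumes [measurable]: "K \<in> borel_measurable borel" "H \<in> borel_measurable borel"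
      "D \<in> borel_measurable borel" "g \<in> borel_measurable borel"
    and KH: "\<And>x. ennreal \<bar>K x - H x\<bar> \<le> D x" "\<And>x. H x \<ge> 0"
    and fin: "laplace c (\<lambda>x. ennreal (H x)) < \<infinity>" "laplace c D < \<infinity>" "laplace c (ennabs g) < \<infinity>"
  shows "(AE t in lborel. ennreal \<bar>(cv H ^^ Suc n) g t\<bar> \<le> nnconv (nnpow (\<lambda>x. ennreal (H x)) n) (ennabs g) t) \<and>
     (AE t in lborel. ennreal \<bar>(cv K ^^ Suc n) g t - (cv H ^^ Suc n) g t\<bar>
        \<le> nnconv (nnrem (\<lambda>x. ennreal (H x)) D n) (ennabs g) t)"
proof -
  define HH where "HH = (\<lambda>x. ennreal (H x))"
  define B where "B = (\<lambda>x. HH x + D x)"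
  define U where "U n = (cv K ^^ n) g" for n
  define W where "W n = (cv H ^^ n) g" for n
  have [measurable]: "HH \<in> borel_measurable borel" "B \<in> borel_measurable borel"
    "U n \<in> borel_measurable borel" "W n \<in> borel_measurable borel" for n
    unfolding HH_def B_def U_def W_def by measurable
  have US: "U (Suc n) = cv K (U n)" and WS: "W (Suc n) = cv H (W n)" for n by (simp_all add: U_def W_def)
  have K: "ennreal \<bar>K x\<bar> \<le> B x" for x
  proof -
    have "\<bar>K x\<bar> \<le> H x + \<bar>K x - H x\<bar>" using KH(2)[of x] by linarith
    then have "ennreal \<bar>K x\<bar> \<le> ennreal (H x + \<bar>K x - H x\<bar>)" by (rule ennreal_leI)
    also have "\<dots> = HH x + ennreal \<bar>K x - H x\<bar>"
      unfolding HH_def using KH(2)[of x] by (intro ennreal_plus) auto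
    also have "\<dots> \<le> B x" unfolding B_def by (intro add_left_mono KH)
    finally show ?thesis .
  qed
  have H: "ennabs H = HH" using KH(2) by (simp add: HH_def fun_eq_iff)
  have finB: "laplace c B < \<infinity>" using fin unfolding B_def by (subst laplace_add) (auto simp: HH_def)
  have finK: "laplace c (ennabs K) < \<infinity>"
    using laplace_mono_AE[of "ennabs K" B c] K finB by (auto intro: le_less_trans)
  have finH: "laplace c (ennabs H) < \<infinity>" using fin H by (simp add: HH_def)
  have finU: "laplace c (ennabs (U n)) < \<infinity>" for n
  proof (induction n)
    case (Suc n)
    have "laplace c (ennabs (U (Suc n))) \<le> laplace c (nnconv (ennabs K) (ennabs (U n)))"
      unfolding US by (intro laplace_mono_AE always_eventually allI cv_le_nnconv) auto
    also have "\<dots> < \<infinity>" using Suc finK by (simp add: laplace_nnconv ennreal_mult_less_top)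
    finally show ?case .
  qed (use fin in \<open>simp add: U_def\<close>)
  have finW: "laplace c (ennabs (W n)) < \<infinity>" for n
  proof (induction n)
    case (Suc n)
    have "laplace c (ennabs (W (Suc n))) \<le> laplace c (nnconv (ennabs H) (ennabs (W n)))"
      unfolding WS by (intro laplace_mono_AE always_eventually allI cv_le_nnconv) auto
    also have "\<dots> < \<infinity>" using Suc finH by (simp add: laplace_nnconv ennreal_mult_less_top)
    finally show ?case .
  qed (use fin in \<open>simp add: W_def\<close>)
  \<comment> \<open>Splitting the difference of the two integrals needs each of them to converge,
    which holds for almost every t by the propagated Laplace bounds \<open>finU\<close> and
    \<open>finW\<close>.\<close>
  have step: "AE t in lborel. ennreal \<bar>U (Suc n) t - W (Suc n) t\<bar>
      \<le> nnconv B (ennabs (\<lambda>s. U n s - W n s)) t + nnconv D (ennabs (W n)) t" for n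
  proof -
    have "AE t in lborel. integrable lborel (\<lambda>s. K (t - s) * U n s)"
      "AE t in lborel. integrable lborel (\<lambda>s. K (t - s) * W n s)"
      "AE t in lborel. integrable lborel (\<lambda>s. H (t - s) * W n s)"
      by (rule AE_integrable_cv[where c=c]; use finK finH finU finW in simp)+
    then show ?thesis
    proof eventually_elim
      case (elim t)
      have "U (Suc n) t - W (Suc n) t = cv K (\<lambda>s. U n s - W n s) t + cv (\<lambda>x. K x - H x) (W n) t"
        unfolding US WS cv_def using elim by (simp add: left_diff_distrib right_diff_distrib)
      then have "ennreal \<bar>U (Suc n) t - W (Suc n) t\<bar>
          \<le> ennreal (\<bar>cv K (\<lambda>s. U n s - W n s) t\<bar> + \<bar>cv (\<lambda>x. K x - H x) (W n) t\<bar>)"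
        by (intro ennreal_leI) linarith
      also have "\<dots> = ennreal \<bar>cv K (\<lambda>s. U n s - W n s) t\<bar> + ennreal \<bar>cv (\<lambda>x. K x - H x) (W n) t\<bar>"
        by simp
      also have "\<dots> \<le> nnconv (ennabs K) (ennabs (\<lambda>s. U n s - W n s)) t + nnconv (ennabs (\<lambda>x. K x - H x)) (ennabs (W n)) t"
        by (intro add_mono cv_le_nnconv) measurable
      also have "\<dots> \<le> nnconv B (ennabs (\<lambda>s. U n s - W n s)) t + nnconv D (ennabs (W n)) t"
        unfolding nnconv_def by (intro add_mono nn_integral_mono mult_right_mono K KH) auto
      finally show ?case .
    qed
  qed
  have "(AE t in lborel. ennreal \<bar>W (Suc n) t\<bar> \<le> nnconv (nnpow HH n) (ennabs g) t) \<and>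
     (AE t in lborel. ennreal \<bar>U (Suc n) t - W (Suc n) t\<bar> \<le> nnconv (nnrem HH D n) (ennabs g) t)"
  proof (induction n)
    case 0
    have "ennreal \<bar>W (Suc 0) t\<bar> \<le> nnconv (nnpow HH 0) (ennabs g) t" for t
      unfolding WS using cv_le_nnconv[of H "W 0" t] H by (simp add: W_def)
    moreover have "nnconv B (ennabs (\<lambda>s. U 0 s - W 0 s)) t = 0" for t
      by (simp add: U_def W_def nnconv_def)
    ultimately show ?case using step[of 0] by (simp add: W_def)
  next
    case (Suc n)
    have "ennreal \<bar>W (Suc (Suc n)) t\<bar> \<le> nnconv (nnpow HH (Suc n)) (ennabs g) t" for t
    proof -
      have "ennreal \<bar>W (Suc (Suc n)) t\<bar> \<le> nnconv HH (ennabs (W (Suc n))) t"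
        unfolding WS[of "Suc n"] using cv_le_nnconv[of H "W (Suc n)" t] H by simp
      also have "\<dots> \<le> nnconv HH (nnconv (nnpow HH n) (ennabs g)) t"
        using Suc by (intro nnconv_mono_AE) auto
      also have "\<dots> = nnconv (nnpow HH (Suc n)) (ennabs g) t"
        by (simp add: nnconv_assoc)
      finally show ?thesis .
    qed
    moreover have "AE t in lborel. ennreal \<bar>U (Suc (Suc n)) t - W (Suc (Suc n)) t\<bar> \<le> nnconv (nnrem HH D (Suc n)) (ennabs g) t"
      using step[of "Suc n"]
    proof eventually_elim
      case (elim t)
      have "nnconv B (ennabs (\<lambda>s. U (Suc n) s - W (Suc n) s)) t + nnconv D (ennabs (W (Suc n))) t
         \<le> nnconv B (nnconv (nnrem HH D n) (ennabs g)) t + nnconv D (nnconv (nnpow HH n) (ennabs g)) t"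
        using Suc by (intro add_mono nnconv_mono_AE) auto
      also have "\<dots> = nnconv (nnconv B (nnrem HH D n)) (ennabs g) t + nnconv (nnconv D (nnpow HH n)) (ennabs g) t"
        by (simp add: nnconv_assoc)
      also have "\<dots> = nnconv (nnrem HH D (Suc n)) (ennabs g) t"
        by (simp add: nnconv_add_left B_def)
      finally show ?case using elim by simp
    qed
    ultimately show ?case by simp
  qed
  then show ?thesis unfolding U_def W_def HH_def .
qed

section \<open>Powers of the model operator and their exponential replacement\<close>

lemma cv_funpow_pker:
  assumes a: "a > 0" and C: "C \<ge> 0" and [measurable]: "g \<in> borel_measurable borel"
    and fin: "laplace l (ennabs g) < \<infinity>" and l: "l > c"
  shows "AE t in lborel. (cv (\<lambda>x. C * pker c a x) ^^ Suc n) g t = cv (\<lambda>x. C ^ Suc n * pker c (a * Suc n) x) g t"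
proof (induction n)
  case (Suc n)
  let ?f = "\<lambda>x. C * pker c a x" and ?g = "\<lambda>x. C ^ Suc n * pker c (a * Suc n) x"
    and ?h = "\<lambda>x. C ^ Suc (Suc n) * pker c (a * Suc (Suc n)) x"
  have an: "a * Suc n > 0" "a * Suc (Suc n) > 0" using a by auto
  have L: "laplace l (\<lambda>x. ennreal (E * pker c b x)) < \<infinity>" if "b > 0" "E \<ge> 0" for b E
  proof -
    have "laplace l (\<lambda>x. ennreal (E * pker c b x)) = ennreal E * laplace l (\<lambda>x. ennreal (pker c b x))"
      unfolding laplace_def using that
      by (subst nn_integral_cmult[symmetric]) (auto simp: ennreal_mult' mult_ac)
    then show ?thesis using that l by (simp add: laplace_pker ennreal_mult_less_top)
  qed
  \<comment> \<open>The convolution of the first power with the current one is the next power by the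
    recursion of \<open>nnpow\<close>, so the closed form at two consecutive indices
    suffices.\<close>
  have conv: "nnconv (\<lambda>x. ennreal (?f x)) (\<lambda>x. ennreal (?g x)) = (\<lambda>x. ennreal (?h x))"
    using nnpow_pker[OF a C, of c "Suc n"] nnpow_pker[OF a C, of c n] by simp
  have "AE t in lborel. cv ?f (cv ?g g) t = cv ?h g t"
    by (rule cv_assoc[where c=l])
      (use a an C pker_nonneg L[OF a C] L[OF an(1), of "C ^ Suc n"] conv fin in auto)
  moreover have "cv ?f ((cv ?f ^^ Suc n) g) t = cv ?f (cv ?g g) t" for t
    using Suc by (intro cv_cong_AE) auto
  ultimately show ?case by simp
qed simp

text \<open>Because ln x \<le> x - 1, the exponential E dominates the power P, so the distance in L1
  is a difference of integrals: at most 1/N for E over [-1,1], and 1/(N + 1) for P. The interval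
  (-1,0] has to be included, since there the replacing kernel does not vanish. The common factor
  exp(\<mu>x) is at most exp |\<mu>|.\<close>

lemma nn_integral_pker_exp_diff:
  fixes b \<mu> C :: real
  assumes b: "b > 1" and C: "C \<ge> 0"
  defines "N \<equiv> b - 1"
  shows "(\<integral>\<^sup>+x. ennreal \<bar>C * pker \<mu> b x - C * exp (- N) / Gamma b * exp ((N + \<mu>) * x)\<bar> * indicator {-1<..<1} x \<partial>lborel)
    \<le> ennreal (C / Gamma b * exp \<bar>\<mu>\<bar> * (1 / N - 1 / (N + 1)))"
proof -
  define P where "P x = (if x > 0 then x powr N else 0)" for x :: real
  define E where "E x = exp (N * (x - 1))" for x
  have N: "N > 0" using b by (simp add: N_def)
  have G: "Gamma b > 0" using b by simp
  have [measurable]: "P \<in> borel_measurable borel" "E \<in> borel_measurable borel"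
    unfolding P_def E_def by measurable
  have PE: "P x \<le> E x" if "x < 1" for x
  proof (cases "x > 0")
    case True
    have "ln x \<le> x - 1" using True by (intro ln_le_minus_one)
    then have "N * ln x \<le> N * (x - 1)" using N by (intro mult_left_mono) auto
    then show ?thesis using True by (simp add: P_def E_def powr_def)
  qed (simp add: P_def E_def)
  have "(\<integral>\<^sup>+x. ennreal (E x - P x) * indicator {-1<..<1} x \<partial>lborel) + ennreal (1 / (N + 1))
     \<le> ennreal (1 / N)"
  proof -
    have "((\<lambda>t. t powr N) has_integral (1 powr (N + 1) / (N + 1))) {0..1}"
      using N by (intro has_integral_powr_from_0) auto
    then have 1: "((\<lambda>t. t powr N) has_integral (1 / (N + 1))) {0..1}" by simp
    have "ennreal (1 / (N + 1)) = (\<integral>\<^sup>+t. ennreal (indicator {0..1} t * t powr N) \<partial>lborel)"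
      using nn_integral_has_integral_lebesgue[OF _ 1] by simp
    also have "\<dots> = (\<integral>\<^sup>+x. ennreal (P x) * indicator {-1<..<1} x \<partial>lborel)"
      using AE_lborel_singleton[of 1] by (intro nn_integral_cong_AE) (auto elim!: eventually_mono simp: P_def indicator_def)
    finally have "(\<integral>\<^sup>+x. ennreal (E x - P x) * indicator {-1<..<1} x \<partial>lborel) + ennreal (1 / (N + 1))
       = (\<integral>\<^sup>+x. ennreal (E x - P x) * indicator {-1<..<1} x + ennreal (P x) * indicator {-1<..<1} x \<partial>lborel)"
      by (subst nn_integral_add) auto
    also have "\<dots> \<le> (\<integral>\<^sup>+x. ennreal (E x) * indicator {-1..1} x \<partial>lborel)"
    proof (rule nn_integral_mono)
      fix x :: real
      show "ennreal (E x - P x) * indicator {-1<..<1} x + ennreal (P x) * indicator {-1<..<1} x \<le> ennreal (E x) * indicator {-1..1} x"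
        using PE[of x] by (auto simp: indicator_def P_def ennreal_plus[symmetric] simp del: ennreal_plus)
    qed
    also have "\<dots> = ennreal (E 1 / N - E (-1) / N)"
      by (rule nn_integral_FTC_Icc)
        (use N in \<open>auto simp: E_def intro!: derivative_eq_intros\<close>)
    also have "\<dots> \<le> ennreal (1 / N)" using N by (intro ennreal_leI) (simp add: E_def)
    finally show ?thesis .
  qed
  moreover have "ennreal (1 / N) = ennreal (1 / (N + 1)) + ennreal (1 / N - 1 / (N + 1))"
    using N by (subst ennreal_plus[symmetric]) (auto simp: divide_simps)
  ultimately have 1: "(\<integral>\<^sup>+x. ennreal (E x - P x) * indicator {-1<..<1} x \<partial>lborel) \<le> ennreal (1 / N - 1 / (N + 1))"
    by (simp add: add.commute ennreal_add_left_cancel_le)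
  have "(\<integral>\<^sup>+x. ennreal \<bar>C * pker \<mu> b x - C * exp (- N) / Gamma b * exp ((N + \<mu>) * x)\<bar> * indicator {-1<..<1} x \<partial>lborel)
    \<le> (\<integral>\<^sup>+x. ennreal (C / Gamma b * exp \<bar>\<mu>\<bar>) * (ennreal (E x - P x) * indicator {-1<..<1} x) \<partial>lborel)"
  proof (rule nn_integral_mono)
    fix x :: real
    show "ennreal \<bar>C * pker \<mu> b x - C * exp (- N) / Gamma b * exp ((N + \<mu>) * x)\<bar> * indicator {-1<..<1} x
       \<le> ennreal (C / Gamma b * exp \<bar>\<mu>\<bar>) * (ennreal (E x - P x) * indicator {-1<..<1} x)"
    proof (cases "x \<in> {-1<..<1}")
      case True
      define q where "q = C / Gamma b * exp (\<mu> * x)"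
      have q: "q \<ge> 0" using C G by (simp add: q_def)
      have 1: "C * pker \<mu> b x = q * P x" unfolding q_def
        by (simp add: pker_def P_def N_def)
      have 2: "C * exp (- N) / Gamma b * exp ((N + \<mu>) * x) = q * E x" unfolding q_def
        by (simp add: E_def exp_diff exp_minus distrib_right exp_add right_diff_distrib field_simps)
      have "\<bar>C * pker \<mu> b x - C * exp (- N) / Gamma b * exp ((N + \<mu>) * x)\<bar> = q * (E x - P x)"
        unfolding 1 2 using q PE[of x] True by (simp add: right_diff_distrib mult_left_mono)
      also have "\<dots> = C / Gamma b * exp (\<mu> * x) * (E x - P x)" by (simp add: q_def)
      also have "\<dots> \<le> C / Gamma b * exp \<bar>\<mu>\<bar> * (E x - P x)"
      proof (intro mult_right_mono mult_left_mono)
        have "\<bar>\<mu> * x\<bar> \<le> \<bar>\<mu>\<bar> * 1" unfolding abs_mult using True by (intro mult_left_mono) auto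
        then show "exp (\<mu> * x) \<le> exp \<bar>\<mu>\<bar>" by simp
      qed (use C G PE[of x] True in auto)
      finally show ?thesis using True C G PE[of x]
        by (simp add: ennreal_mult'[symmetric] ennreal_leI)
    qed simp
  qed
  also have "\<dots> \<le> ennreal (C / Gamma b * exp \<bar>\<mu>\<bar>) * ennreal (1 / N - 1 / (N + 1))"
    by (subst nn_integral_cmult) (auto intro!: mult_left_mono 1)
  also have "\<dots> = ennreal (C / Gamma b * exp \<bar>\<mu>\<bar> * (1 / N - 1 / (N + 1)))"
    using C G by (intro ennreal_mult'[symmetric]) simp
  finally show ?thesis .
qed

section \<open>Norm identities\<close>

lemma Lple_mono:
  assumes "Lple p C u" "C \<le> C'" "0 \<le> C" "1 \<le> p"
  shows "Lple p C' u"
  using assms by (simp add: Lple_iff)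

lemma Lple_cmult:
  assumes p: "1 \<le> p" and u: "Lple p C u" and C: "C \<ge> 0"
  shows "Lple p (\<bar>c\<bar> * C) (\<lambda>t. c * u t)"
  using p
proof (cases rule: ereal_ge_1_cases)
  case 1
  have "AE t in M01. \<bar>u t\<bar> \<le> C" using u 1 by (simp add: Lple_def)
  then have "AE t in M01. \<bar>c * u t\<bar> \<le> \<bar>c\<bar> * C"
    by eventually_elim (auto simp: abs_mult intro: mult_left_mono)
  then show ?thesis using u 1 by (auto simp: Lple_def intro!: borel_measurable_times)
next
  case (2 p')
  have [measurable]: "u \<in> borel_measurable M01" using u by (simp add: Lple_def)
  have "(\<integral>\<^sup>+t. ennreal (\<bar>c * u t\<bar> powr p') \<partial>M01) = ennreal (\<bar>c\<bar> powr p') * (\<integral>\<^sup>+t. ennreal (\<bar>u t\<bar> powr p') \<partial>M01)"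
    by (subst nn_integral_cmult[symmetric]) (auto simp: abs_mult powr_mult ennreal_mult')
  also have "\<dots> \<le> ennreal (\<bar>c\<bar> powr p') * ennreal (C powr p')"
    using u 2 by (intro mult_left_mono) (auto simp: Lple_def)
  also have "\<dots> = ennreal ((\<bar>c\<bar> * C) powr p')" using C by (simp add: ennreal_mult'[symmetric] powr_mult)
  finally show ?thesis using 2 by (simp add: Lple_def)
qed

lemma pnorm_le: "1 \<le> p \<Longrightarrow> C \<ge> 0 \<Longrightarrow> Lple p C u \<Longrightarrow> pnorm p u \<le> C"
  by (simp add: Lple_iff)

lemma Lple_Lp: "1 \<le> p \<Longrightarrow> C \<ge> 0 \<Longrightarrow> Lple p C u \<Longrightarrow> u \<in> Lp p"
  by (simp add: Lple_iff)

lemma Lp_cmult: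
  assumes "1 \<le> p" "u \<in> Lp p"
  shows "(\<lambda>t. c * u t) \<in> Lp p"
  using Lple_Lp[OF _ _ Lple_cmult[OF _ Lple_pnorm]] assms pnorm_nonneg by (metis abs_ge_zero mult_nonneg_nonneg)

lemma pnorm_cmult:
  assumes p: "1 \<le> p" and u: "u \<in> Lp p"
  shows "pnorm p (\<lambda>t. c * u t) = \<bar>c\<bar> * pnorm p u"
proof -
  have le: "pnorm p (\<lambda>t. c * u t) \<le> \<bar>c\<bar> * pnorm p u" if "u \<in> Lp p" for c u
    using Lple_cmult[OF p Lple_pnorm[OF p that] pnorm_nonneg, of c] p pnorm_nonneg[of p u]
    by (intro pnorm_le) auto
  show ?thesis
  proof (cases "c = 0")
    case True
    then show ?thesis using le[OF u, of 0] pnorm_nonneg[of p "\<lambda>t. 0"] by simp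
  next
    case False
    have "pnorm p (\<lambda>t. (1 / c) * (c * u t)) \<le> \<bar>1 / c\<bar> * pnorm p (\<lambda>t. c * u t)"
      by (intro le Lp_cmult p u)
    then have "\<bar>c\<bar> * pnorm p u \<le> pnorm p (\<lambda>t. c * u t)"
      using False by (simp add: field_simps)
    with le[OF u, of c] show ?thesis by simp
  qed
qed

lemma Lp_add:
  assumes "1 \<le> p" "u \<in> Lp p" "v \<in> Lp p"
  shows "(\<lambda>t. u t + v t) \<in> Lp p"
proof -
  have "Lple p (pnorm p w + 1) w" if "w \<in> Lp p" for w
    using Lple_mono[OF Lple_pnorm[OF assms(1) that]] pnorm_nonneg[of p w] assms(1) by simp
  then show ?thesis
    using Lple_add[OF assms(1), of "pnorm p u + 1" "pnorm p v + 1" u v] assms pnorm_nonneg[of p u] pnorm_nonneg[of p v]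
    by (auto intro: Lple_Lp[of _ "pnorm p u + 1 + (pnorm p v + 1)"])
qed

text \<open>The slack e/2 keeps both bounds positive, as \<open>Lple_add\<close> requires, even if
  one of the norms is 0.\<close>

lemma pnorm_triangle:
  assumes p: "1 \<le> p" and u: "u \<in> Lp p" and v: "v \<in> Lp p"
  shows "pnorm p (\<lambda>t. u t + v t) \<le> pnorm p u + pnorm p v"
proof (rule field_le_epsilon)
  fix e :: real assume e: "e > 0"
  have *: "Lple p (pnorm p w + e / 2) w" if "w \<in> Lp p" for w
    using Lple_mono[OF Lple_pnorm[OF p that]] pnorm_nonneg[of p w] p e by simp
  have "Lple p (pnorm p u + e / 2 + (pnorm p v + e / 2)) (\<lambda>t. u t + v t)"
    using *[OF u] *[OF v] e pnorm_nonneg[of p u] pnorm_nonneg[of p v] by (intro Lple_add p) auto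
  then show "pnorm p (\<lambda>t. u t + v t) \<le> pnorm p u + pnorm p v + e"
    using pnorm_le[OF p, of "pnorm p u + e / 2 + (pnorm p v + e / 2)"] e pnorm_nonneg[of p u] pnorm_nonneg[of p v]
    by (simp add: add_ac)
qed

section \<open>Norms of exponentials\<close>

lemma nn_integral_exp_M01:
  fixes b :: real
  assumes b: "b \<noteq> 0"
  shows "(\<integral>\<^sup>+t. ennreal (exp (b * t)) \<partial>M01) = ennreal ((exp b - 1) / b)"
proof -
  have "(\<integral>\<^sup>+t. ennreal (exp (b * t)) \<partial>M01) = (\<integral>\<^sup>+t. ennreal (exp (b * t)) * indicator {0..1} t \<partial>lborel)"
    unfolding nn_integral_M01 using AE_lborel_singleton[of 0] AE_lborel_singleton[of 1]
    by (intro nn_integral_cong_AE, eventually_elim) (auto simp: indicator_def)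
  also have "\<dots> = ennreal (exp (b * 1) / b - exp (b * 0) / b)"
    by (rule nn_integral_FTC_Icc) (use b in \<open>auto intro!: derivative_eq_intros\<close>)
  finally show ?thesis by (simp add: diff_divide_distrib)
qed

lemma measurable_exp_M01: "(\<lambda>t. exp (b * t)) \<in> borel_measurable M01"
  by (rule borel_measurable_M01I) measurable

lemma powr_exp: "exp (x :: real) powr p = exp (p * x)"
  by (simp add: powr_def)

lemma pnorm_exp:
  assumes p: "p \<ge> 1" and b: "b \<noteq> 0"
  shows "pnorm (ereal p) (\<lambda>t. exp (b * t)) = ((exp (p * b) - 1) / (p * b)) powr (1 / p)"
proof -
  have "integral\<^sup>L M01 (\<lambda>t. exp (p * b * t)) = enn2real (\<integral>\<^sup>+t. ennreal (exp (p * b * t)) \<partial>M01)"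
    by (rule integral_eq_nn_integral) (auto intro: measurable_exp_M01)
  also have "\<dots> = (exp (p * b) - 1) / (p * b)"
    using p b nn_integral_exp_M01[of "p * b"]
    by (cases "b > 0") (auto simp: zero_le_divide_iff zero_le_mult_iff mult_le_0_iff)
  finally show ?thesis by (simp add: pnorm_def powr_exp mult_ac)
qed

lemma AE_lborel_interval_ex:
  fixes l r :: real
  assumes "AE t in lborel. P t" "l < r"
  shows "\<exists>t\<in>{l<..<r}. P t"
proof (rule ccontr)
  assume "\<not> ?thesis"
  then have "AE t in lborel. t \<notin> {l<..<r}" using assms(1) by (auto elim!: eventually_mono)
  then have "{l<..<r} \<in> null_sets lborel" by (subst AE_iff_null_sets) auto
  then show False using assms(2) by (simp add: null_sets_def)
qed

text \<open>The supremum is only approached as t tends to 1. By continuity a smaller essential bound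
  would be exceeded on an interval ending at 1, which has positive measure.\<close>

lemma pnorm_exp_infinity:
  assumes b: "b \<ge> 0"
  shows "pnorm \<infinity> (\<lambda>t. exp (b * t)) = exp b" "(\<lambda>t. exp (b * t)) \<in> Lp \<infinity>"
proof -
  have L: "Lple \<infinity> (exp b) (\<lambda>t. exp (b * t))"
    using b by (auto simp: Lple_def AE_M01 measurable_exp_M01 intro!: always_eventually mult_left_le)
  then show Lp: "(\<lambda>t. exp (b * t)) \<in> Lp \<infinity>" by (intro Lple_Lp[where C="exp b"]) auto
  have "pnorm \<infinity> (\<lambda>t. exp (b * t)) \<le> exp b" using L by (intro pnorm_le) auto
  moreover have "exp b \<le> pnorm \<infinity> (\<lambda>t. exp (b * t))"
  proof (rule ccontr)
    assume less: "\<not> ?thesis"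
    define C where "C = pnorm \<infinity> (\<lambda>t. exp (b * t))"
    have "AE t in M01. exp (b * t) \<le> C"
      using Lple_pnorm[OF _ Lp] by (auto simp: Lple_def C_def)
    then have AE: "AE t in lborel. t \<in> {0<..<1} \<longrightarrow> exp (b * t) \<le> C" by (simp add: AE_M01)
    have "((\<lambda>t. exp (b * t)) \<longlongrightarrow> exp (b * 1)) (at_left 1)" by (intro tendsto_intros)
    then have "eventually (\<lambda>t. exp (b * t) > C) (at_left 1)"
      using less by (intro order_tendstoD) (auto simp: C_def)
    then obtain l where l: "l < 1" "\<And>t. l < t \<Longrightarrow> t < 1 \<Longrightarrow> exp (b * t) > C"
      unfolding eventually_at_left_field by auto
    obtain t where "t \<in> {max 0 l<..<1}" "t \<in> {0<..<1} \<longrightarrow> exp (b * t) \<le> C"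
      using AE_lborel_interval_ex[OF AE, of "max 0 l" 1] l by auto
    then show False using l(2)[of t] by auto
  qed
  ultimately show "pnorm \<infinity> (\<lambda>t. exp (b * t)) = exp b" by simp
qed

lemma Lp_exp:
  assumes p: "1 \<le> p"
  shows "(\<lambda>t. exp (b * t)) \<in> Lp p"
proof -
  have le: "exp (b * t) \<le> exp \<bar>b\<bar>" if "t \<in> {0<..<1}" for t
  proof -
    have "\<bar>b * t\<bar> \<le> \<bar>b\<bar> * 1" unfolding abs_mult using that by (intro mult_left_mono) auto
    then show ?thesis by simp
  qed
  have "Lple p (exp \<bar>b\<bar>) (\<lambda>t. exp (b * t))" using p
  proof (cases rule: ereal_ge_1_cases)
    case 1
    then show ?thesis using le by (auto simp: Lple_def AE_M01 measurable_exp_M01)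
  next
    case (2 p')
    have "(\<integral>\<^sup>+t. ennreal (exp (b * t) powr p') \<partial>M01) \<le> (\<integral>\<^sup>+t. ennreal (exp \<bar>b\<bar> powr p') \<partial>M01)"
      using le 2 by (intro nn_integral_mono_AE) (auto simp: AE_M01 intro!: ennreal_leI powr_mono2)
    also have "\<dots> = ennreal (exp \<bar>b\<bar> powr p')" by (simp add: emeasure_M01)
    finally show ?thesis using 2 by (simp add: Lple_def measurable_exp_M01)
  qed
  then show ?thesis by (intro Lple_Lp[OF p]) auto
qed

text \<open>Upper bounds, asymptotically sharp as \<open>l \<rightarrow> \<infinity>\<close>, for the \<open>L\<^sup>p\<close> norm of \<open>e\<^bsup>lt\<^esup>\<close> and the \<open>L\<^sup>q\<close> norm of \<open>e\<^bsup>-lt\<^esup>\<close>,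
  where \<open>q\<close> is the conjugate exponent.\<close>

definition expnorm :: "ereal \<Rightarrow> real \<Rightarrow> real" where
  "expnorm p l = exp l * (if p = \<infinity> then 1 else (1 / (real_of_ereal p * l)) powr (1 / real_of_ereal p))"

definition expnorm_dual :: "ereal \<Rightarrow> real \<Rightarrow> real" where
  "expnorm_dual p l = (if p = 1 then 1 else if p = \<infinity> then 1 / l
     else (let q = real_of_ereal p / (real_of_ereal p - 1) in (1 / (q * l)) powr (1 / q)))"

lemma Lple_exp:
  assumes p: "1 \<le> p" and l: "l > 0"
  shows "Lple p (expnorm p l) (\<lambda>t. exp (l * t))"
  using p
proof (cases rule: ereal_ge_1_cases)
  case 1
  then show ?thesis using l
    by (auto simp: Lple_def expnorm_def AE_M01 measurable_exp_M01 intro!: always_eventually)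
next
  case (2 p')
  have "(\<integral>\<^sup>+t. ennreal (exp (l * t) powr p') \<partial>M01) = ennreal ((exp (p' * l) - 1) / (p' * l))"
    using nn_integral_exp_M01[of "p' * l"] 2 l by (simp add: powr_exp mult_ac)
  also have "\<dots> \<le> ennreal (exp (p' * l) / (p' * l))"
    using 2 l by (intro ennreal_leI divide_right_mono) auto
  also have "exp (p' * l) / (p' * l) = expnorm p l powr p'"
    using 2 l by (simp add: expnorm_def powr_mult powr_powr powr_exp powr_divide)
  finally show ?thesis using 2 by (simp add: Lple_def measurable_exp_M01)
qed

section \<open>Operator estimates\<close>

text \<open>For finite p, from x \<le> 1 + x^p on a space of total mass 1. It puts every admissible
  function in L1, whence its Laplace transforms are finite.\<close>

lemma Lple_nn_integral_abs_less_top: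
  assumes p: "1 \<le> p" and u: "Lple p C u"
  shows "(\<integral>\<^sup>+t. ennreal \<bar>u t\<bar> \<partial>M01) < \<infinity>"
  using p
proof (cases rule: ereal_ge_1_cases)
  case 1
  have "(\<integral>\<^sup>+t. ennreal \<bar>u t\<bar> \<partial>M01) \<le> (\<integral>\<^sup>+t. ennreal C \<partial>M01)"
    using u 1 by (intro nn_integral_mono_AE) (auto simp: Lple_def elim!: eventually_mono intro: ennreal_leI)
  also have "\<dots> < \<infinity>" by (simp add: emeasure_M01)
  finally show ?thesis .
next
  case (2 p')
  have [measurable]: "u \<in> borel_measurable M01" using u by (simp add: Lple_def)
  have le: "x \<le> 1 + x powr p'" if "x \<ge> 0" for x :: real
  proof (cases "x \<le> 1")
    case False
    then have "x powr 1 \<le> x powr p'" using 2 by (intro powr_mono) auto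
    then show ?thesis using False by simp
  qed (simp add: add_increasing2)
  have "(\<integral>\<^sup>+t. ennreal \<bar>u t\<bar> \<partial>M01) \<le> (\<integral>\<^sup>+t. 1 + ennreal (\<bar>u t\<bar> powr p') \<partial>M01)"
  proof (rule nn_integral_mono)
    fix t
    have "ennreal \<bar>u t\<bar> \<le> ennreal (1 + \<bar>u t\<bar> powr p')" by (intro ennreal_leI le) auto
    then show "ennreal \<bar>u t\<bar> \<le> 1 + ennreal (\<bar>u t\<bar> powr p')" by simp
  qed
  also have "\<dots> = 1 + (\<integral>\<^sup>+t. ennreal (\<bar>u t\<bar> powr p') \<partial>M01)"
    by (subst nn_integral_add) (auto simp: emeasure_M01)
  also have "\<dots> < \<infinity>" using u 2 by (auto simp: Lple_def le_less_trans)
  finally show ?thesis .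
qed

lemma ennreal_add_mult:
  "x \<ge> 0 \<Longrightarrow> y \<ge> 0 \<Longrightarrow> a \<ge> 0 \<Longrightarrow> b \<ge> 0 \<Longrightarrow>
    ennreal (x * a + y * b) = ennreal x * ennreal a + ennreal y * ennreal b"
  by (simp add: ennreal_mult')

lemma exp_mult_le_exp_abs:
  fixes c t :: real
  assumes "\<bar>t\<bar> \<le> 1"
  shows "exp (c * t) \<le> exp \<bar>c\<bar>"
proof -
  have "\<bar>c * t\<bar> \<le> \<bar>c\<bar> * 1" unfolding abs_mult using assms by (intro mult_left_mono) auto
  then show ?thesis by simp
qed

lemma Lple_laplace_less_top:
  assumes p: "1 \<le> p" and u: "Lple p C g" and [measurable]: "g \<in> borel_measurable borel"
    and g: "\<And>x. x \<notin> {0<..<1} \<Longrightarrow> g x = 0"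
  shows "laplace c (ennabs g) < \<infinity>"
proof -
  have "laplace c (ennabs g) \<le> (\<integral>\<^sup>+t. ennreal (exp \<bar>c\<bar>) * (ennreal \<bar>g t\<bar> * indicator {0<..<1} t) \<partial>lborel)"
    unfolding laplace_def
  proof (rule nn_integral_mono)
    fix t :: real
    show "ennreal (exp (- c * t)) * ennreal \<bar>g t\<bar> \<le> ennreal (exp \<bar>c\<bar>) * (ennreal \<bar>g t\<bar> * indicator {0<..<1} t)"
      using g[of t] exp_mult_le_exp_abs[of t "- c"]
      by (cases "t \<in> {0<..<1}") (auto intro!: mult_right_mono ennreal_leI)
  qed
  also have "\<dots> = ennreal (exp \<bar>c\<bar>) * (\<integral>\<^sup>+t. ennreal \<bar>g t\<bar> \<partial>M01)"
    unfolding nn_integral_M01 by (rule nn_integral_cmult) measurable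
  also have "\<dots> < \<infinity>"
    using Lple_nn_integral_abs_less_top[OF p u] by (simp add: ennreal_mult_less_top)
  finally show ?thesis .
qed

text \<open>The kernel splits as exp(lt) exp(-ls), so the operator has rank one. The number
  \<open>Sop l u 0\<close> is the pairing of \<open>u\<close> with exp(-ls), and exp(lt) spans the
  range.\<close>

lemma Sop_factor: "Sop l u t = exp (l * t) * Sop l u 0"
proof -
  have "exp (l * (t - s)) * u s = exp (l * t) * (exp (l * (0 - s)) * u s)" for s
    by (simp add: right_diff_distrib exp_diff exp_minus divide_inverse)
  then show ?thesis unfolding Sop_def by (simp only: set_integral_mult_right)
qed

text \<open>Hoelder's inequality for the pairing with exp(-ls). For 1 < p < \<infinity>, Young's
  inequality is applied to exp(-ls)/E and |g|/C, where E bounds the norm of exp(-ls) in the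
  conjugate space; after integration the terms add up to 1/q + 1/p = 1.\<close>

lemma Sop_0_le:
  assumes p: "1 \<le> p" and u: "Lple p C u" and C: "C > 0" and l: "l > 0"
  shows "\<bar>Sop l u 0\<bar> \<le> expnorm_dual p l * C"
proof -
  obtain g where [measurable]: "g \<in> borel_measurable borel" and g0: "\<And>x. x \<notin> {0<..<1} \<Longrightarrow> g x = 0"
    and g: "AE x in lborel. x \<in> {0<..<1} \<longrightarrow> u x = g x"
    using u M01_borel_representative[of u] by (auto simp: Lple_def)
  have Lg: "Lple p C g"
    by (rule Lple_AE_cong[OF _ g u]) (rule borel_measurable_M01I, measurable)
  have [measurable]: "g \<in> borel_measurable M01" by (rule borel_measurable_M01I) measurable
  have [measurable]: "(\<lambda>t. exp (b * t)) \<in> borel_measurable M01"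
    "(\<lambda>t. exp (- (b * t))) \<in> borel_measurable M01" for b
    using measurable_exp_M01[of b] measurable_exp_M01[of "- b"] by simp_all
  have exp_int: "(\<integral>\<^sup>+s. ennreal (exp (- b * s)) \<partial>M01) \<le> ennreal (1 / b)" if b: "b > 0" for b
    using nn_integral_exp_M01[of "- b"] b by (auto intro!: ennreal_leI simp: field_simps)
  have "ennreal \<bar>Sop l u 0\<bar> \<le> nnconv (ennabs (\<lambda>x. exp (l * x))) (ennabs g) 0"
    using cv_le_nnconv[of "\<lambda>x. exp (l * x)" g 0] by (subst Sop_eq_cv[OF _ g g0]) auto
  also have "\<dots> = (\<integral>\<^sup>+s. ennreal (exp (- l * s)) * ennreal \<bar>g s\<bar> \<partial>M01)"
    unfolding nn_integral_M01 nnconv_def using g0 by (intro nn_integral_cong) (auto simp: indicator_def)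
  also have "\<dots> \<le> ennreal (expnorm_dual p l * C)"
    using p
  proof (cases rule: ereal_ge_1_cases)
    case 1
    have "(\<integral>\<^sup>+s. ennreal (exp (- l * s)) * ennreal \<bar>g s\<bar> \<partial>M01) \<le> (\<integral>\<^sup>+s. ennreal (exp (- l * s)) * ennreal C \<partial>M01)"
      using Lg 1 by (intro nn_integral_mono_AE) (auto simp: Lple_def elim!: eventually_mono intro!: mult_left_mono ennreal_leI)
    also have "\<dots> = (\<integral>\<^sup>+s. ennreal (exp (- l * s)) \<partial>M01) * ennreal C"
      by (rule nn_integral_multc) measurable
    also have "\<dots> \<le> ennreal (1 / l) * ennreal C" by (intro mult_right_mono exp_int l) auto
    also have "\<dots> = ennreal (expnorm_dual p l * C)" using 1 l C by (simp add: expnorm_dual_def ennreal_mult'[symmetric])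
    finally show ?thesis .
  next
    case (2 p')
    show ?thesis
    proof (cases "p' = 1")
      case True
      have "(\<integral>\<^sup>+s. ennreal (exp (- l * s)) * ennreal \<bar>g s\<bar> \<partial>M01) \<le> (\<integral>\<^sup>+s. ennreal (\<bar>g s\<bar> powr 1) \<partial>M01)"
      proof (rule nn_integral_mono_AE, unfold AE_M01, intro always_eventually allI impI)
        fix s :: real assume s: "s \<in> {0<..<1}"
        have "exp (- l * s) * \<bar>g s\<bar> \<le> 1 * \<bar>g s\<bar>" using s l by (intro mult_right_mono) auto
        then show "ennreal (exp (- l * s)) * ennreal \<bar>g s\<bar> \<le> ennreal (\<bar>g s\<bar> powr 1)"
          by (simp add: ennreal_mult'[symmetric] ennreal_leI)
      qed
      also have "\<dots> \<le> ennreal (expnorm_dual p l * C)" using Lg 2 True C by (simp add: Lple_def expnorm_dual_def)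
      finally show ?thesis .
    next
      case False
      define q where "q = p' / (p' - 1)"
      have p': "p' > 1" using 2 False by simp
      have q: "q > 1" "1 / q + 1 / p' = 1" using p' by (auto simp: q_def field_simps)
      define E where "E = (1 / (q * l)) powr (1 / q)"
      have E: "E > 0" "E powr q = 1 / (q * l)" using q l by (auto simp: E_def powr_powr)
      have "(\<integral>\<^sup>+s. ennreal (exp (- l * s)) * ennreal \<bar>g s\<bar> \<partial>M01)
         \<le> (\<integral>\<^sup>+s. ennreal (E * C * l) * ennreal (exp (- (q * l) * s)) + ennreal (E * C / (p' * C powr p')) * ennreal (\<bar>g s\<bar> powr p') \<partial>M01)"
      proof (rule nn_integral_mono)
        fix s
        have "exp (- l * s) / E * (\<bar>g s\<bar> / C) \<le> (exp (- l * s) / E) powr q / q + (\<bar>g s\<bar> / C) powr p' / p'"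
          using q p' E C by (intro Youngs_inequality) auto
        also have "(exp (- l * s) / E) powr q = q * l * exp (- (q * l) * s)"
          using E by (simp add: powr_divide powr_exp mult_ac)
        finally have "E * C * (exp (- l * s) / E * (\<bar>g s\<bar> / C))
            \<le> E * C * (q * l * exp (- (q * l) * s) / q + (\<bar>g s\<bar> / C) powr p' / p')"
          using E C by (intro mult_left_mono) auto
        then have "exp (- l * s) * \<bar>g s\<bar> \<le> E * C * l * exp (- (q * l) * s) + E * C / (p' * C powr p') * \<bar>g s\<bar> powr p'"
          using E C q by (simp add: powr_divide distrib_left mult_ac)
        then have "ennreal (exp (- l * s) * \<bar>g s\<bar>) \<le> ennreal (E * C * l * exp (- (q * l) * s) + E * C / (p' * C powr p') * \<bar>g s\<bar> powr p')"
          by (rule ennreal_leI)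
        also have "\<dots> = ennreal (E * C * l) * ennreal (exp (- (q * l) * s)) + ennreal (E * C / (p' * C powr p')) * ennreal (\<bar>g s\<bar> powr p')"
          using E C l p' by (intro ennreal_add_mult) auto
        finally show "ennreal (exp (- l * s)) * ennreal \<bar>g s\<bar> \<le> ennreal (E * C * l) * ennreal (exp (- (q * l) * s)) + ennreal (E * C / (p' * C powr p')) * ennreal (\<bar>g s\<bar> powr p')"
          by (simp add: ennreal_mult')
      qed
      also have "\<dots> = ennreal (E * C * l) * (\<integral>\<^sup>+s. ennreal (exp (- (q * l) * s)) \<partial>M01)
          + ennreal (E * C / (p' * C powr p')) * (\<integral>\<^sup>+s. ennreal (\<bar>g s\<bar> powr p') \<partial>M01)"
        by (subst nn_integral_add) (auto simp: nn_integral_cmult)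
      also have "\<dots> \<le> ennreal (E * C * l) * ennreal (1 / (q * l)) + ennreal (E * C / (p' * C powr p')) * ennreal (C powr p')"
        using Lg 2 q l by (intro add_mono mult_left_mono exp_int) (auto simp: Lple_def)
      also have "\<dots> = ennreal (E * C * (1 / q + 1 / p'))"
        using E C l p' q(1) by (simp add: ennreal_mult'[symmetric] ennreal_plus[symmetric] distrib_left del: ennreal_plus)
      also have "\<dots> = ennreal (expnorm_dual p l * C)" unfolding q using 2 False by (simp add: expnorm_dual_def E_def q_def Let_def)
      finally show ?thesis .
    qed
  qed
  finally show ?thesis
    using C l by (subst (asm) ennreal_le_iff) (auto simp: expnorm_dual_def Let_def)
qed

lemma expnorm_nonneg: "expnorm p l \<ge> 0"
  by (simp add: expnorm_def)

lemma expnorm_dual_nonneg: "l > 0 \<Longrightarrow> expnorm_dual p l \<ge> 0"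
  by (simp add: expnorm_dual_def Let_def)

lemma Lple_Sop:
  assumes p: "1 \<le> p" and u: "Lple p C u" and C: "C > 0" and l: "l > 0"
  shows "Lple p (expnorm_dual p l * expnorm p l * C) (Sop l u)"
proof -
  have 1: "Lple p (\<bar>Sop l u 0\<bar> * expnorm p l) (\<lambda>t. Sop l u 0 * exp (l * t))"
    by (intro Lple_cmult p Lple_exp l expnorm_nonneg)
  have 2: "(\<lambda>t. Sop l u 0 * exp (l * t)) = Sop l u"
    by (rule ext, subst (2) Sop_factor) (simp add: mult.commute)
  have "\<bar>Sop l u 0\<bar> * expnorm p l \<le> expnorm_dual p l * C * expnorm p l"
    by (intro mult_right_mono Sop_0_le[OF p u C l] expnorm_nonneg)
  then have "Lple p (expnorm_dual p l * C * expnorm p l) (Sop l u)"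
    by (rule Lple_mono[OF 1[unfolded 2]]) (use expnorm_nonneg[of p l] p in auto)
  then show ?thesis by (simp add: mult.commute mult.left_commute)
qed

text \<open>The origin of the constant C_p: the powers l^(1/q) and l^(1/p) combine to l, and p^(1/p)
  q^(1/q) remains in the denominator.\<close>

lemma expnorm_dual_mult_expnorm:
  assumes p: "1 \<le> p" and l: "l > 0"
  shows "expnorm_dual p l * expnorm p l = Cp p * exp l / l"
  using p
proof (cases rule: ereal_ge_1_cases)
  case (2 p')
  show ?thesis
  proof (cases "p' = 1")
    case False
    define q where "q = p' / (p' - 1)"
    have p': "p' > 1" using 2 False by simp
    have q: "q > 1" "1 / q + 1 / p' = 1" using p' by (auto simp: q_def field_simps)
    have ll: "l powr (1 / q) * l powr (1 / p') = l" using l q by (simp add: powr_add[symmetric])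
    have k: "expnorm_dual p l = (1 / (q * l)) powr (1 / q)" and C: "Cp p = 1 / (p' powr (1 / p') * q powr (1 / q))"
      using 2 p' by (simp_all add: expnorm_dual_def Cp_def Let_def q_def)
    have "expnorm_dual p l * expnorm p l = exp l / ((l powr (1 / q) * l powr (1 / p')) * (p' powr (1 / p') * q powr (1 / q)))"
      unfolding k using 2 p' q l by (simp add: expnorm_def powr_divide powr_mult mult_ac)
    also have "\<dots> = Cp p * exp l / l" unfolding C ll by simp
    finally show ?thesis .
  qed (use 2 l in \<open>simp add: expnorm_dual_def expnorm_def Cp_def\<close>)
qed (use l in \<open>simp add: expnorm_dual_def expnorm_def Cp_def\<close>)

section \<open>From kernel bounds to operator bounds\<close>

lemma cv_cmult: "cv (\<lambda>x. c * K x) u t = c * cv K u t" "cv K (\<lambda>x. c * u x) t = c * cv K u t"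
  by (simp_all add: cv_def mult_ac)

lemma cv_funpow_cmult: "(cv (\<lambda>x. c * K x) ^^ n) g = (\<lambda>t. c ^ n * (cv K ^^ n) g t)"
  by (induction n) (auto simp: cv_cmult)

text \<open>Young's inequality in the form in which it is applied: \<open>u\<close> is the given
  input with Borel representative \<open>g\<close>, and \<open>v'\<close> is the operator value,
  known to equal the Borel function \<open>v\<close> only almost everywhere on (0,1).\<close>

lemma Lple_nnconv_representative:
  assumes p: "1 \<le> p" and [measurable]: "w \<in> borel_measurable borel" "g \<in> borel_measurable borel"
    and W: "W > 0" "(\<integral>\<^sup>+x. w x * indicator {-1<..<1} x \<partial>lborel) \<le> ennreal W"
    and C: "C \<ge> 0" "Lple p C u"
    and g: "AE x in lborel. x \<in> {0<..<1} \<longrightarrow> u x = g x" "\<And>x. x \<notin> {0<..<1} \<Longrightarrow> g x = 0"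
    and v: "v \<in> borel_measurable borel" "AE t in lborel. t \<in> {0<..<1} \<longrightarrow> v' t = v t"
    and dom: "AE t in lborel. ennreal \<bar>v t\<bar> \<le> nnconv w (ennabs g) t"
  shows "Lple p (W * C) v'"
proof -
  have Lg: "Lple p C g"
    by (rule Lple_AE_cong[OF _ g(1) C(2)]) (rule borel_measurable_M01I, measurable)
  have "nnconv w (ennabs g) t = (\<integral>\<^sup>+s. w (t - s) * ennreal \<bar>g s\<bar> * indicator {0<..<1} s \<partial>lborel)" for t
    unfolding nnconv_def using g(2) by (intro nn_integral_cong) (auto simp: indicator_def)
  then have "Lple p (W * C) v"
    using dom by (intro Lple_Young_convolution[OF p _ _ W C(1) Lg]) (auto intro: borel_measurable_M01I v elim!: eventually_mono)
  then show ?thesis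
    by (rule Lple_AE_cong[rotated 2]) (use v in \<open>auto intro: borel_measurable_M01_AE elim!: eventually_mono\<close>)
qed

text \<open>Both operators are convolutions with explicit kernels, so their difference is
  convolution with \<open>w\<close>, a constant factor apart, and the L1 estimate for
  \<open>w\<close> is already available. The power of \<open>F\<close> is pulled out because
  \<open>F\<close> may be negative, while the theory of powers is for nonnegative kernels.\<close>

lemma Lple_Vop_diff_Sop:
  fixes a \<mu> F :: real and n :: nat
  assumes p: "1 \<le> p" and a: "a > 0" and F: "F \<noteq> 0" and b: "b = a * Suc n" "b > 1"
    and h: "\<And>t. t \<in> {0<..<1} \<Longrightarrow> h t = F * (Gamma a * pker \<mu> a t)"
    and u: "Lple p C u" and C: "C \<ge> 0"
  shows "Lple p (\<bar>F\<bar> ^ Suc n * (Gamma a ^ Suc n / Gamma b * exp \<bar>\<mu>\<bar> * (1 / (b - 1) - 1 / b)) * C)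
    (\<lambda>t. (Vop h ^^ Suc n) u t - F ^ Suc n * Gamma a ^ Suc n * exp (- (b - 1)) / Gamma b * Sop (b - 1 + \<mu>) u t)"
proof -
  obtain g where [measurable]: "g \<in> borel_measurable borel" and g0: "\<And>x. x \<notin> {0<..<1} \<Longrightarrow> g x = 0"
    and g: "AE x in lborel. x \<in> {0<..<1} \<longrightarrow> u x = g x"
    using u M01_borel_representative[of u] by (auto simp: Lple_def)
  have Lg: "Lple p C g"
    by (rule Lple_AE_cong[OF _ g u]) (rule borel_measurable_M01I, measurable)
  \<comment> \<open>Any parameter beyond \<open>\<mu>\<close> would do; it only has to make the
    transform of the model kernel finite.\<close>
  define l where "l = \<bar>\<mu>\<bar> + 1"
  have fin: "laplace l (ennabs g) < \<infinity>" by (rule Lple_laplace_less_top[OF p Lg _ g0]) measurable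
  define H where "H x = Gamma a * pker \<mu> a x" for x
  define Hn where "Hn x = Gamma a ^ Suc n * pker \<mu> b x" for x
  define c where "c = Gamma a ^ Suc n * exp (- (b - 1)) / Gamma b"
  define m where "m = b - 1 + \<mu>"
  define w where "w x = Hn x - c * exp (m * x)" for x
  have [measurable]: "H \<in> borel_measurable borel" "Hn \<in> borel_measurable borel" "w \<in> borel_measurable borel"
    unfolding H_def Hn_def w_def by measurable
  have G: "Gamma a > 0" "Gamma b > 0" using a b by auto
  have finH: "laplace l (ennabs Hn) < \<infinity>"
  proof -
    have "laplace l (ennabs Hn) = ennreal (Gamma a ^ Suc n) * laplace l (\<lambda>x. ennreal (pker \<mu> b x))"
      unfolding laplace_def using G pker_nonneg[of b] b
      by (subst nn_integral_cmult[symmetric]) (auto simp: Hn_def ennreal_mult' abs_mult mult_ac)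
    then show ?thesis using b by (simp add: laplace_pker l_def ennreal_mult_less_top)
  qed
  have 1: "AE t in lborel. (cv H ^^ Suc n) g t = cv Hn g t"
    using cv_funpow_pker[of a "Gamma a" g l \<mu> n] a G fin b(1)
    by (simp add: H_def[abs_def] Hn_def[abs_def] l_def del: funpow.simps power_Suc)
  have 2: "AE t in lborel. t \<in> {0<..<1} \<longrightarrow> (Vop h ^^ Suc n) u t = (cv (\<lambda>x. F * H x) ^^ Suc n) g t"
    by (rule Vop_funpow_eq_cv) (use g g0 h in \<open>auto simp: H_def pker_def\<close>)
  \<comment> \<open>The exponential part is integrable for every t, as \<open>g\<close> has bounded
    support; only the power part restricts t.\<close>
  have 3: "cv w g t = cv Hn g t - c * cv (\<lambda>x. exp (m * x)) g t"
    if i: "integrable lborel (\<lambda>s. Hn (t - s) * g s)" for t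
  proof -
    have "integrable lborel (\<lambda>s. exp (m * (t - s)) * g s)"
    proof (rule integrableI_bounded)
      have "(\<integral>\<^sup>+s. ennreal (norm (exp (m * (t - s)) * g s)) \<partial>lborel) = ennreal (exp (m * t)) * laplace m (ennabs g)"
        unfolding laplace_def
        by (subst nn_integral_cmult[symmetric])
          (auto simp: abs_mult ennreal_mult'[symmetric] exp_add[symmetric] right_diff_distrib exp_diff exp_minus divide_inverse mult.assoc[symmetric])
      also have "\<dots> < \<infinity>"
        using Lple_laplace_less_top[OF p Lg _ g0, of m] by (simp add: ennreal_mult_less_top)
      finally show "(\<integral>\<^sup>+s. ennreal (norm (exp (m * (t - s)) * g s)) \<partial>lborel) < \<infinity>" .
    qed measurable
    then show ?thesis using i unfolding cv_def w_def by (simp add: left_diff_distrib mult.assoc)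
  qed
  have "1 / b < 1 / (b - 1)" using b by (intro divide_strict_left_mono) auto
  then have Wpos: "\<bar>F\<bar> ^ Suc n * (Gamma a ^ Suc n / Gamma b * exp \<bar>\<mu>\<bar> * (1 / (b - 1) - 1 / b)) > 0"
    using F G by (intro mult_pos_pos divide_pos_pos zero_less_power) auto
  show ?thesis
  proof (rule Lple_nnconv_representative[where w="\<lambda>x. ennreal (\<bar>F\<bar> ^ Suc n) * ennabs w x" and u=u and g=g and v="\<lambda>t. F ^ Suc n * cv w g t"])
    show "(\<integral>\<^sup>+x. ennreal (\<bar>F\<bar> ^ Suc n) * ennabs w x * indicator {-1<..<1} x \<partial>lborel)
       \<le> ennreal (\<bar>F\<bar> ^ Suc n * (Gamma a ^ Suc n / Gamma b * exp \<bar>\<mu>\<bar> * (1 / (b - 1) - 1 / b)))"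
    proof -
      have "(\<integral>\<^sup>+x. ennabs w x * indicator {-1<..<1} x \<partial>lborel)
         \<le> ennreal (Gamma a ^ Suc n / Gamma b * exp \<bar>\<mu>\<bar> * (1 / (b - 1) - 1 / (b - 1 + 1)))"
        using nn_integral_pker_exp_diff[OF b(2), of "Gamma a ^ Suc n" \<mu>] G
        by (simp add: w_def Hn_def c_def m_def del: power_Suc)
      then have "ennreal (\<bar>F\<bar> ^ Suc n) * (\<integral>\<^sup>+x. ennabs w x * indicator {-1<..<1} x \<partial>lborel)
         \<le> ennreal (\<bar>F\<bar> ^ Suc n) * ennreal (Gamma a ^ Suc n / Gamma b * exp \<bar>\<mu>\<bar> * (1 / (b - 1) - 1 / b))"
        by (intro mult_left_mono) auto
      also have "\<dots> = ennreal (\<bar>F\<bar> ^ Suc n * (Gamma a ^ Suc n / Gamma b * exp \<bar>\<mu>\<bar> * (1 / (b - 1) - 1 / b)))"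
        by (intro ennreal_mult'[symmetric]) simp
      finally show ?thesis
        by (simp add: nn_integral_cmult mult.assoc del: power_Suc)
    qed
    show "AE t in lborel. t \<in> {0<..<1} \<longrightarrow>
        (Vop h ^^ Suc n) u t - F ^ Suc n * Gamma a ^ Suc n * exp (- (b - 1)) / Gamma b * Sop (b - 1 + \<mu>) u t = F ^ Suc n * cv w g t"
    proof -
      have "AE t in lborel. integrable lborel (\<lambda>s. Hn (t - s) * g s)"
        by (rule AE_integrable_cv[where c=l]) (use finH fin in simp_all)
      with 1 2 show ?thesis
      proof eventually_elim
        case (elim t)
        have "Sop (b - 1 + \<mu>) u t = cv (\<lambda>x. exp (m * x)) g t"
          unfolding m_def by (rule Sop_eq_cv[OF _ g g0]) auto
        then show ?case using elim 3[of t]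
          by (simp add: cv_funpow_cmult c_def right_diff_distrib mult.assoc del: funpow.simps power_Suc)
      qed
    qed
    show "AE t in lborel. ennreal \<bar>F ^ Suc n * cv w g t\<bar> \<le> nnconv (\<lambda>x. ennreal (\<bar>F\<bar> ^ Suc n) * ennabs w x) (ennabs g) t"
    proof (intro always_eventually allI)
      fix t
      have "ennreal \<bar>F ^ Suc n * cv w g t\<bar> = ennreal (\<bar>F\<bar> ^ Suc n) * ennreal \<bar>cv w g t\<bar>"
        by (simp add: abs_mult power_abs ennreal_mult' del: power_Suc)
      also have "\<dots> \<le> ennreal (\<bar>F\<bar> ^ Suc n) * nnconv (ennabs w) (ennabs g) t"
        by (intro mult_left_mono cv_le_nnconv) auto
      finally show "ennreal \<bar>F ^ Suc n * cv w g t\<bar> \<le> nnconv (\<lambda>x. ennreal (\<bar>F\<bar> ^ Suc n) * ennabs w x) (ennabs g) t"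
        by (simp add: nnconv_cmult_left)
    qed
  qed (use p C u g g0 Wpos in \<open>auto simp del: funpow.simps power_Suc\<close>)
qed

text \<open>Joins two independent inputs: a kernel \<open>K\<close> dominated as in
  \<open>local_kernel_approximation\<close>, and a bound \<open>W\<close> for the mass of the
  resulting remainder as in \<open>nnrem_bound\<close>.\<close>

lemma Lple_Vop_diff_Vop:
  fixes a \<mu> F :: real and n :: nat and K :: "real \<Rightarrow> real"
  assumes p: "1 \<le> p" and a: "a > 0" and e: "\<epsilon> > 0" and [measurable]: "K \<in> borel_measurable borel" "d \<in> borel_measurable borel"
    and h: "\<And>t. t \<in> {0<..<1} \<Longrightarrow> h t = F * (Gamma a * pker \<mu> a t)"
    and k: "AE x in lborel. x \<in> {0<..<1} \<longrightarrow> k x = F * K x" and K0: "\<And>x. x \<le> 0 \<Longrightarrow> K x = 0"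
    and KH: "\<And>x. ennreal \<bar>K x - Gamma a * pker \<mu> a x\<bar>
       \<le> ennreal (Gamma a * pker (\<mu> + \<epsilon>) a x - Gamma a * pker \<mu> a x) + d x"
    and M: "(\<integral>\<^sup>+t. d t \<partial>lborel) \<le> ennreal M"
    and W: "W > 0" "(\<integral>\<^sup>+t. nnrem (\<lambda>t. ennreal (Gamma a * pker \<mu> a t))
        (\<lambda>t. ennreal (Gamma a * pker (\<mu> + \<epsilon>) a t - Gamma a * pker \<mu> a t) + d t) n t * indicator {..1} t \<partial>lborel) \<le> ennreal W"
    and u: "Lple p C u" and C: "C \<ge> 0" and F: "F \<noteq> 0" and d0: "\<And>x. x < 0 \<Longrightarrow> d x = 0"
  shows "Lple p (\<bar>F\<bar> ^ Suc n * W * C) (\<lambda>t. (Vop k ^^ Suc n) u t - (Vop h ^^ Suc n) u t)"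
proof -
  obtain g where [measurable]: "g \<in> borel_measurable borel" and g0: "\<And>x. x \<notin> {0<..<1} \<Longrightarrow> g x = 0"
    and g: "AE x in lborel. x \<in> {0<..<1} \<longrightarrow> u x = g x"
    using u M01_borel_representative[of u] by (auto simp: Lple_def)
  have Lg: "Lple p C g"
    by (rule Lple_AE_cong[OF _ g u]) (rule borel_measurable_M01I, measurable)
  define l where "l = \<bar>\<mu>\<bar> + \<epsilon> + 1"
  have fin: "laplace l (ennabs g) < \<infinity>" by (rule Lple_laplace_less_top[OF p Lg _ g0]) measurable
  define H where "H x = Gamma a * pker \<mu> a x" for x
  define D where "D t = ennreal (Gamma a * pker (\<mu> + \<epsilon>) a t - Gamma a * pker \<mu> a t) + d t" for t
  have [measurable]: "H \<in> borel_measurable borel" "D \<in> borel_measurable borel"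
    unfolding H_def D_def by measurable
  have G: "Gamma a > 0" using a by auto
  have H0: "H x \<ge> 0" for x using G pker_nonneg[OF a, of \<mu> x] by (simp add: H_def)
  have L: "laplace l (\<lambda>x. ennreal (Gamma a * pker c a x)) < \<infinity>" if "c < l" for c
  proof -
    have "laplace l (\<lambda>x. ennreal (Gamma a * pker c a x)) = ennreal (Gamma a) * laplace l (\<lambda>x. ennreal (pker c a x))"
      unfolding laplace_def using G
      by (subst nn_integral_cmult[symmetric]) (auto simp: ennreal_mult' mult_ac)
    then show ?thesis using that a by (simp add: laplace_pker ennreal_mult_less_top)
  qed
  have finH: "laplace l (\<lambda>x. ennreal (H x)) < \<infinity>" unfolding H_def using e by (intro L) (auto simp: l_def)
  have finD: "laplace l D < \<infinity>"
  proof -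
    have "laplace l D = laplace l (\<lambda>t. ennreal (Gamma a * pker (\<mu> + \<epsilon>) a t - Gamma a * pker \<mu> a t)) + laplace l d"
      unfolding D_def by (rule laplace_add) measurable
    moreover have "laplace l (\<lambda>t. ennreal (Gamma a * pker (\<mu> + \<epsilon>) a t - Gamma a * pker \<mu> a t))
       \<le> laplace l (\<lambda>t. ennreal (Gamma a * pker (\<mu> + \<epsilon>) a t))"
      using G H0 by (intro laplace_mono_AE always_eventually allI ennreal_leI) (auto simp: H_def)
    moreover have "\<dots> < \<infinity>" by (intro L) (auto simp: l_def)
    moreover have "laplace l d < \<infinity>"
    proof -
      have "laplace l d \<le> ennreal (exp (- l * 0)) * (\<integral>\<^sup>+t. d t \<partial>lborel)"
        by (rule laplace_supported_atLeast) (use e d0 in \<open>auto simp: l_def\<close>)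
      also have "\<dots> < \<infinity>" using M by (auto simp: le_less_trans)
      finally show ?thesis .
    qed
    ultimately show ?thesis by (auto simp: le_less_trans)
  qed
  have dom: "AE t in lborel. ennreal \<bar>(cv K ^^ Suc n) g t - (cv H ^^ Suc n) g t\<bar>
        \<le> nnconv (nnrem (\<lambda>x. ennreal (H x)) D n) (ennabs g) t"
    using cv_funpow_diff_le[of K H D g l n] KH H0 finH finD fin by (auto simp: H_def D_def)
  have 2: "AE t in lborel. t \<in> {0<..<1} \<longrightarrow> (Vop h ^^ Suc n) u t = (cv (\<lambda>x. F * H x) ^^ Suc n) g t"
    by (rule Vop_funpow_eq_cv) (use g g0 h in \<open>auto simp: H_def pker_def\<close>)
  have 3: "AE t in lborel. t \<in> {0<..<1} \<longrightarrow> (Vop k ^^ Suc n) u t = (cv (\<lambda>x. F * K x) ^^ Suc n) g t"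
    by (rule Vop_funpow_eq_cv) (use g g0 k K0 in auto)
  have nr: "nnrem (\<lambda>x. ennreal (H x)) D n = nnrem (\<lambda>t. ennreal (Gamma a * pker \<mu> a t))
        (\<lambda>t. ennreal (Gamma a * pker (\<mu> + \<epsilon>) a t - Gamma a * pker \<mu> a t) + d t) n"
    by (simp add: H_def[abs_def] D_def[abs_def])
  show ?thesis
  proof (rule Lple_nnconv_representative[where w="\<lambda>x. ennreal (\<bar>F\<bar> ^ Suc n) * nnrem (\<lambda>x. ennreal (H x)) D n x" and u=u and g=g
        and v="\<lambda>t. F ^ Suc n * ((cv K ^^ Suc n) g t - (cv H ^^ Suc n) g t)"])
    have "(\<integral>\<^sup>+x. ennreal (\<bar>F\<bar> ^ Suc n) * nnrem (\<lambda>x. ennreal (H x)) D n x * indicator {-1<..<1} x \<partial>lborel)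
      \<le> (\<integral>\<^sup>+x. ennreal (\<bar>F\<bar> ^ Suc n) * (nnrem (\<lambda>x. ennreal (H x)) D n x * indicator {..1} x) \<partial>lborel)"
      by (intro nn_integral_mono) (auto simp: indicator_def)
    also have "\<dots> \<le> ennreal (\<bar>F\<bar> ^ Suc n) * ennreal W"
      using W by (subst nn_integral_cmult) (auto simp: nr intro!: mult_left_mono)
    finally show "(\<integral>\<^sup>+x. ennreal (\<bar>F\<bar> ^ Suc n) * nnrem (\<lambda>x. ennreal (H x)) D n x * indicator {-1<..<1} x \<partial>lborel)
      \<le> ennreal (\<bar>F\<bar> ^ Suc n * W)"
      by (simp add: ennreal_mult' del: power_Suc)
    show "AE t in lborel. t \<in> {0<..<1} \<longrightarrow> (Vop k ^^ Suc n) u t - (Vop h ^^ Suc n) u t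
       = F ^ Suc n * ((cv K ^^ Suc n) g t - (cv H ^^ Suc n) g t)"
      using 2 3 by eventually_elim (simp add: cv_funpow_cmult right_diff_distrib del: funpow.simps power_Suc)
    show "AE t in lborel. ennreal \<bar>F ^ Suc n * ((cv K ^^ Suc n) g t - (cv H ^^ Suc n) g t)\<bar>
       \<le> nnconv (\<lambda>x. ennreal (\<bar>F\<bar> ^ Suc n) * nnrem (\<lambda>x. ennreal (H x)) D n x) (ennabs g) t"
      using dom
    proof eventually_elim
      case (elim t)
      have "ennreal \<bar>F ^ Suc n * ((cv K ^^ Suc n) g t - (cv H ^^ Suc n) g t)\<bar> = ennreal (\<bar>F\<bar> ^ Suc n) * ennreal \<bar>(cv K ^^ Suc n) g t - (cv H ^^ Suc n) g t\<bar>"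
        by (simp add: abs_mult power_abs ennreal_mult' del: power_Suc funpow.simps)
      also have "\<dots> \<le> ennreal (\<bar>F\<bar> ^ Suc n) * nnconv (nnrem (\<lambda>x. ennreal (H x)) D n) (ennabs g) t"
        by (intro mult_left_mono elim) auto
      finally show ?case by (simp add: nnconv_cmult_left del: power_Suc funpow.simps)
    qed
    have [measurable]: "(cv K ^^ Suc n) g \<in> borel_measurable borel" "(cv H ^^ Suc n) g \<in> borel_measurable borel"
      by (rule measurable_cv_funpow; measurable)+
    show "(\<lambda>t. F ^ Suc n * ((cv K ^^ Suc n) g t - (cv H ^^ Suc n) g t)) \<in> borel_measurable borel"
      by measurable
  qed (use p C u g g0 F W in \<open>auto simp del: funpow.simps power_Suc\<close>)
qed

text \<open>The function f(x)/f(0) - exp(\<mu>x) has value and right derivative 0 at 0, by the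
  choice of \<open>\<mu>\<close>, so near 0 it is o(x) and hence below exp((\<mu> + \<epsilon>)x) -
  exp(\<mu>x), which is at least a multiple of x. Away from 0 nothing but integrability of
  \<open>k\<close> is used, and \<open>d\<close> takes the whole difference.\<close>

lemma local_kernel_approximation:
  fixes k f :: "real \<Rightarrow> real"
  assumes k_L1: "integrable M01 k" and k_def: "\<And>t. t \<in> {0<..<1} \<Longrightarrow> k t = t powr (a - 1) * f t"
    and a: "a > 0" and f0: "f 0 \<noteq> 0" and fderiv: "(f has_real_derivative f') (at_right 0)"
    and e: "\<epsilon> > 0" and mu: "\<mu> = f' / f 0"
  obtains K d \<delta> M where "K \<in> borel_measurable borel" "d \<in> borel_measurable borel" "\<delta> > 0" "M > 0"
    "AE x in lborel. x \<in> {0<..<1} \<longrightarrow> k x = f 0 * K x" "\<And>x. x \<le> 0 \<Longrightarrow> K x = 0"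
    "\<And>x. ennreal \<bar>K x - Gamma a * pker \<mu> a x\<bar>
       \<le> ennreal (Gamma a * pker (\<mu> + \<epsilon>) a x - Gamma a * pker \<mu> a x) + d x"
    "(\<integral>\<^sup>+t. d t \<partial>lborel) \<le> ennreal M" "\<And>x. x < \<delta> \<Longrightarrow> d x = 0"
proof -
  define \<phi> where "\<phi> x = f x / f 0 - exp (\<mu> * x)" for x
  have "((\<lambda>x. exp (\<mu> * x)) has_real_derivative \<mu>) (at_right 0)"
    by (auto intro!: derivative_eq_intros)
  then have "(\<phi> has_real_derivative (f' / f 0 - \<mu>)) (at_right 0)"
    unfolding \<phi>_def by (intro DERIV_diff DERIV_cdivide fderiv)
  then have "((\<lambda>x. \<phi> x / x) \<longlongrightarrow> 0) (at_right 0)"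
    using f0 by (simp add: has_field_derivative_iff mu \<phi>_def)
  \<comment> \<open>The factor exp(-|\<mu>|) is a lower bound of exp(\<mu>x) on (0,1); it is what
    makes this bound sit below exp(\<mu>x)(exp(\<epsilon>x) - 1).\<close>
  then have "eventually (\<lambda>x. \<bar>\<phi> x / x\<bar> < exp (- \<bar>\<mu>\<bar>) * \<epsilon>) (at_right 0)"
    using e tendstoD[of "\<lambda>x. \<phi> x / x" 0 "at_right 0" "exp (- \<bar>\<mu>\<bar>) * \<epsilon>"] by (simp add: dist_real_def)
  then obtain \<delta>' where \<delta>': "\<delta>' > 0" "\<And>x. 0 < x \<Longrightarrow> x < \<delta>' \<Longrightarrow> \<bar>\<phi> x / x\<bar> < exp (- \<bar>\<mu>\<bar>) * \<epsilon>"
    unfolding eventually_at_right_field by auto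
  define \<delta> where "\<delta> = min \<delta>' 1"
  have \<delta>: "\<delta> > 0" "\<delta> \<le> 1" using \<delta>' by (auto simp: \<delta>_def)
  define H where "H x = Gamma a * pker \<mu> a x" for x
  define A where "A x = Gamma a * pker (\<mu> + \<epsilon>) a x" for x
  have [measurable]: "H \<in> borel_measurable borel" "A \<in> borel_measurable borel"
    unfolding H_def A_def by measurable
  have G: "Gamma a > 0" using a by simp
  have Hx: "H x = x powr (a - 1) * exp (\<mu> * x)" and Ax: "A x = x powr (a - 1) * exp ((\<mu> + \<epsilon>) * x)" if "x > 0" for x
    using that less_imp_neq[OF G] by (auto simp: H_def A_def pker_def)
  have near: "\<bar>k x / f 0 - H x\<bar> \<le> A x - H x" if x: "0 < x" "x < \<delta>" for x
  proof -
    have "\<bar>\<phi> x\<bar> \<le> exp (- \<bar>\<mu>\<bar>) * (\<epsilon> * x)"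
      using \<delta>'(2)[of x] x by (simp add: \<delta>_def field_simps)
    also have "\<dots> \<le> exp (\<mu> * x) * (exp (\<epsilon> * x) - 1)"
    proof (rule mult_mono)
      show "exp (- \<bar>\<mu>\<bar>) \<le> exp (\<mu> * x)"
      proof -
        have "\<bar>\<mu> * x\<bar> \<le> \<bar>\<mu>\<bar> * 1" unfolding abs_mult using x \<delta> by (intro mult_left_mono) auto
        then show ?thesis by simp
      qed
      show "\<epsilon> * x \<le> exp (\<epsilon> * x) - 1" using exp_ge_add_one_self[of "\<epsilon> * x"] by linarith
    qed (use x e in auto)
    also have "\<dots> = exp ((\<mu> + \<epsilon>) * x) - exp (\<mu> * x)" by (simp add: algebra_simps exp_add)
    finally have "x powr (a - 1) * \<bar>\<phi> x\<bar> \<le> x powr (a - 1) * (exp ((\<mu> + \<epsilon>) * x) - exp (\<mu> * x))"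
      by (intro mult_left_mono) auto
    moreover have "k x / f 0 - H x = x powr (a - 1) * \<phi> x"
      using x \<delta> k_def[of x] by (simp add: Hx \<phi>_def right_diff_distrib)
    ultimately show ?thesis using x by (simp add: Hx Ax abs_mult right_diff_distrib)
  qed
  have kM: "k \<in> borel_measurable M01" using k_L1 by auto
  obtain k' where [measurable]: "k' \<in> borel_measurable borel" and k': "AE x in lborel. x \<in> {0<..<1} \<longrightarrow> k x = k' x"
    using M01_borel_representative[OF kM] by metis
  \<comment> \<open>Below \<delta> the Borel representative \<open>k'\<close> satisfies the estimate
    only almost everywhere. At exceptional points, and outside (0,1), \<open>K\<close> falls back to
    \<open>H\<close>, so the domination holds everywhere while K = k/f(0) still holds almost
    everywhere on (0,1).\<close>
  define K where "K x = (if x \<in> {0<..<1} \<and> (x \<ge> \<delta> \<or> \<bar>k' x / f 0 - H x\<bar> \<le> A x - H x) then k' x / f 0 else H x)" for x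
  have [measurable]: "K \<in> borel_measurable borel" unfolding K_def by measurable
  define d where "d x = ennreal \<bar>K x - H x\<bar> * indicator {\<delta>..<1} x" for x
  have [measurable]: "d \<in> borel_measurable borel" unfolding d_def by measurable
  have AH: "A x \<ge> H x" for x
  proof (cases "x > 0")
    case True
    then have "exp (\<mu> * x) \<le> exp ((\<mu> + \<epsilon>) * x)" using e by (simp add: algebra_simps)
    then show ?thesis using True by (simp add: Hx Ax mult_left_mono)
  qed (simp add: H_def A_def pker_def)
  have dfin: "(\<integral>\<^sup>+x. d x \<partial>lborel) < \<infinity>"
  proof -
    have "(\<integral>\<^sup>+x. d x \<partial>lborel) \<le> (\<integral>\<^sup>+x. ennreal \<bar>1 / f 0\<bar> * (ennreal \<bar>k x\<bar> * indicator {0<..<1} x)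
        + ennreal (Gamma a * exp \<bar>\<mu>\<bar>) * (ennreal (pker 0 a x) * indicator {..1} x) \<partial>lborel)"
    proof (rule nn_integral_mono_AE, use k' in eventually_elim)
      fix x :: real assume kx: "x \<in> {0<..<1} \<longrightarrow> k x = k' x"
      show "d x \<le> ennreal \<bar>1 / f 0\<bar> * (ennreal \<bar>k x\<bar> * indicator {0<..<1} x)
        + ennreal (Gamma a * exp \<bar>\<mu>\<bar>) * (ennreal (pker 0 a x) * indicator {..1} x)"
      proof (cases "x \<in> {\<delta>..<1}")
        case True
        then have x: "x \<in> {0<..<1}" using \<delta> by auto
        have "H x \<le> Gamma a * exp \<bar>\<mu>\<bar> * pker 0 a x"
          using x G exp_mult_le_exp_abs[of x \<mu>] unfolding H_def
          by (auto simp: pker_def intro!: mult_left_mono mult_right_mono divide_right_mono)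
        moreover have "H x \<ge> 0" using x by (simp add: Hx)
        ultimately have "\<bar>K x - H x\<bar> \<le> \<bar>1 / f 0\<bar> * \<bar>k x\<bar> + Gamma a * exp \<bar>\<mu>\<bar> * pker 0 a x"
          using kx x True by (auto simp: K_def abs_divide intro!: order_trans[OF abs_triangle_ineq4])
        then have "ennreal \<bar>K x - H x\<bar> \<le> ennreal (\<bar>1 / f 0\<bar> * \<bar>k x\<bar> + Gamma a * exp \<bar>\<mu>\<bar> * pker 0 a x)"
          by (rule ennreal_leI)
        also have "\<dots> = ennreal \<bar>1 / f 0\<bar> * ennreal \<bar>k x\<bar> + ennreal (Gamma a * exp \<bar>\<mu>\<bar>) * ennreal (pker 0 a x)"
          using G pker_nonneg[OF a] by (subst ennreal_plus) (auto simp: ennreal_mult' simp del: abs_divide)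
        finally show ?thesis using True x by (simp add: d_def)
      qed (simp add: d_def)
    qed
    also have "\<dots> = ennreal \<bar>1 / f 0\<bar> * (\<integral>\<^sup>+x. ennreal \<bar>k' x\<bar> * indicator {0<..<1} x \<partial>lborel)
       + ennreal (Gamma a * exp \<bar>\<mu>\<bar>) * (\<integral>\<^sup>+x. ennreal (pker 0 a x) * indicator {..1} x \<partial>lborel)"
    proof -
      have "(\<integral>\<^sup>+x. ennreal \<bar>1 / f 0\<bar> * (ennreal \<bar>k x\<bar> * indicator {0<..<1} x)
        + ennreal (Gamma a * exp \<bar>\<mu>\<bar>) * (ennreal (pker 0 a x) * indicator {..1} x) \<partial>lborel)
        = (\<integral>\<^sup>+x. ennreal \<bar>1 / f 0\<bar> * (ennreal \<bar>k' x\<bar> * indicator {0<..<1} x)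
        + ennreal (Gamma a * exp \<bar>\<mu>\<bar>) * (ennreal (pker 0 a x) * indicator {..1} x) \<partial>lborel)"
        using k' by (intro nn_integral_cong_AE) (auto elim!: eventually_mono simp: indicator_def)
      then show ?thesis by (simp add: nn_integral_add nn_integral_cmult)
    qed
    also have "(\<integral>\<^sup>+x. ennreal \<bar>k' x\<bar> * indicator {0<..<1} x \<partial>lborel) = (\<integral>\<^sup>+x. ennreal (norm (k x)) \<partial>M01)"
      unfolding nn_integral_M01
      using k' by (intro nn_integral_cong_AE) (auto elim!: eventually_mono simp: indicator_def)
    also have "ennreal \<bar>1 / f 0\<bar> * \<dots> + ennreal (Gamma a * exp \<bar>\<mu>\<bar>) * (\<integral>\<^sup>+x. ennreal (pker 0 a x) * indicator {..1} x \<partial>lborel) < \<infinity>"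
      using k_L1 a unfolding integrable_iff_bounded
      by (simp add: nn_integral_pker_atMost_1 ennreal_mult_less_top)
    finally show ?thesis .
  qed
  define M where "M = enn2real (\<integral>\<^sup>+x. d x \<partial>lborel) + 1"
  show thesis
  proof (rule that[of K d \<delta> M])
    show "M > 0" by (simp add: M_def add_nonneg_pos)
    show "(\<integral>\<^sup>+x. d x \<partial>lborel) \<le> ennreal M"
      using dfin by (simp add: M_def)
    show "AE x in lborel. x \<in> {0<..<1} \<longrightarrow> k x = f 0 * K x"
      using k'
    proof eventually_elim
      case (elim x)
      then show ?case using near[of x] f0 by (auto simp: K_def not_le)
    qed
    show "K x = 0" if "x \<le> 0" for x using that by (simp add: K_def H_def pker_def)
    show "ennreal \<bar>K x - Gamma a * pker \<mu> a x\<bar>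
       \<le> ennreal (Gamma a * pker (\<mu> + \<epsilon>) a x - Gamma a * pker \<mu> a x) + d x" for x
      unfolding A_def[symmetric] H_def[symmetric]
    proof (cases "x \<in> {\<delta>..<1}")
      case False
      then have "\<bar>K x - H x\<bar> \<le> A x - H x" using AH[of x] by (auto simp: K_def)
      then show "ennreal \<bar>K x - H x\<bar> \<le> ennreal (A x - H x) + d x"
        by (simp add: add_increasing2 ennreal_leI)
    qed (simp add: d_def)
    show "d x = 0" if "x < \<delta>" for x using that by (simp add: d_def)
  qed (use \<delta> in auto)
qed

section \<open>Asymptotics of operator norms\<close>

text \<open>Says A - B = o(\<sigma>) in operator norm, but through \<open>Lple\<close>, so that it
  includes that the differences lie in \<open>Lp p\<close>. The real supremum in
  \<open>opnorm\<close> carries no information about an unbounded operator.\<close>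

definition near :: "ereal \<Rightarrow> (nat \<Rightarrow> (real \<Rightarrow> real) \<Rightarrow> real \<Rightarrow> real) \<Rightarrow>
    (nat \<Rightarrow> (real \<Rightarrow> real) \<Rightarrow> real \<Rightarrow> real) \<Rightarrow> (nat \<Rightarrow> real) \<Rightarrow> bool" where
  "near p A B \<sigma> \<longleftrightarrow> (\<forall>\<eta>>0. \<forall>\<^sub>F n in sequentially. \<forall>u C. C > 0 \<longrightarrow> Lple p C u \<longrightarrow>
     Lple p (\<eta> * \<sigma> n * C) (\<lambda>t. A n u t - B n u t))"

lemma near_trans:
  assumes p: "1 \<le> p" and AB: "near p A B \<sigma>" and BD: "near p B D \<sigma>"
    and pos: "\<forall>\<^sub>F n in sequentially. \<sigma> n > 0"
  shows "near p A D \<sigma>"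
  unfolding near_def
proof (intro allI impI)
  fix \<eta> :: real assume \<eta>: "\<eta> > 0"
  then have "\<eta> / 2 > 0" by simp
  then have "\<forall>\<^sub>F n in sequentially. \<forall>u C. C > 0 \<longrightarrow> Lple p C u \<longrightarrow> Lple p (\<eta> / 2 * \<sigma> n * C) (\<lambda>t. A n u t - B n u t)"
    "\<forall>\<^sub>F n in sequentially. \<forall>u C. C > 0 \<longrightarrow> Lple p C u \<longrightarrow> Lple p (\<eta> / 2 * \<sigma> n * C) (\<lambda>t. B n u t - D n u t)"
    using AB BD unfolding near_def by blast+
  with pos show "\<forall>\<^sub>F n in sequentially. \<forall>u C. C > 0 \<longrightarrow> Lple p C u \<longrightarrow> Lple p (\<eta> * \<sigma> n * C) (\<lambda>t. A n u t - D n u t)"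
  proof eventually_elim
    case (elim n)
    show ?case
    proof (intro allI impI)
      fix u C assume C: "(C::real) > 0" and u: "Lple p C u"
      have "\<eta> / 2 * \<sigma> n * C > 0" using \<eta> elim(1) C by simp
      then have "Lple p (\<eta> / 2 * \<sigma> n * C + \<eta> / 2 * \<sigma> n * C) (\<lambda>t. (A n u t - B n u t) + (B n u t - D n u t))"
        using elim C u by (intro Lple_add p) blast+
      then show "Lple p (\<eta> * \<sigma> n * C) (\<lambda>t. A n u t - D n u t)" by (simp add: field_simps)
    qed
  qed
qed

lemma near_rescale:
  assumes p: "1 \<le> p" and AB: "near p A B \<sigma>" and K: "K > 0"
    and le: "\<forall>\<^sub>F n in sequentially. 0 < \<sigma> n \<and> \<sigma> n \<le> K * \<tau> n"
  shows "near p A B \<tau>"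
  unfolding near_def
proof (intro allI impI)
  fix \<eta> :: real assume \<eta>: "\<eta> > 0"
  then have "\<eta> / K > 0" using K by simp
  then have "\<forall>\<^sub>F n in sequentially. \<forall>u C. C > 0 \<longrightarrow> Lple p C u \<longrightarrow> Lple p (\<eta> / K * \<sigma> n * C) (\<lambda>t. A n u t - B n u t)"
    using AB unfolding near_def by blast
  with le show "\<forall>\<^sub>F n in sequentially. \<forall>u C. C > 0 \<longrightarrow> Lple p C u \<longrightarrow> Lple p (\<eta> * \<tau> n * C) (\<lambda>t. A n u t - B n u t)"
  proof eventually_elim
    case (elim n)
    show ?case
    proof (intro allI impI)
      fix u C assume C: "(C::real) > 0" and u: "Lple p C u"
      have "\<eta> / K * \<sigma> n \<le> \<eta> / K * (K * \<tau> n)" using elim \<eta> K by (intro mult_left_mono) auto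
      then have "\<eta> / K * \<sigma> n * C \<le> \<eta> * \<tau> n * C" using K C by (intro mult_right_mono) auto
      moreover have "0 \<le> \<eta> / K * \<sigma> n * C" using elim \<eta> K C by simp
      moreover have "Lple p (\<eta> / K * \<sigma> n * C) (\<lambda>t. A n u t - B n u t)" using elim C u by blast
      ultimately show "Lple p (\<eta> * \<tau> n * C) (\<lambda>t. A n u t - B n u t)" using p Lple_mono by blast
    qed
  qed
qed

text \<open>A real supremum is meaningful only for a nonempty bounded set. Nonemptiness comes from
  the zero function, written as 0 times an exponential, and boundedness from the hypothesis.\<close>

lemma opnorm_le:
  assumes p: "1 \<le> p" and K: "K \<ge> 0"
    and bd: "\<And>u. Lple p 1 u \<Longrightarrow> pnorm p (A u) \<le> K"
  shows "opnorm p A \<le> K" "0 \<le> opnorm p A" "\<And>u. Lple p 1 u \<Longrightarrow> pnorm p (A u) \<le> opnorm p A"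
proof -
  define S where "S = {pnorm p (A u) | u. u \<in> Lp p \<and> pnorm p u \<le> 1}"
  have S: "S = {pnorm p (A u) | u. Lple p 1 u}" using p by (simp add: S_def Lple_iff)
  have "Lple p (\<bar>0\<bar> * expnorm p 1) (\<lambda>t. 0 * exp (1 * t))"
    by (intro Lple_cmult p Lple_exp expnorm_nonneg) simp
  then have 0: "Lple p 1 (\<lambda>t. 0)" using p Lple_mono[of p 0 "\<lambda>t. 0" 1] by simp
  then have ne: "S \<noteq> {}" unfolding S by blast
  have bdd: "bdd_above S" using bd unfolding S by (intro bdd_aboveI[of _ K]) auto
  show "opnorm p A \<le> K"
    unfolding opnorm_def S_def[symmetric] using ne bd by (intro cSup_least) (auto simp: S)
  show le: "pnorm p (A u) \<le> opnorm p A" if "Lple p 1 u" for u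
    unfolding opnorm_def S_def[symmetric] using bdd that by (intro cSup_upper) (auto simp: S)
  show "0 \<le> opnorm p A" using le[OF 0] pnorm_nonneg[of p "A (\<lambda>t. 0)"] by linarith
qed

lemma near_op_diff:
  assumes p: "1 \<le> p" and AB: "near p A B \<sigma>" and pos: "\<forall>\<^sub>F n in sequentially. \<sigma> n > 0"
  shows "(\<lambda>n. opnorm p (op_diff (A n) (B n)) / \<sigma> n) \<longlonglongrightarrow> 0"
proof (rule tendstoI)
  fix e :: real assume e: "e > 0"
  then have "\<forall>\<^sub>F n in sequentially. \<forall>u C. C > 0 \<longrightarrow> Lple p C u \<longrightarrow> Lple p (e / 2 * \<sigma> n * C) (\<lambda>t. A n u t - B n u t)"
    using AB unfolding near_def by (meson half_gt_zero)
  with pos show "\<forall>\<^sub>F n in sequentially. dist (opnorm p (op_diff (A n) (B n)) / \<sigma> n) 0 < e"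
  proof eventually_elim
    case (elim n)
    have pos: "e / 2 * \<sigma> n \<ge> 0" using e elim by simp
    have bd: "pnorm p (op_diff (A n) (B n) u) \<le> e / 2 * \<sigma> n" if "Lple p 1 u" for u
    proof -
      have "Lple p (e / 2 * \<sigma> n * 1) (\<lambda>t. A n u t - B n u t)" using elim that zero_less_one by blast
      then show ?thesis using pos p by (intro pnorm_le) (auto simp: op_diff_def)
    qed
    have "0 \<le> opnorm p (op_diff (A n) (B n))" "opnorm p (op_diff (A n) (B n)) \<le> e / 2 * \<sigma> n"
      using opnorm_le[OF p pos bd] by auto
    moreover have "e / 2 * \<sigma> n < e * \<sigma> n" using e elim by simp
    ultimately show ?case using elim by (simp add: dist_real_def divide_less_eq)
  qed
qed

text \<open>A sandwich: with \<rho>, x, y the normalised values of \<open>B\<close> at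
  \<open>f\<close>, of \<open>A\<close> at \<open>f\<close>, and of the norm of \<open>A\<close>,
  eventually \<rho> - \<eta> \<le> x \<le> y \<le> 1 + \<eta>. As \<rho> tends to 1, so do x and y,
  and this gives the norm asymptotics and the extremality of \<open>f\<close> together. Homogeneity
  is used to normalise \<open>f n\<close>.\<close>

lemma opnorm_asymp:
  assumes p: "1 \<le> p" and AB: "near p A B \<sigma>" and pos: "\<forall>\<^sub>F n in sequentially. \<sigma> n > 0"
    and B: "\<forall>\<^sub>F n in sequentially. \<forall>u C. C > 0 \<longrightarrow> Lple p C u \<longrightarrow> Lple p (\<sigma> n * C) (B n u)"
    and hom: "\<And>n c u. A n (\<lambda>t. c * u t) = (\<lambda>t. c * A n u t)"
    and f: "\<forall>\<^sub>F n in sequentially. f n \<in> Lp p \<and> pnorm p (f n) > 0"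
    and lim: "(\<lambda>n. pnorm p (B n (f n)) / (\<sigma> n * pnorm p (f n))) \<longlonglongrightarrow> 1"
  shows "(\<lambda>n. opnorm p (A n) / \<sigma> n) \<longlonglongrightarrow> 1"
    "num_asymp (\<lambda>n. pnorm p (A n (f n))) (\<lambda>n. opnorm p (A n) * pnorm p (f n))"
proof -
  define \<rho> where "\<rho> n = pnorm p (B n (f n)) / (\<sigma> n * pnorm p (f n))" for n
  define x where "x n = pnorm p (A n (f n)) / (\<sigma> n * pnorm p (f n))" for n
  define y where "y n = opnorm p (A n) / \<sigma> n" for n
  have ev: "\<forall>\<^sub>F n in sequentially. \<rho> n - \<eta> \<le> x n \<and> x n \<le> y n \<and> y n \<le> 1 + \<eta>" if \<eta>: "\<eta> > 0" for \<eta>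
  proof -
    have "\<forall>\<^sub>F n in sequentially. \<forall>u C. C > 0 \<longrightarrow> Lple p C u \<longrightarrow> Lple p (\<eta> * \<sigma> n * C) (\<lambda>t. A n u t - B n u t)"
      using AB \<eta> unfolding near_def by blast
    with pos B f show ?thesis
    proof eventually_elim
      case (elim n)
      define N where "N = pnorm p (f n)"
      have N: "N > 0" and fL: "f n \<in> Lp p" using elim by (auto simp: N_def)
      have fN: "Lple p N (f n)" using fL p unfolding N_def by (intro Lple_pnorm)
      have s: "\<sigma> n > 0" using elim by blast
      have D: "Lple p (\<eta> * \<sigma> n * C) (\<lambda>t. A n u t - B n u t)" and BL: "Lple p (\<sigma> n * C) (B n u)"
        if "C > 0" "Lple p C u" for u C
        using elim that by blast+
      have DL: "(\<lambda>t. A n u t - B n u t) \<in> Lp p" "pnorm p (\<lambda>t. A n u t - B n u t) \<le> \<eta> * \<sigma> n * C"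
        and BLp: "B n u \<in> Lp p" "pnorm p (B n u) \<le> \<sigma> n * C"
        if "C > 0" "Lple p C u" for u C
      proof -
        have nn: "0 \<le> \<eta> * \<sigma> n * C" "0 \<le> \<sigma> n * C" using \<eta> s that by auto
        show "(\<lambda>t. A n u t - B n u t) \<in> Lp p" "pnorm p (\<lambda>t. A n u t - B n u t) \<le> \<eta> * \<sigma> n * C"
          using Lple_iff[OF p nn(1)] D[OF that] by auto
        show "B n u \<in> Lp p" "pnorm p (B n u) \<le> \<sigma> n * C"
          using Lple_iff[OF p nn(2)] BL[OF that] by auto
      qed
      have AL: "A n u \<in> Lp p" and An: "pnorm p (A n u) \<le> (1 + \<eta>) * \<sigma> n * C" if "C > 0" "Lple p C u" for u C
      proof -
        have eq: "A n u = (\<lambda>t. (A n u t - B n u t) + B n u t)" by simp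
        show "A n u \<in> Lp p" by (subst eq) (intro Lp_add p DL(1)[OF that] BLp(1)[OF that])
        have "pnorm p (A n u) \<le> pnorm p (\<lambda>t. A n u t - B n u t) + pnorm p (B n u)"
          by (subst eq) (intro pnorm_triangle p DL(1)[OF that] BLp(1)[OF that])
        also have "\<dots> \<le> \<eta> * \<sigma> n * C + \<sigma> n * C" by (intro add_mono DL(2)[OF that] BLp(2)[OF that])
        finally show "pnorm p (A n u) \<le> (1 + \<eta>) * \<sigma> n * C" by (simp add: algebra_simps)
      qed
      have K: "0 \<le> (1 + \<eta>) * \<sigma> n" using \<eta> s by simp
      have bd: "pnorm p (A n u) \<le> (1 + \<eta>) * \<sigma> n" if "Lple p 1 u" for u
        using An[of 1 u] that by simp
      have op_le: "opnorm p (A n) \<le> (1 + \<eta>) * \<sigma> n"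
        by (rule opnorm_le(1)[OF p K]) (rule bd)
      have le_op: "pnorm p (A n u) \<le> opnorm p (A n)" if "Lple p 1 u" for u
        by (rule opnorm_le(3)[OF p K _ that]) (rule bd)
      have "y n \<le> 1 + \<eta>" using op_le s by (simp add: y_def divide_le_eq)
      moreover have "x n \<le> y n"
      proof -
        have "Lple p (\<bar>1 / N\<bar> * N) (\<lambda>t. 1 / N * f n t)" using N by (intro Lple_cmult p fN) simp
        then have "Lple p 1 (\<lambda>t. 1 / N * f n t)" using N by simp
        from le_op[OF this] have "pnorm p (\<lambda>t. 1 / N * A n (f n) t) \<le> opnorm p (A n)"
          by (simp only: hom)
        then have "pnorm p (A n (f n)) / N \<le> opnorm p (A n)"
          using N AL[OF N fN] p by (simp only: pnorm_cmult) simp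
        then have "pnorm p (A n (f n)) / N / \<sigma> n \<le> opnorm p (A n) / \<sigma> n"
          using s by (intro divide_right_mono) auto
        then show ?thesis unfolding x_def y_def N_def[symmetric] by (simp add: mult.commute)
      qed
      moreover have "\<rho> n - \<eta> \<le> x n"
      proof -
        have eq: "B n (f n) = (\<lambda>t. A n (f n) t + (-1) * (A n (f n) t - B n (f n) t))" by simp
        have "pnorm p (B n (f n)) \<le> pnorm p (A n (f n)) + pnorm p (\<lambda>t. (-1) * (A n (f n) t - B n (f n) t))"
          by (subst eq) (intro pnorm_triangle p AL[OF N fN] Lp_cmult DL(1)[OF N fN])
        also have "pnorm p (\<lambda>t. (-1) * (A n (f n) t - B n (f n) t)) = \<bar>-1\<bar> * pnorm p (\<lambda>t. A n (f n) t - B n (f n) t)"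
          by (rule pnorm_cmult[OF p DL(1)[OF N fN]])
        also have "\<dots> \<le> \<eta> * \<sigma> n * N" using DL(2)[OF N fN] by simp
        finally have "pnorm p (B n (f n)) / (\<sigma> n * N) \<le> (pnorm p (A n (f n)) + \<eta> * \<sigma> n * N) / (\<sigma> n * N)"
          using s N by (intro divide_right_mono) auto
        also have "\<dots> = pnorm p (A n (f n)) / (\<sigma> n * N) + \<eta>" using s N by (simp add: field_simps)
        finally show ?thesis by (simp add: \<rho>_def x_def N_def)
      qed
      ultimately show ?case by simp
    qed
  qed
  have \<rho>: "\<rho> \<longlonglongrightarrow> 1" using lim unfolding \<rho>_def .
  have xy: "x \<longlonglongrightarrow> 1 \<and> y \<longlonglongrightarrow> 1"
  proof -
    have "\<forall>\<^sub>F n in sequentially. dist (x n) 1 < e \<and> dist (y n) 1 < e" if e: "e > 0" for e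
    proof -
      have "e / 2 > 0" using e by simp
      have "\<forall>\<^sub>F n in sequentially. dist (\<rho> n) 1 < e / 2" using tendstoD[OF \<rho> \<open>e / 2 > 0\<close>] .
      with ev[OF \<open>e / 2 > 0\<close>] show ?thesis
      proof eventually_elim
        case (elim n)
        have "\<rho> n - 1 < e / 2" "1 - \<rho> n < e / 2" using elim(2) unfolding dist_real_def by linarith+
        then have "x n - 1 < e" "1 - x n < e" "y n - 1 < e" "1 - y n < e" using elim(1) e by linarith+
        then show ?case unfolding dist_real_def by linarith
      qed
    qed
    then show ?thesis by (simp add: tendsto_iff eventually_conj_iff)
  qed
  then show "(\<lambda>n. opnorm p (A n) / \<sigma> n) \<longlonglongrightarrow> 1" by (simp add: y_def[abs_def])
  have "(\<lambda>n. x n / y n) \<longlonglongrightarrow> 1 / 1" using xy by (intro tendsto_divide) auto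
  moreover have "\<forall>\<^sub>F n in sequentially. x n / y n = pnorm p (A n (f n)) / (opnorm p (A n) * pnorm p (f n))"
    using pos by eventually_elim (simp add: x_def y_def)
  ultimately show "num_asymp (\<lambda>n. pnorm p (A n (f n))) (\<lambda>n. opnorm p (A n) * pnorm p (f n))"
    unfolding num_asymp_def by (simp add: tendsto_cong)
qed

lemma near_op_asymp:
  assumes p: "1 \<le> p" and AB: "near p A B \<sigma>" and pos: "\<forall>\<^sub>F n in sequentially. \<sigma> n > 0"
    and lim: "(\<lambda>n. opnorm p (A n) / \<sigma> n) \<longlonglongrightarrow> 1"
  shows "op_asymp p A B"
proof -
  have 1: "(\<lambda>n. opnorm p (op_diff (A n) (B n)) / \<sigma> n / (opnorm p (A n) / \<sigma> n)) \<longlonglongrightarrow> 0 / 1"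
    using near_op_diff[OF p AB pos] lim by (intro tendsto_divide) auto
  have 2: "\<forall>\<^sub>F n in sequentially. opnorm p (op_diff (A n) (B n)) / \<sigma> n / (opnorm p (A n) / \<sigma> n)
      = opnorm p (op_diff (A n) (B n)) / opnorm p (A n)"
    using pos by eventually_elim simp
  show ?thesis using Lim_transform_eventually[OF 1 2] by (simp add: op_asymp_def)
qed

lemma Vop_funpow_cmult: "(Vop k ^^ n) (\<lambda>t. c * u t) = (\<lambda>t. c * (Vop k ^^ n) u t)"
proof (induction n)
  case (Suc n)
  have "k (t - s) * (c * v s) = c * (k (t - s) * v s)" for t s v by simp
  then have "Vop k (\<lambda>t. c * v t) = (\<lambda>t. c * Vop k v t)" for v
    unfolding Vop_def by (simp only: set_integral_mult_right)
  with Suc show ?case by simp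
qed simp

section \<open>Extremal functions of the rank one operators\<close>

lemma Sop_exp_0:
  assumes "l + b > 0"
  shows "Sop l (\<lambda>s. exp (- b * s)) 0 = (1 - exp (- (l + b))) / (l + b)"
proof -
  have "Sop l (\<lambda>s. exp (- b * s)) 0 = integral\<^sup>L lborel (\<lambda>s. exp (- (l + b) * s) * indicator {0..1} s)"
    unfolding Sop_def set_lebesgue_integral_def
    by (rule lebesgue_integral_cong_AE_lborel)
      (auto simp: exp_add[symmetric] algebra_simps indicator_def)
  also have "\<dots> = - exp (- (l + b) * 1) / (l + b) - (- exp (- (l + b) * 0) / (l + b))"
  proof -
    define m where "m = l + b"
    show ?thesis
      unfolding m_def[symmetric]
      by (rule integral_FTC_Icc_real)
        (use assms in \<open>auto simp: m_def[symmetric] intro!: derivative_eq_intros continuous_intros\<close>)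
  qed
  also have "\<dots> = (1 - exp (- (l + b))) / (l + b)" by (simp add: diff_divide_distrib)
  finally show ?thesis .
qed

lemma pnorm_Sop:
  assumes p: "1 \<le> p"
  shows "pnorm p (Sop l u) = \<bar>Sop l u 0\<bar> * pnorm p (\<lambda>t. exp (l * t))"
proof -
  have "Sop l u = (\<lambda>t. Sop l u 0 * exp (l * t))"
    by (rule ext, subst Sop_factor) (simp add: mult.commute)
  then have "pnorm p (Sop l u) = pnorm p (\<lambda>t. Sop l u 0 * exp (l * t))" by simp
  then show ?thesis using pnorm_cmult[OF p Lp_exp[OF p], of "Sop l u 0"] by simp
qed

text \<open>For p = 1 the functional exp(-ls) has its supremum 1 at s = 0, so the mass of the test
  function must concentrate at 0 on a scale 1/b much shorter than 1/l. The loss is the factor 1/(1 +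
  l/b), up to terms exponentially small in l and b.\<close>

lemma Sop_extremal_1:
  fixes l b :: "nat \<Rightarrow> real"
  assumes l: "filterlim l at_top sequentially" and b: "filterlim b at_top sequentially"
    and lb: "(\<lambda>n. l n / b n) \<longlonglongrightarrow> 0"
  shows "(\<lambda>n. pnorm 1 (Sop (l n) (\<lambda>t. exp (- b n * t))) / (expnorm_dual 1 (l n) * expnorm 1 (l n) * pnorm 1 (\<lambda>t. exp (- b n * t)))) \<longlonglongrightarrow> 1"
proof -
  have "(\<lambda>n. (1 - exp (- l n)) * (1 - exp (- (l n + b n))) / (1 - exp (- b n)) / (1 + l n / b n)) \<longlonglongrightarrow> (1 - 0) * (1 - 0) / (1 - 0) / (1 + 0)"
    by (intro tendsto_intros lb filterlim_compose[OF exp_at_bot]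
        filterlim_compose[OF filterlim_uminus_at_bot_at_top] l b filterlim_at_top_add_at_top) auto
  moreover have "\<forall>\<^sub>F n in sequentially. (1 - exp (- l n)) * (1 - exp (- (l n + b n))) / (1 - exp (- b n)) / (1 + l n / b n)
     = pnorm 1 (Sop (l n) (\<lambda>t. exp (- b n * t))) / (expnorm_dual 1 (l n) * expnorm 1 (l n) * pnorm 1 (\<lambda>t. exp (- b n * t)))"
    using filterlim_at_top_dense[THEN iffD1, OF l, rule_format, of 0] filterlim_at_top_dense[THEN iffD1, OF b, rule_format, of 0]
  proof eventually_elim
    case (elim n)
    have 1: "pnorm 1 (\<lambda>t. exp (c * t)) = (exp c - 1) / c" if "c \<noteq> 0" for c
    proof -
      have "(exp c - 1) / c \<ge> 0" using that by (cases "c > 0") (auto simp: zero_le_divide_iff)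
      then have "((exp (1 * c) - 1) / (1 * c)) powr (1 / 1) = (exp c - 1) / c" by (simp only: mult_1 div_by_1 powr_one)
      then show ?thesis using pnorm_exp[OF order_refl that] by (simp only: one_ereal_def)
    qed
    define P where "P = 1 - exp (- l n)"
    define Q where "Q = 1 - exp (- (l n + b n))"
    define R where "R = 1 - exp (- b n)"
    have pos: "R > 0" "Q > 0" using elim by (auto simp: R_def Q_def)
    have nl: "pnorm 1 (\<lambda>t. exp (l n * t)) = exp (l n) * P / l n"
      using 1[of "l n"] elim by (simp add: P_def right_diff_distrib exp_add[symmetric])
    have nb: "pnorm 1 (\<lambda>t. exp (- b n * t)) = R / b n"
      using 1[of "- b n"] elim by (simp add: R_def minus_divide_left)
    have Q: "\<bar>Q / (l n + b n)\<bar> = Q / (l n + b n)" using pos elim by simp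
    have ke: "expnorm_dual 1 (l n) * expnorm 1 (l n) = exp (l n) / l n"
      using expnorm_dual_mult_expnorm[of 1 "l n"] elim by (simp add: Cp_def)
    have alg: "P * Q / R / (s / c) = Q / s * (X * P / L) / (X / L * (R / c))"
      if "X > 0" "R > 0" "s > 0" "c > 0" "L > 0" for P Q R s c X L :: real
      using that by (simp add: field_simps)
    have eq: "1 + l n / b n = (l n + b n) / b n" using elim by (simp add: field_simps)
    show ?case
      unfolding pnorm_Sop[OF order_refl] Sop_exp_0[of "l n" "b n", OF add_pos_pos[OF elim]] nl nb ke
        P_def[symmetric] Q_def[symmetric] R_def[symmetric] Q eq
      by (rule alg) (use elim pos in auto)
  qed
  ultimately show ?thesis by (simp add: tendsto_cong)
qed

text \<open>The pairing with the positive function exp(-ls) is maximised on the unit ball by the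
  constant 1. The factor 1 - exp(-l) appears only because \<open>expnorm_dual\<close> integrates
  over the half line.\<close>

lemma Sop_extremal_infinity:
  fixes l :: "nat \<Rightarrow> real"
  assumes l: "filterlim l at_top sequentially"
  shows "(\<lambda>n. pnorm \<infinity> (Sop (l n) (\<lambda>t. 1)) / (expnorm_dual \<infinity> (l n) * expnorm \<infinity> (l n) * pnorm \<infinity> (\<lambda>t. 1))) \<longlonglongrightarrow> 1"
proof -
  have "(\<lambda>n. 1 - exp (- l n)) \<longlonglongrightarrow> 1 - 0"
    by (intro tendsto_intros filterlim_compose[OF exp_at_bot] filterlim_compose[OF filterlim_uminus_at_bot_at_top] l)
  moreover have "\<forall>\<^sub>F n in sequentially. 1 - exp (- l n)
     = pnorm \<infinity> (Sop (l n) (\<lambda>t. 1)) / (expnorm_dual \<infinity> (l n) * expnorm \<infinity> (l n) * pnorm \<infinity> (\<lambda>t. 1))"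
    using filterlim_at_top_dense[THEN iffD1, OF l, rule_format, of 0]
  proof eventually_elim
    case (elim n)
    have "pnorm \<infinity> (\<lambda>t. 1) = 1" using pnorm_exp_infinity(1)[of 0] by simp
    moreover have "Sop (l n) (\<lambda>t. 1) 0 = (1 - exp (- l n)) / l n" using Sop_exp_0[of "l n" 0] elim by simp
    ultimately show ?case
      using elim pnorm_exp_infinity(1)[of "l n"] by (simp add: pnorm_Sop expnorm_dual_def expnorm_def abs_mult)
  qed
  ultimately show ?thesis by (simp add: tendsto_cong)
qed

text \<open>Equality in Hoelder's inequality requires f^p proportional to exp(-qls), that is f =
  exp(-(q/p)ls), and q/p = 1/(p - 1). The ratio differs from 1 only by the two exponentially small
  terms dropped in \<open>expnorm\<close> and \<open>expnorm_dual\<close>.\<close>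

lemma Sop_extremal_real:
  fixes l :: "nat \<Rightarrow> real"
  assumes l: "filterlim l at_top sequentially" and p: "p > 1"
  shows "(\<lambda>n. pnorm (ereal p) (Sop (l n) (\<lambda>t. exp (- (l n / (p - 1)) * t)))
     / (expnorm_dual (ereal p) (l n) * expnorm (ereal p) (l n) * pnorm (ereal p) (\<lambda>t. exp (- (l n / (p - 1)) * t)))) \<longlonglongrightarrow> 1"
proof -
  define q where "q = p / (p - 1)"
  have q: "q > 1" "1 / q + 1 / p = 1" using p by (auto simp: q_def field_simps)
  have ql: "filterlim (\<lambda>n. q * l n) at_top sequentially" "filterlim (\<lambda>n. p * l n) at_top sequentially"
    using p q by (auto intro!: filterlim_tendsto_pos_mult_at_top[OF tendsto_const _ l])
  have "(\<lambda>n. (1 - exp (- (q * l n))) powr (1 / q) * (1 - exp (- (p * l n))) powr (1 / p)) \<longlonglongrightarrow> (1 - 0) powr (1 / q) * (1 - 0) powr (1 / p)"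
    by (intro tendsto_intros filterlim_compose[OF exp_at_bot] filterlim_compose[OF filterlim_uminus_at_bot_at_top] ql) auto
  moreover have "\<forall>\<^sub>F n in sequentially. (1 - exp (- (q * l n))) powr (1 / q) * (1 - exp (- (p * l n))) powr (1 / p)
     = pnorm (ereal p) (Sop (l n) (\<lambda>t. exp (- (l n / (p - 1)) * t)))
     / (expnorm_dual (ereal p) (l n) * expnorm (ereal p) (l n) * pnorm (ereal p) (\<lambda>t. exp (- (l n / (p - 1)) * t)))"
    using filterlim_at_top_dense[THEN iffD1, OF l, rule_format, of 0]
  proof eventually_elim
    case (elim n)
    define L where "L = l n"
    have L: "L > 0" using elim by (simp add: L_def)
    have sum: "L + L / (p - 1) = q * L" using p by (simp add: q_def field_simps)
    define J where "J = (1 - exp (- (q * L))) / (q * L)"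
    define I where "I = (1 - exp (- (p * L))) / (p * L)"
    have J: "J > 0" and I: "I > 0" using q p L by (auto simp: J_def I_def)
    have S0: "Sop L (\<lambda>t. exp (- (L / (p - 1)) * t)) 0 = J"
      using Sop_exp_0[of L "L / (p - 1)"] q L unfolding sum by (simp add: J_def)
    have "(exp (p * L) - 1) / (p * L) = exp (p * L) * I" using p L by (simp add: I_def exp_minus field_simps)
    then have nL: "pnorm (ereal p) (\<lambda>t. exp (L * t)) = exp L * I powr (1 / p)"
      using pnorm_exp[of p L] p L I by (simp add: powr_mult powr_exp)
    have "(exp (p * (- (L / (p - 1)))) - 1) / (p * (- (L / (p - 1)))) = J"
      using p L by (simp add: J_def q_def field_simps)
    then have nf: "pnorm (ereal p) (\<lambda>t. exp (- (L / (p - 1)) * t)) = J powr (1 / p)"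
      using pnorm_exp[of p "- (L / (p - 1))"] p L by simp
    have p1: "1 \<le> ereal p" using p by (simp add: one_ereal_def)
    have JJ: "J = J powr (1 / q) * J powr (1 / p)" using J q by (simp add: powr_add[symmetric])
    have expnorm_dual: "expnorm_dual (ereal p) L = (1 / (q * L)) powr (1 / q)" using p by (simp add: expnorm_dual_def q_def Let_def one_ereal_def)
    have expnorm: "expnorm (ereal p) L = exp L * (1 / (p * L)) powr (1 / p)" by (simp add: expnorm_def)
    have "pnorm (ereal p) (Sop L (\<lambda>t. exp (- (L / (p - 1)) * t)))
       / (expnorm_dual (ereal p) L * expnorm (ereal p) L * pnorm (ereal p) (\<lambda>t. exp (- (L / (p - 1)) * t)))
       = J powr (1 / q) * J powr (1 / p) * (exp L * I powr (1 / p)) / ((1 / (q * L)) powr (1 / q) * (exp L * (1 / (p * L)) powr (1 / p)) * J powr (1 / p))"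
      unfolding pnorm_Sop[OF p1] S0 nL nf expnorm_dual expnorm abs_of_pos[OF J] JJ[symmetric] ..
    also have "\<dots> = (J / (1 / (q * L))) powr (1 / q) * (I / (1 / (p * L))) powr (1 / p)"
      using J I p q L by (simp add: powr_divide powr_mult mult_ac)
    also have "\<dots> = (1 - exp (- (q * L))) powr (1 / q) * (1 - exp (- (p * L))) powr (1 / p)"
      using p q L by (simp add: J_def I_def)
    finally show ?case by (simp add: L_def)
  qed
  ultimately show ?thesis by (simp add: tendsto_cong)
qed

lemma pnorm_exp_pos:
  assumes p: "p \<ge> 1" and b: "b \<noteq> 0"
  shows "pnorm (ereal p) (\<lambda>t. exp (b * t)) > 0"
proof -
  have "(exp (p * b) - 1) / (p * b) > 0"
  proof (cases "b > 0")
    case True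
    then have "p * b > 0" using p by simp
    then show ?thesis by (intro divide_pos_pos) auto
  next
    case False
    then have "p * b < 0" using p b by (simp add: mult_less_0_iff)
    then show ?thesis by (intro divide_neg_neg) auto
  qed
  then show ?thesis unfolding pnorm_exp[OF p b] using p b by simp
qed

section \<open>The two operator comparisons on the common scale, for large n\<close>

lemma near_Vop_Sop:
  fixes a \<mu> F :: real
  assumes p: "1 \<le> p" and a: "a > 0" and F: "F \<noteq> 0"
    and h: "\<And>t. t \<in> {0<..<1} \<Longrightarrow> h t = F * (Gamma a * pker \<mu> a t)"
  shows "near p (\<lambda>n. Vop h ^^ n)
    (\<lambda>n. op_scale (F ^ n * Gamma a ^ n * exp (- (a * real n - 1)) / Gamma (a * real n)) (Sop (a * real n - 1 + \<mu>)))
    (\<lambda>n. \<bar>F\<bar> ^ n * (Gamma a ^ n / Gamma (a * real n + 1)))"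
  unfolding near_def
proof (intro allI impI)
  fix \<eta> :: real assume \<eta>: "\<eta> > 0"
  have "filterlim (\<lambda>m. a * real (Suc m)) at_top sequentially" using a by real_asymp
  \<comment> \<open>The threshold is what makes exp |\<mu>| / (b(b - 1)) \<le> \<eta>/b, the right
    side being \<eta> times the scale because Gamma(b + 1) = b Gamma(b).\<close>
  then have "\<forall>\<^sub>F m in sequentially. a * real (Suc m) > 1 + exp \<bar>\<mu>\<bar> / \<eta>"
    by (simp only: filterlim_at_top_dense)
  then have "\<forall>\<^sub>F m in sequentially. \<forall>u C. C > 0 \<longrightarrow> Lple p C u \<longrightarrow>
     Lple p (\<eta> * (\<bar>F\<bar> ^ Suc m * (Gamma a ^ Suc m / Gamma (a * real (Suc m) + 1))) * C)
       (\<lambda>t. (Vop h ^^ Suc m) u t - op_scale (F ^ Suc m * Gamma a ^ Suc m * exp (- (a * real (Suc m) - 1)) / Gamma (a * real (Suc m))) (Sop (a * real (Suc m) - 1 + \<mu>)) u t)"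
  proof eventually_elim
    case (elim m)
    define b where "b = a * real (Suc m)"
    have b: "b > 1 + exp \<bar>\<mu>\<bar> / \<eta>" using elim by (simp only: b_def)
    have b1: "b > 1" using b \<eta> by (smt (verit) divide_nonneg_pos exp_ge_zero)
    have G: "Gamma a > 0" "Gamma b > 0" using a b1 by auto
    have "exp \<bar>\<mu>\<bar> * (1 / (b - 1) - 1 / b) \<le> \<eta> / b"
    proof -
      have "exp \<bar>\<mu>\<bar> \<le> \<eta> * (b - 1)" using b \<eta> by (simp add: field_simps)
      then have "exp \<bar>\<mu>\<bar> / (b * (b - 1)) \<le> \<eta> * (b - 1) / (b * (b - 1))"
        using b1 by (intro divide_right_mono) auto
      moreover have "1 / (b - 1) - 1 / b = 1 / (b * (b - 1))" using b1 by (simp add: field_simps)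
      ultimately show ?thesis using b1 by simp
    qed
    then have "\<bar>F\<bar> ^ Suc m * (Gamma a ^ Suc m / Gamma b) * (exp \<bar>\<mu>\<bar> * (1 / (b - 1) - 1 / b))
       \<le> \<bar>F\<bar> ^ Suc m * (Gamma a ^ Suc m / Gamma b) * (\<eta> / b)"
      using G by (intro mult_left_mono) auto
    also have "\<dots> = \<eta> * (\<bar>F\<bar> ^ Suc m * (Gamma a ^ Suc m / Gamma (b + 1)))"
      using b1 Gamma_plus1[of b] by (simp add: nonpos_Ints_def mult_ac)
    finally have le: "\<bar>F\<bar> ^ Suc m * (Gamma a ^ Suc m / Gamma b * exp \<bar>\<mu>\<bar> * (1 / (b - 1) - 1 / b))
       \<le> \<eta> * (\<bar>F\<bar> ^ Suc m * (Gamma a ^ Suc m / Gamma (b + 1)))" by (simp only: mult.assoc)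
    have nn: "0 \<le> \<bar>F\<bar> ^ Suc m * (Gamma a ^ Suc m / Gamma b * exp \<bar>\<mu>\<bar> * (1 / (b - 1) - 1 / b))"
      using G b1 by (intro mult_nonneg_nonneg) (auto simp: field_simps)
    show ?case
      unfolding op_scale_def b_def[symmetric]
    proof (intro allI impI)
      fix u C assume C: "(C::real) > 0" and u: "Lple p C u"
      show "Lple p (\<eta> * (\<bar>F\<bar> ^ Suc m * (Gamma a ^ Suc m / Gamma (b + 1))) * C)
          (\<lambda>t. (Vop h ^^ Suc m) u t - F ^ Suc m * Gamma a ^ Suc m * exp (- (b - 1)) / Gamma b * Sop (b - 1 + \<mu>) u t)"
        by (rule Lple_mono[OF Lple_Vop_diff_Sop[OF p a F b_def b1 h u less_imp_le[OF C]]])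
          (use p C le nn in \<open>simp_all only: mult_right_mono mult_nonneg_nonneg less_imp_le\<close>)
    qed
  qed
  then show "\<forall>\<^sub>F n in sequentially. \<forall>u C. C > 0 \<longrightarrow> Lple p C u \<longrightarrow>
     Lple p (\<eta> * (\<bar>F\<bar> ^ n * (Gamma a ^ n / Gamma (a * real n + 1))) * C)
       (\<lambda>t. (Vop h ^^ n) u t - op_scale (F ^ n * Gamma a ^ n * exp (- (a * real n - 1)) / Gamma (a * real n)) (Sop (a * real n - 1 + \<mu>)) u t)"
    by (rule eventually_sequentially_Suc[THEN iffD1])
qed

text \<open>The order of choices matters: \<epsilon> is fixed by \<eta> so that the pointwise error
  is below \<eta>/2; this determines \<delta> and M; only then is n taken large enough for the far
  error to fall below \<eta>/2.\<close>

lemma near_Vop_Vop: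
  fixes k f :: "real \<Rightarrow> real"
  assumes p: "1 \<le> p" and k_L1: "integrable M01 k" and k_def: "\<And>t. t \<in> {0<..<1} \<Longrightarrow> k t = t powr (a - 1) * f t"
    and a: "a > 0" and f0: "f 0 \<noteq> 0" and fderiv: "(f has_real_derivative f') (at_right 0)"
    and mu: "\<mu> = f' / f 0"
    and h: "\<And>t. t \<in> {0<..<1} \<Longrightarrow> h t = f 0 * (Gamma a * pker \<mu> a t)"
  shows "near p (\<lambda>n. Vop k ^^ n) (\<lambda>n. Vop h ^^ n) (\<lambda>n. \<bar>f 0\<bar> ^ n * (Gamma a ^ n / Gamma (a * real n + 1)))"
  unfolding near_def
proof (intro allI impI)
  fix \<eta> :: real assume \<eta>: "\<eta> > 0"
  have "((\<lambda>e. exp \<bar>\<mu>\<bar> * (exp e - 1)) \<longlongrightarrow> exp \<bar>\<mu>\<bar> * (exp 0 - 1)) (at_right 0)"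
    by (intro tendsto_intros)
  then have "eventually (\<lambda>e. exp \<bar>\<mu>\<bar> * (exp e - 1) < \<eta> / 2) (at_right 0)"
    by (rule order_tendstoD) (use \<eta> in simp)
  moreover have "eventually (\<lambda>e::real. e > 0) (at_right 0)" by (simp add: eventually_at_right_less)
  ultimately have "eventually (\<lambda>e. exp \<bar>\<mu>\<bar> * (exp e - 1) < \<eta> / 2 \<and> e > 0) (at_right 0)"
    by (rule eventually_conj)
  then obtain \<epsilon> where \<epsilon>: "exp \<bar>\<mu>\<bar> * (exp \<epsilon> - 1) < \<eta> / 2" "\<epsilon> > 0"
    using eventually_happens' trivial_limit_at_right_real by blast
  obtain K d \<delta> M where K: "K \<in> borel_measurable borel" "d \<in> borel_measurable borel" "\<delta> > 0" "M > 0"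
    "AE x in lborel. x \<in> {0<..<1} \<longrightarrow> k x = f 0 * K x" "\<And>x. x \<le> 0 \<Longrightarrow> K x = 0"
    "\<And>x. ennreal \<bar>K x - Gamma a * pker \<mu> a x\<bar>
       \<le> ennreal (Gamma a * pker (\<mu> + \<epsilon>) a x - Gamma a * pker \<mu> a x) + d x"
    "(\<integral>\<^sup>+t. d t \<partial>lborel) \<le> ennreal M" "\<And>x. x < \<delta> \<Longrightarrow> d x = 0"
    by (rule local_kernel_approximation[OF k_L1 _ a f0 fderiv \<epsilon>(2) mu]) (erule k_def, rule that)
  define Y where "Y n = exp (\<mu> + \<epsilon> + 1) * (a * real n + 1)
         * (exp (real n * (M * exp (- (a * real n + (\<mu> + \<epsilon>)) * \<delta>) * (a * real n) powr a / Gamma a)) - 1)" for n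
  have "Y \<longlonglongrightarrow> 0" unfolding Y_def using a K(3,4) by (intro far_bound_tendsto_0) auto
  then have "\<forall>\<^sub>F n in sequentially. Y n < \<eta> / 2" using \<eta> by (intro order_tendstoD) auto
  then have "\<forall>\<^sub>F m in sequentially. Y (Suc m) < \<eta> / 2" by (subst eventually_sequentially_Suc)
  moreover have "\<forall>\<^sub>F m in sequentially. a * real (Suc m) + \<mu> + \<epsilon> \<ge> 0"
    using a by real_asymp
  ultimately have "\<forall>\<^sub>F m in sequentially. \<forall>u C. C > 0 \<longrightarrow> Lple p C u \<longrightarrow>
     Lple p (\<eta> * (\<bar>f 0\<bar> ^ Suc m * (Gamma a ^ Suc m / Gamma (a * real (Suc m) + 1))) * C)
       (\<lambda>t. (Vop k ^^ Suc m) u t - (Vop h ^^ Suc m) u t)"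
  proof eventually_elim
    case (elim m)
    define W where "W = Gamma a ^ Suc m / Gamma (a * real (Suc m) + 1)"
    have W: "W > 0" unfolding W_def using a
      by (intro divide_pos_pos zero_less_power Gamma_real_pos) (auto intro!: add_nonneg_pos)
    have "(\<integral>\<^sup>+t. nnrem (\<lambda>t. ennreal (Gamma a * pker \<mu> a t))
        (\<lambda>t. ennreal (Gamma a * pker (\<mu> + \<epsilon>) a t - Gamma a * pker \<mu> a t) + d t) m t * indicator {..1} t \<partial>lborel)
       \<le> ennreal (W * (exp \<bar>\<mu>\<bar> * (exp \<epsilon> - 1) + Y (Suc m)))"
      unfolding W_def Y_def using elim K by (intro nnrem_bound a \<epsilon>(2)) auto
    also have "\<dots> \<le> ennreal (\<eta> * W)"
    proof (rule ennreal_leI)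
      have "W * (exp \<bar>\<mu>\<bar> * (exp \<epsilon> - 1) + Y (Suc m)) \<le> W * \<eta>"
        using W elim \<epsilon>(1) by (intro mult_left_mono) auto
      then show "W * (exp \<bar>\<mu>\<bar> * (exp \<epsilon> - 1) + Y (Suc m)) \<le> \<eta> * W" by (simp add: mult.commute)
    qed
    finally have bd: "(\<integral>\<^sup>+t. nnrem (\<lambda>t. ennreal (Gamma a * pker \<mu> a t))
        (\<lambda>t. ennreal (Gamma a * pker (\<mu> + \<epsilon>) a t - Gamma a * pker \<mu> a t) + d t) m t * indicator {..1} t \<partial>lborel)
       \<le> ennreal (\<eta> * W)" .
    have Wp: "\<eta> * W > 0" using W \<eta> by simp
    show ?case unfolding W_def[symmetric]
    proof (intro allI impI)
      fix u C assume C: "(C::real) > 0" and u: "Lple p C u"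
      have "Lple p (\<bar>f 0\<bar> ^ Suc m * (\<eta> * W) * C) (\<lambda>t. (Vop k ^^ Suc m) u t - (Vop h ^^ Suc m) u t)"
        by (rule Lple_Vop_diff_Vop[OF p a \<epsilon>(2) K(1,2) h K(5,6,7,8) Wp bd u less_imp_le[OF C] f0])
          (use K(3,9) in auto)
      then show "Lple p (\<eta> * (\<bar>f 0\<bar> ^ Suc m * W) * C) (\<lambda>t. (Vop k ^^ Suc m) u t - (Vop h ^^ Suc m) u t)"
        by (simp only: mult_ac)
    qed
  qed
  then show "\<forall>\<^sub>F n in sequentially. \<forall>u C. C > 0 \<longrightarrow> Lple p C u \<longrightarrow>
     Lple p (\<eta> * (\<bar>f 0\<bar> ^ n * (Gamma a ^ n / Gamma (a * real n + 1))) * C)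
       (\<lambda>t. (Vop k ^^ n) u t - (Vop h ^^ n) u t)"
    by (rule eventually_sequentially_Suc[THEN iffD1])
qed

section \<open>Assembly of the norm asymptotics and of the extremal sequences\<close>

theorem theorem4p3:
  fixes k f :: "real \<Rightarrow> real" and r f'0 :: real and p :: ereal
  assumes k_L1: "integrable M01 k"
    and k_def: "\<And>t. t \<in> {0<..<1} \<Longrightarrow> k t = t powr r * f t"
    and r_gt: "r > -1"
    and f0: "f 0 \<noteq> 0"
    and fderiv: "(f has_real_derivative f'0) (at_right 0)"
    and p_ge: "1 \<le> p"
  defines "\<mu> \<equiv> f'0 / f 0"
    and "h \<equiv> (\<lambda>t. f 0 * t powr r * exp (f'0 / f 0 * t))"
  shows "op_asymp p (\<lambda>n. Vop k ^^ n) (\<lambda>n. Vop h ^^ n)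
    \<and> op_asymp p (\<lambda>n. Vop k ^^ n)
        (\<lambda>n. op_scale (f 0 ^ n * Gamma (r + 1) ^ n * exp (- ((r + 1) * real n - 1))
                        / Gamma ((r + 1) * real n))
               (Sop ((r + 1) * real n - 1 + \<mu>)))
    \<and> num_asymp (\<lambda>n. opnorm p (Vop k ^^ n))
        (\<lambda>n. Cp p * (\<bar>f 0\<bar> * Gamma (r + 1)) ^ n * exp \<mu> / Gamma ((r + 1) * real n + 1))
    \<and> (p = 1 \<longrightarrow> (\<forall>g :: nat \<Rightarrow> real. filterlim g at_top sequentially \<longrightarrow>
          (let fn = (\<lambda>n t. exp (- g n * real n * t)) in
           num_asymp (\<lambda>n. pnorm p ((Vop k ^^ n) (fn n)))
                     (\<lambda>n. opnorm p (Vop k ^^ n) * pnorm p (fn n)))))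
    \<and> (1 < p \<and> p < \<infinity> \<longrightarrow>
          (let fn = (\<lambda>n t. exp (- ((r + 1) * real n - 1 + \<mu>) * t / (real_of_ereal p - 1))) in
           num_asymp (\<lambda>n. pnorm p ((Vop k ^^ n) (fn n)))
                     (\<lambda>n. opnorm p (Vop k ^^ n) * pnorm p (fn n))))
    \<and> (p = \<infinity> \<longrightarrow>
          (let fn = (\<lambda>n (t::real). 1::real) in
           num_asymp (\<lambda>n. pnorm p ((Vop k ^^ n) (fn n)))
                     (\<lambda>n. opnorm p (Vop k ^^ n) * pnorm p (fn n))))"
proof -
  define a where "a = r + 1"
  have a: "a > 0" using r_gt by (simp add: a_def)
  have Ga: "Gamma a > 0" using a by simp
  define l where "l n = a * real n - 1 + \<mu>" for n
  define c where "c n = f 0 ^ n * Gamma a ^ n * exp (- (a * real n - 1)) / Gamma (a * real n)" for n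
  define A where "A n = Vop k ^^ n" for n
  define B where "B n = op_scale (c n) (Sop (l n))" for n
  \<comment> \<open>Two scales: \<tau> comes from the kernel estimates and does not involve p, while
    \<sigma> is the Hoelder bound for the norm of \<open>B n\<close>, against which extremality is
    measured.\<close>
  define \<tau> where "\<tau> n = \<bar>f 0\<bar> ^ n * (Gamma a ^ n / Gamma (a * real n + 1))" for n
  define \<sigma> where "\<sigma> n = \<bar>c n\<bar> * (expnorm_dual p (l n) * expnorm p (l n))" for n
  define T where "T n = Cp p * (\<bar>f 0\<bar> * Gamma a) ^ n * exp \<mu> / Gamma (a * real n + 1)" for n
  have k': "k t = t powr (a - 1) * f t" if "t \<in> {0<..<1}" for t using k_def[OF that] by (simp add: a_def)
  have h': "h t = f 0 * (Gamma a * pker \<mu> a t)" if "t \<in> {0<..<1}" for t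
    using that less_imp_neq[OF Ga] by (simp add: h_def pker_def \<mu>_def a_def)
  have C: "Cp p > 0"
    using p_ge by (cases rule: ereal_ge_1_cases) (auto simp: Cp_def Let_def one_ereal_def)
  have l_top: "filterlim l at_top sequentially" unfolding l_def using a by real_asymp
  have l_pos: "\<forall>\<^sub>F n in sequentially. l n > 0" using l_top by (simp only: filterlim_at_top_dense)
  have \<tau>: "\<tau> n > 0" for n
    unfolding \<tau>_def using f0 a by (intro mult_pos_pos divide_pos_pos zero_less_power Gamma_real_pos) (auto intro!: add_nonneg_pos)
  have T: "T n = Cp p * exp \<mu> * \<tau> n" for n
    by (simp add: T_def \<tau>_def power_mult_distrib)
  \<comment> \<open>The shift of the exponent by \<open>\<mu>\<close> survives as the factor exp
    \<mu>; having \<open>l n\<close> instead of an in the denominator costs a factor tending to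
    1.\<close>
  have \<sigma>_eq: "\<forall>\<^sub>F n in sequentially. \<sigma> n = T n * (a * real n / l n)"
    using l_pos eventually_gt_at_top[of 0]
  proof eventually_elim
    case (elim n)
    define b where "b = a * real n"
    have b: "b > 0" using a elim by (simp add: b_def)
    define G where "G = (\<bar>f 0\<bar> * Gamma a) ^ n"
    have 1: "\<bar>c n\<bar> = G * exp (- (b - 1)) / Gamma b"
      using Ga b Gamma_real_pos[OF b] by (simp add: c_def G_def b_def[symmetric] abs_mult power_abs power_mult_distrib)
    have 2: "exp (- (b - 1)) * exp (l n) = exp \<mu>"
      by (simp add: l_def b_def exp_add[symmetric])
    have 3: "Gamma (b + 1) = b * Gamma b" using b by (intro Gamma_plus1) (auto simp: nonpos_Ints_def)
    have "\<sigma> n = Cp p * G * (exp (- (b - 1)) * exp (l n)) / (Gamma b * l n)"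
      unfolding \<sigma>_def expnorm_dual_mult_expnorm[OF p_ge elim(1)] 1 by simp
    also have "\<dots> = Cp p * G * exp \<mu> / Gamma (b + 1) * (b / l n)"
      unfolding 2 3 using b by simp
    finally show ?case by (simp add: T_def G_def b_def)
  qed
  have \<sigma>_pos: "\<forall>\<^sub>F n in sequentially. \<sigma> n > 0"
    using \<sigma>_eq l_pos eventually_gt_at_top[of 0]
    by eventually_elim (use a C \<tau> in \<open>simp add: T\<close>)
  have ratio: "(\<lambda>n. a * real n / l n) \<longlonglongrightarrow> 1" unfolding l_def using a by real_asymp
  have \<sigma>T: "(\<lambda>n. \<sigma> n / T n) \<longlonglongrightarrow> 1"
  proof (rule Lim_transform_eventually[OF ratio])
    show "\<forall>\<^sub>F n in sequentially. a * real n / l n = \<sigma> n / T n"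
      using \<sigma>_eq
    proof eventually_elim
      case (elim n)
      then show ?case using \<tau>[of n] C by (simp add: T)
    qed
  qed
  \<comment> \<open>The constant comes from \<sigma>/T > 1/2 together with T = C_p exp(\<mu>)
    \<tau>.\<close>
  have \<tau>\<sigma>: "\<forall>\<^sub>F n in sequentially. 0 < \<tau> n \<and> \<tau> n \<le> 2 / (Cp p * exp \<mu>) * \<sigma> n"
  proof -
    have "\<forall>\<^sub>F n in sequentially. \<sigma> n / T n > 1 / 2" using \<sigma>T by (rule order_tendstoD) simp
    then show ?thesis
    proof eventually_elim
      case (elim n)
      then show ?case using \<tau>[of n] C by (simp add: T field_simps)
    qed
  qed
  have K: "2 / (Cp p * exp \<mu>) > 0" using C by simp
  have AH: "near p A (\<lambda>n. Vop h ^^ n) \<tau>"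
    unfolding A_def \<tau>_def by (rule near_Vop_Vop[OF p_ge k_L1 k' a f0 fderiv _ h']) (simp_all add: \<mu>_def)
  have HB: "near p (\<lambda>n. Vop h ^^ n) B \<tau>"
    unfolding B_def \<tau>_def c_def l_def by (rule near_Vop_Sop[OF p_ge a f0 h'])
  have AB: "near p A B \<tau>" using near_trans[OF p_ge AH HB] \<tau> by simp
  note AH\<sigma> = near_rescale[OF p_ge AH K \<tau>\<sigma>]
  note AB\<sigma> = near_rescale[OF p_ge AB K \<tau>\<sigma>]
  have B_bd: "\<forall>\<^sub>F n in sequentially. \<forall>u C. C > 0 \<longrightarrow> Lple p C u \<longrightarrow> Lple p (\<sigma> n * C) (B n u)"
    using l_pos
  proof eventually_elim
    case (elim n)
    show ?case
    proof (intro allI impI)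
      fix u C assume C: "(C::real) > 0" and u: "Lple p C u"
      have "Lple p (\<bar>c n\<bar> * (expnorm_dual p (l n) * expnorm p (l n) * C)) (\<lambda>t. c n * Sop (l n) u t)"
        using C expnorm_dual_nonneg[OF elim, of p] expnorm_nonneg[of p "l n"]
        by (intro Lple_cmult p_ge Lple_Sop u elim) auto
      then show "Lple p (\<sigma> n * C) (B n u)" by (simp add: \<sigma>_def B_def op_scale_def mult.assoc)
    qed
  qed
  have hom: "A n (\<lambda>t. c * u t) = (\<lambda>t. c * A n u t)" for n c u
    unfolding A_def by (rule Vop_funpow_cmult)
  have main: "(\<lambda>n. opnorm p (A n) / \<sigma> n) \<longlonglongrightarrow> 1 \<and>
      num_asymp (\<lambda>n. pnorm p (A n (fn n))) (\<lambda>n. opnorm p (A n) * pnorm p (fn n))"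
    if fn: "\<And>n. fn n \<in> Lp p" "\<forall>\<^sub>F n in sequentially. pnorm p (fn n) > 0"
      and lim: "(\<lambda>n. pnorm p (Sop (l n) (fn n)) / (expnorm_dual p (l n) * expnorm p (l n) * pnorm p (fn n))) \<longlonglongrightarrow> 1" for fn
  proof -
    have "\<forall>\<^sub>F n in sequentially. pnorm p (Sop (l n) (fn n)) / (expnorm_dual p (l n) * expnorm p (l n) * pnorm p (fn n))
        = pnorm p (B n (fn n)) / (\<sigma> n * pnorm p (fn n))"
      using \<sigma>_pos l_pos
    proof eventually_elim
      case (elim n)
      have "Lple p (pnorm p (fn n) + 1) (fn n)"
        using Lple_mono[OF Lple_pnorm[OF p_ge fn(1)]] pnorm_nonneg p_ge by simp
      from Lple_Sop[OF p_ge this _ elim(2)] have "Sop (l n) (fn n) \<in> Lp p"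
        using pnorm_nonneg[of p "fn n"] expnorm_dual_nonneg[OF elim(2), of p] expnorm_nonneg[of p "l n"]
        by (intro Lple_Lp[OF p_ge]) (auto simp: add_nonneg_pos)
      then have "pnorm p (B n (fn n)) = \<bar>c n\<bar> * pnorm p (Sop (l n) (fn n))"
        by (simp add: B_def op_scale_def pnorm_cmult[OF p_ge])
      moreover have "\<bar>c n\<bar> \<noteq> 0" using elim by (auto simp: \<sigma>_def)
      ultimately show ?case by (simp add: \<sigma>_def mult.assoc)
    qed
    from Lim_transform_eventually[OF lim this]
    have lim': "(\<lambda>n. pnorm p (B n (fn n)) / (\<sigma> n * pnorm p (fn n))) \<longlonglongrightarrow> 1" .
    have "\<forall>\<^sub>F n in sequentially. fn n \<in> Lp p \<and> pnorm p (fn n) > 0"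
      using fn(2) by eventually_elim (simp add: fn(1))
    from opnorm_asymp[OF p_ge AB\<sigma> \<sigma>_pos B_bd hom this lim'] show ?thesis ..
  qed
  have p1: "(\<lambda>n. opnorm p (A n) / \<sigma> n) \<longlonglongrightarrow> 1 \<and>
      num_asymp (\<lambda>n. pnorm p (A n (\<lambda>t. exp (- g n * real n * t)))) (\<lambda>n. opnorm p (A n) * pnorm p (\<lambda>t. exp (- g n * real n * t)))"
    if p: "p = 1" and g: "filterlim g at_top sequentially" for g :: "nat \<Rightarrow> real"
  proof (rule main)
    define b where "b n = g n * real n" for n
    have b: "filterlim b at_top sequentially"
      unfolding b_def using g by (rule filterlim_at_top_mult_at_top) (rule filterlim_real_sequentially)
    have bpos: "\<forall>\<^sub>F n in sequentially. b n > 0" using b by (simp only: filterlim_at_top_dense)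
    \<comment> \<open>As \<open>l n\<close> grows like an, the hypothesis that g tends to infinity
      makes g(n)n outgrow \<open>l n\<close>, the concentration needed for p = 1.\<close>
    have "(\<lambda>n. l n / real n) \<longlonglongrightarrow> a" unfolding l_def using a by real_asymp
    then have "(\<lambda>n. l n / real n / g n) \<longlonglongrightarrow> 0"
      by (rule tendsto_divide_0) (rule filterlim_at_top_imp_at_infinity[OF g])
    then have lb: "(\<lambda>n. l n / b n) \<longlonglongrightarrow> 0" by (simp add: b_def mult.commute)
    show "(\<lambda>n. pnorm p (Sop (l n) (\<lambda>t. exp (- g n * real n * t))) / (expnorm_dual p (l n) * expnorm p (l n) * pnorm p (\<lambda>t. exp (- g n * real n * t)))) \<longlonglongrightarrow> 1"
      using Sop_extremal_1[OF l_top b lb] by (simp add: p b_def)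
    show "(\<lambda>t. exp (- g n * real n * t)) \<in> Lp p" for n by (rule Lp_exp[OF p_ge])
    show "\<forall>\<^sub>F n in sequentially. pnorm p (\<lambda>t. exp (- g n * real n * t)) > 0"
      using bpos
    proof eventually_elim
      case (elim n)
      then have "- b n \<noteq> 0" by simp
      from pnorm_exp_pos[OF order_refl this] show ?case by (simp add: b_def p one_ereal_def)
    qed
  qed
  have p2: "(\<lambda>n. opnorm p (A n) / \<sigma> n) \<longlonglongrightarrow> 1 \<and>
      num_asymp (\<lambda>n. pnorm p (A n (\<lambda>t. exp (- l n * t / (real_of_ereal p - 1))))) (\<lambda>n. opnorm p (A n) * pnorm p (\<lambda>t. exp (- l n * t / (real_of_ereal p - 1))))"
    if p: "1 < p" "p < \<infinity>"
  proof (rule main)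
    obtain p' where p': "p = ereal p'" "p' > 1" using p by (cases p) (auto simp: one_ereal_def)
    have eq: "(\<lambda>t. exp (- l n * t / (real_of_ereal p - 1))) = (\<lambda>t. exp (- (l n / (p' - 1)) * t))" for n
      by (simp add: p')
    show "(\<lambda>n. pnorm p (Sop (l n) (\<lambda>t. exp (- l n * t / (real_of_ereal p - 1)))) / (expnorm_dual p (l n) * expnorm p (l n) * pnorm p (\<lambda>t. exp (- l n * t / (real_of_ereal p - 1))))) \<longlonglongrightarrow> 1"
      unfolding eq using Sop_extremal_real[OF l_top p'(2)] by (simp only: p'(1))
    show "(\<lambda>t. exp (- l n * t / (real_of_ereal p - 1))) \<in> Lp p" for n unfolding eq by (rule Lp_exp[OF p_ge])
    show "\<forall>\<^sub>F n in sequentially. pnorm p (\<lambda>t. exp (- l n * t / (real_of_ereal p - 1))) > 0"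
      using l_pos
    proof eventually_elim
      case (elim n)
      then show ?case using pnorm_exp_pos[of p' "- (l n / (p' - 1))"] p' elim unfolding eq by simp
    qed
  qed
  have p3: "(\<lambda>n. opnorm p (A n) / \<sigma> n) \<longlonglongrightarrow> 1 \<and>
      num_asymp (\<lambda>n. pnorm p (A n (\<lambda>t. 1))) (\<lambda>n. opnorm p (A n) * pnorm p (\<lambda>t. 1))"
    if p: "p = \<infinity>"
  proof (rule main)
    show "(\<lambda>n. pnorm p (Sop (l n) (\<lambda>t. 1)) / (expnorm_dual p (l n) * expnorm p (l n) * pnorm p (\<lambda>t. 1))) \<longlonglongrightarrow> 1"
      using Sop_extremal_infinity[OF l_top] by (simp only: p)
    show "(\<lambda>t. 1) \<in> Lp p" "\<forall>\<^sub>F n in sequentially. pnorm p (\<lambda>t. 1) > 0"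
      using pnorm_exp_infinity[of 0] by (simp_all add: p)
  qed
  have op: "(\<lambda>n. opnorm p (A n) / \<sigma> n) \<longlonglongrightarrow> 1"
  proof -
    consider "p = 1" | "1 < p" "p < \<infinity>" | "p = \<infinity>"
      using p_ge by (metis ereal_infty_less(1) le_less)
    \<comment> \<open>The norm asymptotics needs some extremal sequence; for p = 1 the choice g(n) =
      n provides one.\<close>
    then show ?thesis using p1[OF _ filterlim_real_sequentially] p2 p3 by cases auto
  qed
  have opT: "num_asymp (\<lambda>n. opnorm p (A n)) T"
  proof -
    have 1: "(\<lambda>n. opnorm p (A n) / \<sigma> n * (\<sigma> n / T n)) \<longlonglongrightarrow> 1 * 1" by (intro tendsto_mult op \<sigma>T)
    have 2: "\<forall>\<^sub>F n in sequentially. opnorm p (A n) / \<sigma> n * (\<sigma> n / T n) = opnorm p (A n) / T n"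
      using \<sigma>_pos by eventually_elim simp
    show ?thesis using Lim_transform_eventually[OF 1 2] by (simp add: num_asymp_def)
  qed
  have "op_asymp p A (\<lambda>n. Vop h ^^ n)" by (rule near_op_asymp[OF p_ge AH\<sigma> \<sigma>_pos op])
  moreover have "op_asymp p A B" by (rule near_op_asymp[OF p_ge AB\<sigma> \<sigma>_pos op])
  ultimately show ?thesis
    using opT p1 p2 p3
    unfolding A_def[abs_def] B_def[abs_def] T_def[abs_def] c_def[abs_def] l_def[abs_def] a_def Let_def by blast
qed

end
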